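(* Let $W=\bigoplus_{k=1}^r V_{d_k}$ ($r\ge1$) be a finite-dimensional $\mathrm{SL}_2$-representation with $W^{\mathrm{SL}_2}=\{0\}$ (so all $d_k\ge1$), let $L\ge0$ be an integer, let $e$ be the number of $k$ with $d_k$ even, and set $\nu_{W,L}=L+1-\sum_{(k,i)\in\Lambda}a_{k,i}$. For $0<|t|<1$ put $$F(t)=\lim_{\boldsymbol b\to\boldsymbol a}\ \sum_{(K,I)\in\Lambda}\ \sum_{\zeta^{a_{K,I}}=1}\frac{\zeta^{-L}t^{-L/b_{K,I}}-\zeta^{L+2}t^{(L+2)/b_{K,I}}}{b_{K,I}(1-t^2)(1-t)^e\prod\limits_{(k,i)\in\Lambda\smallsetminus\{(K,I)\}}\big(1-\zeta^{-a_{k,i}}t^{(b_{K,I}-b_{k,i})/b_{K,I}}\big)\big(1-\zeta^{a_{k,i}}t^{(b_{K,I}+b_{k,i})/b_{K,I}}\big)}.$$ If $\nu_{W,L}\le0$, then the Hilbert series of the module of covariants $W\to V_L$ is $$\mathrm{Hilb}_{(\mathbb{C}[W]\otimes V_L)^{\mathrm{SL}_2}}(t)=F(t).$$ If $\nu_{W,L}>0$, then $$\mathrm{Hilb}_{(\mathbb{C}[W]\otimes V_L)^{\mathrm{SL}_2}}(t)=F(t)+\frac{(-1)^C}{(1-t)^e}\sum_{S}\ \prod_{(k,i)\in\Lambda}t^{I_{k,i}-J_{k,i}-1},$$ where the sum runs over all $(I_{k,i},J_{k,i})_{(k,i)\in\Lambda}$ in $$S=\Big\{(I_{k,i},J_{k,i})_{(k,i)\in\Lambda}\in\mathbb{Z}_{\ge0}^{2C}\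 :\ \sum_{(k,i)\in\Lambda}(I_{k,i}+J_{k,i})a_{k,i}=\nu_{W,L}-1\Big\}.$$
   Context: $V_d$ denotes the irreducible $\mathrm{SL}_2=\mathrm{SL}_2(\mathbb C)$-module of dimension $d+1$ (binary forms of degree $d$). Set $a_{k,i}=2i-d_k$ and $\Lambda=\{(k,i)\in\mathbb Z^2:1\le k\le r,\ \lfloor d_k/2\rfloor+1\le i\le d_k\}$, so that $\boldsymbol a=(a_{k,i})_{(k,i)\in\Lambda}$ lists the positive weights of $W$ with multiplicity; $C=|\Lambda|$. $\mathrm{Hilb}_{(\mathbb{C}[W]\otimes V_L)^{\mathrm{SL}_2}}(t)=\sum_{n\ge0}\dim_{\mathbb C}\big((\mathbb{C}[W]_n\otimes V_L)^{\mathrm{SL}_2}\big)t^n$, graded by polynomial degree; it converges for $|t|<1$. The limit is over real vectors $\boldsymbol b=(b_{k,i})_{(k,i)\in\Lambda}$ with pairwise distinct positive entries tending to $\boldsymbol a$ (the claim includes that the limit exists). Non-integral powers of $t$ are $t^x=\exp(x\log t)$ for a fixed choice of $\log t$. The inner sum is over all complex $a_{K,I}$-th roots of unity $\zeta$. *)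

theory Defs
  imports "HOL-Analysis.Analysis" "HOL-Library.Function_Algebras"
begin

section \<open>Complex vector spaces of functions\<close>

definition fscale :: "complex \<Rightarrow> ('a \<Rightarrow> complex) \<Rightarrow> 'a \<Rightarrow> complex" where
  "fscale c f = (\<lambda>x. c * f x)"

text \<open>The functions \<open>cfun.span\<close> and \<open>cfun.dim\<close> below are the span and the dimension over the
  complex numbers (not over the reals).\<close>

global_interpretation cfun: vector_space "fscale :: complex \<Rightarrow> ('a \<Rightarrow> complex) \<Rightarrow> 'a \<Rightarrow> complex"
  by standard (auto simp: fscale_def fun_eq_iff algebra_simps)

text \<open>For spaces \<open>U\<close>, \<open>V\<close> of complex functions on sets \<open>X\<close>, \<open>Y\<close>, the tensor product of \<open>U\<close> and
  \<open>V\<close> is realised in the usual way inside the functions on \<open>X \<times> Y\<close>, with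
  \<open>(f \<otimes> g) (x, y) = f x * g y\<close>. That no relations beyond bilinearity are introduced is
  lemma \<open>independent_tensor\<close> below.\<close>

definition tensor_fun :: "('a \<Rightarrow> complex) \<Rightarrow> ('b \<Rightarrow> complex) \<Rightarrow> 'a \<times> 'b \<Rightarrow> complex" where
  "tensor_fun f g = (\<lambda>(x, y). f x * g y)"

definition tensor :: "('a \<Rightarrow> complex) set \<Rightarrow> ('b \<Rightarrow> complex) set \<Rightarrow> ('a \<times> 'b \<Rightarrow> complex) set" where
  "tensor U V = cfun.span {tensor_fun f g | f g. f \<in> U \<and> g \<in> V}"

lemma sum_fscale_apply: "(\<Sum>f\<in>A. fscale (c f) (h f)) x = (\<Sum>f\<in>A. c f * h f x)"
  by (induction A rule: infinite_finite_induct) (auto simp: fscale_def)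

lemma independent_tensor:
  assumes "\<not> cfun.dependent A" "\<not> cfun.dependent B" "finite S" "S \<subseteq> A" "finite T" "T \<subseteq> B"
    and eq: "(\<Sum>f\<in>S. \<Sum>g\<in>T. fscale (c f g) (tensor_fun f g)) = 0"
    and "f \<in> S" "g \<in> T"
  shows "c f g = 0"
proof -
  have z: "(\<Sum>g\<in>T. fscale (\<Sum>f\<in>S. c f g * f x) g) = 0" for x
  proof
    fix y
    have "(\<Sum>g\<in>T. fscale (\<Sum>f\<in>S. c f g * f x) g) y = (\<Sum>f\<in>S. \<Sum>g\<in>T. c f g * f x * g y)"
      by (subst sum.swap) (simp add: sum_fscale_apply sum_distrib_right)
    also have "\<dots> = (\<Sum>f\<in>S. \<Sum>g\<in>T. fscale (c f g) (tensor_fun f g)) (x, y)"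
    proof -
      have "(\<Sum>f\<in>S'. \<Sum>g\<in>T. fscale (c f g) (tensor_fun f g)) (x, y)
            = (\<Sum>f\<in>S'. \<Sum>g\<in>T. c f g * f x * g y)" if "finite S'" for S'
        using that by induction (auto simp: sum_fscale_apply tensor_fun_def mult.assoc)
      from this[OF \<open>finite S\<close>] show ?thesis by simp
    qed
    finally show "(\<Sum>g\<in>T. fscale (\<Sum>f\<in>S. c f g * f x) g) y = 0 y"
      using eq by simp
  qed
  have "(\<Sum>f\<in>S. c f g * f x) = 0" for x
    using cfun.independentD[OF assms(2) assms(5,6) z \<open>g \<in> T\<close>] .
  hence "(\<Sum>f\<in>S. fscale (c f g) f) = 0"
    by (intro ext) (simp add: sum_fscale_apply)
  from cfun.independentD[OF assms(1) assms(3,4) this \<open>f \<in> S\<close>] show ?thesis .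
qed


section \<open>Representations of the special linear group\<close>

definition SL2 :: "(complex^2^2) set" where
  "SL2 = {g. det g = 1}"

definition binary_forms :: "nat \<Rightarrow> (complex^2 \<Rightarrow> complex) set" where
  "binary_forms d = {f. \<exists>c. \<forall>x. f x = (\<Sum>i\<le>d. c i * (x $ 1) ^ i * (x $ 2) ^ (d - i))}"

definition form_act :: "complex^2^2 \<Rightarrow> (complex^2 \<Rightarrow> complex) \<Rightarrow> complex^2 \<Rightarrow> complex" where
  "form_act g f = (\<lambda>x. f (matrix_inv g *v x))"

text \<open>The direct sum of the binary forms of degrees \<open>d 1, \<dots>, d r\<close>: families of forms, padded by
  zero outside the index range.\<close>

type_synonym form_family = "nat \<Rightarrow> complex^2 \<Rightarrow> complex"

definition rep :: "nat \<Rightarrow> (nat \<Rightarrow> nat) \<Rightarrow> form_family set" where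
  "rep r d = {w. (\<forall>k\<in>{1..r}. w k \<in> binary_forms (d k)) \<and> (\<forall>k. k \<notin> {1..r} \<longrightarrow> w k = 0)}"

definition rep_act :: "complex^2^2 \<Rightarrow> form_family \<Rightarrow> form_family" where
  "rep_act g w = (\<lambda>k. form_act g (w k))"

definition rep_invariants :: "nat \<Rightarrow> (nat \<Rightarrow> nat) \<Rightarrow> form_family set" where
  "rep_invariants r d = {w \<in> rep r d. \<forall>g\<in>SL2. rep_act g w = w}"

definition linear_forms_on :: "form_family set \<Rightarrow> (form_family \<Rightarrow> complex) set" where
  "linear_forms_on W = {l. (\<forall>u\<in>W. \<forall>v\<in>W. l (u + v) = l u + l v) \<and>
                           (\<forall>c. \<forall>u\<in>W. l (\<lambda>k. fscale c (u k)) = c * l u)}"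

text \<open>The degree \<open>n\<close> component of the coordinate ring of \<open>W\<close>: polynomial functions on \<open>W\<close> that are
  linear combinations of products of \<open>n\<close> linear forms. Functions on \<open>W\<close> are padded by zero
  outside \<open>W\<close>, so that equality of functions is equality on \<open>W\<close>.\<close>

definition coord_ring :: "form_family set \<Rightarrow> nat \<Rightarrow> (form_family \<Rightarrow> complex) set" where
  "coord_ring W n = cfun.span
     {(\<lambda>w. if w \<in> W then \<Prod>j<n. l j w else 0) | l. \<forall>j<n. l j \<in> linear_forms_on W}"

definition poly_act :: "complex^2^2 \<Rightarrow> (form_family \<Rightarrow> complex) \<Rightarrow> form_family \<Rightarrow> complex" where
  "poly_act g p = (\<lambda>w. p (rep_act (matrix_inv g) w))"

definition tensor_act ::
  "complex^2^2 \<Rightarrow> (form_family \<times> (complex^2) \<Rightarrow> complex) \<Rightarrow> form_family \<times> (complex^2) \<Rightarrow> complex" where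
  "tensor_act g F = (\<lambda>(w, x). F (rep_act (matrix_inv g) w, matrix_inv g *v x))"

lemma tensor_act_tensor_fun:
  "tensor_act g (tensor_fun p f) = tensor_fun (poly_act g p) (form_act g f)"
  by (auto simp: tensor_act_def tensor_fun_def poly_act_def form_act_def)

definition covariants ::
  "nat \<Rightarrow> (nat \<Rightarrow> nat) \<Rightarrow> nat \<Rightarrow> nat \<Rightarrow> (form_family \<times> (complex^2) \<Rightarrow> complex) set" where
  "covariants r d L n =
     {F \<in> tensor (coord_ring (rep r d) n) (binary_forms L). \<forall>g\<in>SL2. tensor_act g F = F}"

definition hilb :: "nat \<Rightarrow> (nat \<Rightarrow> nat) \<Rightarrow> nat \<Rightarrow> complex \<Rightarrow> complex" where
  "hilb r d L t = (\<Sum>n. of_nat (cfun.dim (covariants r d L n)) * t ^ n)"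


section \<open>Weights and the perturbed residue sum\<close>

definition pos_weights :: "nat \<Rightarrow> (nat \<Rightarrow> nat) \<Rightarrow> (nat \<times> nat) set" where
  "pos_weights r d = {(k, i). 1 \<le> k \<and> k \<le> r \<and> d k div 2 + 1 \<le> i \<and> i \<le> d k}"

definition weight :: "(nat \<Rightarrow> nat) \<Rightarrow> nat \<times> nat \<Rightarrow> int" where
  "weight d = (\<lambda>(k, i). 2 * int i - int (d k))"

definition num_even :: "nat \<Rightarrow> (nat \<Rightarrow> nat) \<Rightarrow> nat" where
  "num_even r d = card {k \<in> {1..r}. even (d k)}"

definition nu :: "nat \<Rightarrow> (nat \<Rightarrow> nat) \<Rightarrow> nat \<Rightarrow> int" where
  "nu r d L = int L + 1 - (\<Sum>p\<in>pos_weights r d. weight d p)"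

text \<open>The real power \<open>t\<^sup>x\<close> with respect to a chosen logarithm \<open>s\<close> of \<open>t\<close>.\<close>

definition logpow :: "complex \<Rightarrow> real \<Rightarrow> complex" where
  "logpow s x = exp (of_real x * s)"

definition perturbed_sum ::
  "nat \<Rightarrow> (nat \<Rightarrow> nat) \<Rightarrow> nat \<Rightarrow> complex \<Rightarrow> complex \<Rightarrow> (nat \<times> nat \<Rightarrow> real) \<Rightarrow> complex" where
  "perturbed_sum r d L t s b =
     (\<Sum>q\<in>pos_weights r d. \<Sum>\<zeta>\<in>{\<zeta>. \<zeta> powi weight d q = 1}.
        (\<zeta> powi (- int L) * logpow s (- real L / b q)
           - \<zeta> ^ (L + 2) * logpow s (real (L + 2) / b q)) /
        (of_real (b q) * (1 - t ^ 2) * (1 - t) ^ num_even r d *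
          (\<Prod>p\<in>pos_weights r d - {q}.
             (1 - \<zeta> powi (- weight d p) * logpow s ((b q - b p) / b q)) *
             (1 - \<zeta> powi (weight d p) * logpow s ((b q + b p) / b q)))))"

text \<open>Real vectors indexed by \<open>pos_weights r d\<close> are the extensional functions on that set, with the
  product topology. The weight vector itself is not excluded from the limit when its entries
  happen to be pairwise distinct, hence \<open>nhds\<close> rather than \<open>at\<close>.\<close>

definition admissible :: "nat \<Rightarrow> (nat \<Rightarrow> nat) \<Rightarrow> (nat \<times> nat \<Rightarrow> real) set" where
  "admissible r d = {b \<in> extensional (pos_weights r d).
      inj_on b (pos_weights r d) \<and> (\<forall>p\<in>pos_weights r d. 0 < b p)}"

definition weight_filter :: "nat \<Rightarrow> (nat \<Rightarrow> nat) \<Rightarrow> (nat \<times> nat \<Rightarrow> real) filter" where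
  "weight_filter r d =
     inf (nhds (restrict (\<lambda>p. real_of_int (weight d p)) (pos_weights r d)))
         (principal (admissible r d))"

definition exponent_pairs ::
  "nat \<Rightarrow> (nat \<Rightarrow> nat) \<Rightarrow> nat \<Rightarrow> ((nat \<times> nat \<Rightarrow> nat) \<times> (nat \<times> nat \<Rightarrow> nat)) set" where
  "exponent_pairs r d L =
     {(I, J). I \<in> extensional (pos_weights r d) \<and> J \<in> extensional (pos_weights r d) \<and>
        (\<Sum>p\<in>pos_weights r d. int (I p + J p) * weight d p) = nu r d L - 1}"

end

theory Submission
  imports Defs "HOL-Complex_Analysis.Complex_Analysis"
begin

text \<open>The covariants of degree \<open>n\<close> are the vectors of weight \<open>0\<close> in
  \<open>\<complex>[W \<oplus> V\<^sub>1]\<close> of bidegree \<open>(n, L)\<close> that are killed by the raising operator; since that operator is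
  surjective from weight \<open>0\<close> onto weight \<open>2\<close>, their dimension is a difference of two numbers of
  monomials, and the Hilbert series becomes a contour integral over the unit circle. Its integrand has
  the pole \<open>0\<close>, whose residue is the sum over \<open>S\<close>, and the poles \<open>z = \<zeta> * t powr (1 / a)\<close> with \<open>\<zeta>\<close> an
  \<open>a\<close>-th root of unity. The variable \<open>x\<close> with \<open>z = \<zeta> * t powr x\<close> turns the latter into the pole
  \<open>1 / a\<close>, and replacing the weights by \<open>b\<close> splits it into simple poles \<open>1 / b p\<close> whose residues are the
  terms of the perturbed sum. The sum of these residues is an integral over a fixed small circle,
  hence continuous in \<open>b\<close>.\<close>

section \<open>Derivations and the action of the Lie algebra\<close>

text \<open>A vector of V_L is a form on the plane, so a covariant is a polynomial function of a
  pair (w, x), and x can serve as one more summand V_1. Invariance then becomes infinitesimal: a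
  vector of weight 0 killed by the raising operator E is also killed by the lowering operator F,
  hence constant along the unipotent one-parameter groups, and these generate the group.
  Surjectivity of E from weight 0 to weight 2 follows from the injectivity of E F on the
  finite-dimensional space of weight 2. On the analytic side the obstacle is that weights may
  coincide. Then single terms of the perturbed sum have denominators tending to 0, and a limit is
  established only for the total over equal weights with a fixed root of unity. Powers of z with
  real exponents are not single valued, whereas powers of exp (s x) are; this is why the weights are
  perturbed only after passing to x, with the powers of the root of unity left at their integral
  exponents.\<close>

text \<open>Polynomials in the coordinates \<open>v (k, i)\<close> of \<open>W \<oplus> V\<^sub>1\<close>: the index \<open>k = 0\<close> belongs to \<open>V\<^sub>1\<close>, so that
  \<open>d 0 = 1\<close> in the application. In \<open>hom r d n l w\<close>, the degree in the coordinates of \<open>W\<close> is \<open>n\<close>, the one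
  in those of \<open>V\<^sub>1\<close> is \<open>l\<close>, and \<open>w\<close> is the weight.\<close>

definition wdeg :: "nat \<times> nat \<Rightarrow> nat" where "wdeg p = (if fst p = 0 then 0 else 1)"
definition xdeg :: "nat \<times> nat \<Rightarrow> nat" where "xdeg p = (if fst p = 0 then 1 else 0)"
definition idx :: "nat \<Rightarrow> (nat \<Rightarrow> nat) \<Rightarrow> (nat \<times> nat) set" where
  "idx r d = (SIGMA k:{0..r}. {..d k})"

inductive hom :: "nat \<Rightarrow> (nat \<Rightarrow> nat) \<Rightarrow> nat \<Rightarrow> nat \<Rightarrow> int \<Rightarrow> ((nat \<times> nat \<Rightarrow> complex) \<Rightarrow> complex) \<Rightarrow> bool"
  for r d where
  zero: "hom r d n l w (\<lambda>v. 0)"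
| const: "hom r d 0 0 0 (\<lambda>v. c)"
| coord: "p \<in> idx r d \<Longrightarrow> hom r d (wdeg p) (xdeg p) (weight d p) (\<lambda>v. v p)"
| add: "hom r d n l w f \<Longrightarrow> hom r d n l w g \<Longrightarrow> hom r d n l w (\<lambda>v. f v + g v)"
| mult: "hom r d n l w f \<Longrightarrow> hom r d n' l' w' g \<Longrightarrow> hom r d (n + n') (l + l') (w + w') (\<lambda>v. f v * g v)"

lemma hom_scale: "hom r d n l w f \<Longrightarrow> hom r d n l w (\<lambda>v. c * f v)"
  using hom.mult[OF hom.const] by force

lemma hom_sum: "(\<And>a. a \<in> A \<Longrightarrow> hom r d n l w (f a)) \<Longrightarrow> hom r d n l w (\<lambda>v. \<Sum>a\<in>A. f a v)"
  by (induction A rule: infinite_finite_induct) (auto intro: hom.zero hom.add)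

text \<open>The derivative along the vector field \<open>N\<close>, taken analytically and so
  defined for every function without choosing a polynomial expression. The rules of a derivation
  need differentiability, which membership in some \<open>hom\<close> provides.\<close>

definition der :: "(('i \<Rightarrow> complex) \<Rightarrow> 'i \<Rightarrow> complex) \<Rightarrow> (('i \<Rightarrow> complex) \<Rightarrow> complex) \<Rightarrow> ('i \<Rightarrow> complex) \<Rightarrow> complex"
  where "der N f = (\<lambda>v. deriv (\<lambda>x. f (\<lambda>p. v p + x * N v p)) 0)"

lemma hom_differentiable:
  "hom r d n l w f \<Longrightarrow> (\<lambda>x. f (\<lambda>p. v p + x * N v p)) field_differentiable (at x)"
  by (induction rule: hom.induct) (auto intro!: derivative_intros)

lemma der_const: "der N (\<lambda>v. c) = (\<lambda>v. 0)"
  by (simp add: der_def)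

lemma der_coord: "der N (\<lambda>v. v p) = (\<lambda>v. N v p)"
  unfolding der_def by (intro ext DERIV_imp_deriv) (auto intro!: derivative_eq_intros)

lemma der_add:
  assumes "hom r d n l w f" "hom r d n' l' w' g"
  shows "der N (\<lambda>v. f v + g v) = (\<lambda>v. der N f v + der N g v)"
  unfolding der_def by (intro ext deriv_add assms[THEN hom_differentiable])

lemma der_mult:
  assumes "hom r d n l w f" "hom r d n' l' w' g"
  shows "der N (\<lambda>v. f v * g v) = (\<lambda>v. der N f v * g v + f v * der N g v)"
  unfolding der_def by (intro ext) (simp add: deriv_mult assms[THEN hom_differentiable])

lemma der_cmult:
  assumes "hom r d n l w f"
  shows "der N (\<lambda>v. c * f v) = (\<lambda>v. c * der N f v)"
  by (subst der_mult[OF hom.const assms]) (simp add: der_const)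

text \<open>The derivatives at \<open>x = 0\<close> of the coefficients of the forms \<open>f (y1 - x * y2, y2)\<close> and
  \<open>f (y1, y2 - x * y1)\<close>; \<open>der (up d)\<close> and \<open>der (dn d)\<close> are the operators \<open>E\<close> and \<open>F\<close> of an sl2-triple.\<close>

definition up :: "(nat \<Rightarrow> nat) \<Rightarrow> (nat \<times> nat \<Rightarrow> complex) \<Rightarrow> nat \<times> nat \<Rightarrow> complex" where
  "up d v = (\<lambda>(k, i). if i < d k then - of_nat (i + 1) * v (k, i + 1) else 0)"
definition dn :: "(nat \<Rightarrow> nat) \<Rightarrow> (nat \<times> nat \<Rightarrow> complex) \<Rightarrow> nat \<times> nat \<Rightarrow> complex" where
  "dn d v = (\<lambda>(k, i). if 0 < i then - of_nat (d k + 1 - i) * v (k, i - 1) else 0)"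

lemma der_up_coord: "der (up d) (\<lambda>v. v (k, i)) = (\<lambda>v. if i < d k then - of_nat (i + 1) * v (k, i + 1) else 0)"
  and der_dn_coord: "der (dn d) (\<lambda>v. v (k, i)) = (\<lambda>v. if 0 < i then - of_nat (d k + 1 - i) * v (k, i - 1) else 0)"
  by (simp_all add: der_coord up_def dn_def)

lemma hom_up: "hom r d n l w f \<Longrightarrow> hom r d n l (w + 2) (der (up d) f)"
proof (induction rule: hom.induct)
  case (coord p)
  obtain k i where p: "p = (k, i)" by (cases p)
  show ?case
  proof (cases "i < d k")
    case True
    hence "(k, i + 1) \<in> idx r d" using coord by (auto simp: p idx_def)
    moreover have "weight d (k, i + 1) = weight d p + 2" "wdeg (k, i + 1) = wdeg p" "xdeg (k, i + 1) = xdeg p"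
      by (simp_all add: p wdeg_def xdeg_def weight_def)
    ultimately have "hom r d (wdeg p) (xdeg p) (weight d p + 2) (\<lambda>v. v (k, i + 1))"
      using hom.coord by metis
    from hom_scale[OF this, of "- of_nat (i + 1)"] show ?thesis using True by (simp add: p der_up_coord)
  qed (simp add: p der_up_coord hom.zero)
next
  case (mult n l w f n' l' w' g)
  have "hom r d (n + n') (l + l') (w + 2 + w') (\<lambda>v. der (up d) f v * g v)"
    by (intro hom.mult mult)
  moreover have "hom r d (n + n') (l + l') (w + (w' + 2)) (\<lambda>v. f v * der (up d) g v)"
    by (intro hom.mult mult)
  ultimately show ?case
    by (subst der_mult[OF mult.hyps]) (intro hom.add; simp add: algebra_simps)
qed (auto simp: der_const der_add intro: hom.intros)

lemma hom_dn: "hom r d n l w f \<Longrightarrow> hom r d n l (w - 2) (der (dn d) f)"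
proof (induction rule: hom.induct)
  case (coord p)
  obtain k i where p: "p = (k, i)" by (cases p)
  show ?case
  proof (cases "i > 0")
    case True
    hence "(k, i - 1) \<in> idx r d" using coord by (auto simp: p idx_def)
    from hom.coord[OF this] have "hom r d (wdeg p) (xdeg p) (weight d p - 2) (\<lambda>v. v (k, i - 1))"
      using True by (simp add: p wdeg_def xdeg_def weight_def of_nat_diff algebra_simps)
    from hom_scale[OF this, of "- of_nat (d k + 1 - i)"] show ?thesis using True by (simp add: p der_dn_coord)
  qed (simp add: p der_dn_coord hom.zero)
next
  case (mult n l w f n' l' w' g)
  have "hom r d (n + n') (l + l') (w - 2 + w') (\<lambda>v. der (dn d) f v * g v)"
    by (intro hom.mult mult)
  moreover have "hom r d (n + n') (l + l') (w + (w' - 2)) (\<lambda>v. f v * der (dn d) g v)"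
    by (intro hom.mult mult)
  ultimately show ?case
    by (subst der_mult[OF mult.hyps]) (intro hom.add; simp add: algebra_simps)
qed (auto simp: der_const der_add intro: hom.intros)

text \<open>The commutator of two derivations is a derivation, and so is multiplication by the
  weight on weight vectors; hence agreement on coordinates suffices. There it is
  \<open>(d k + 1 - i) * i - (d k - i) * (i + 1) = 2 * i - d k\<close>.\<close>

lemma hom_commutator:
  "hom r d n l w f \<Longrightarrow> der (up d) (der (dn d) f) v - der (dn d) (der (up d) f) v = of_int w * f v"
proof (induction rule: hom.induct)
  case (coord p)
  obtain k i where p: "p = (k, i)" "i \<le> d k" using coord by (cases p) (auto simp: idx_def)
  have "der (up d) (der (dn d) (\<lambda>v. v (k, i))) v = of_nat ((d k + 1 - i) * i) * v (k, i)"
  proof (cases "i > 0")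
    case True
    then obtain j where j: "i = Suc j" by (cases i) auto
    have "hom r d (wdeg (k, j)) (xdeg (k, j)) (weight d (k, j)) (\<lambda>v. v (k, j))"
      using coord p j by (intro hom.coord) (auto simp: idx_def)
    from der_cmult[OF this, of "up d" "- of_nat (d k + 1 - i)"] show ?thesis
      using p j by (simp add: der_dn_coord der_up_coord of_nat_diff) (simp add: algebra_simps)
  qed (simp add: der_dn_coord der_const)
  moreover have "der (dn d) (der (up d) (\<lambda>v. v (k, i))) v = of_nat ((d k - i) * (i + 1)) * v (k, i)"
  proof (cases "i < d k")
    case True
    have "hom r d (wdeg (k, i + 1)) (xdeg (k, i + 1)) (weight d (k, i + 1)) (\<lambda>v. v (k, i + 1))"
      using coord p True by (intro hom.coord) (auto simp: idx_def)
    from der_cmult[OF this, of "dn d" "- of_nat (i + 1)"] show ?thesis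
      using p True by (simp add: der_dn_coord der_up_coord of_nat_diff) (simp add: algebra_simps)
  qed (use p in \<open>simp add: der_up_coord der_const\<close>)
  ultimately show ?case
    using p(2) by (simp add: p(1) weight_def of_nat_diff) (simp add: algebra_simps)
next
  case (add n l w f g)
  show ?case
    unfolding der_add[OF add.hyps] der_add[OF add.hyps[THEN hom_dn]] der_add[OF add.hyps[THEN hom_up]]
    using add.IH by (simp add: algebra_simps)
next
  case (mult n l w f n' l' w' g)
  note h = mult.hyps
  note hu = h[THEN hom_up] and hd = h[THEN hom_dn]
  have "der (up d) (der (dn d) (\<lambda>v. f v * g v)) v =
     der (up d) (der (dn d) f) v * g v + der (dn d) f v * der (up d) g v +
     (der (up d) f v * der (dn d) g v + f v * der (up d) (der (dn d) g) v)"
    unfolding der_mult[OF h] der_add[OF hom.mult[OF hd(1) h(2)] hom.mult[OF h(1) hd(2)]]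
      der_mult[OF hd(1) h(2)] der_mult[OF h(1) hd(2)] by simp
  moreover have "der (dn d) (der (up d) (\<lambda>v. f v * g v)) v =
     der (dn d) (der (up d) f) v * g v + der (up d) f v * der (dn d) g v +
     (der (dn d) f v * der (up d) g v + f v * der (dn d) (der (up d) g) v)"
    unfolding der_mult[OF h] der_add[OF hom.mult[OF hu(1) h(2)] hom.mult[OF h(1) hu(2)]]
      der_mult[OF hu(1) h(2)] der_mult[OF h(1) hu(2)] by simp
  ultimately have "der (up d) (der (dn d) (\<lambda>v. f v * g v)) v - der (dn d) (der (up d) (\<lambda>v. f v * g v)) v =
     (der (up d) (der (dn d) f) v - der (dn d) (der (up d) f) v) * g v +
     f v * (der (up d) (der (dn d) g) v - der (dn d) (der (up d) g) v)"
    by (simp add: algebra_simps)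
  thus ?case unfolding mult.IH by (simp add: algebra_simps)
qed (auto simp: der_const)

section \<open>Boundedness of weights and strings of the sl2-triple\<close>

lemma hom_weight_bound:
  assumes "\<And>k. k \<le> r \<Longrightarrow> d k \<le> B"
  shows "hom r d n l w f \<Longrightarrow> f = (\<lambda>v. 0) \<or> \<bar>w\<bar> \<le> int ((n + l) * B)"
proof (induction rule: hom.induct)
  case (coord p)
  then show ?case using assms[of "fst p"] by (cases p) (auto simp: idx_def weight_def wdeg_def xdeg_def)
next
  case (mult n l w f n' l' w' g)
  then show ?case
    by (auto simp: algebra_simps)
qed auto

lemma hom_zero_of_weight:
  assumes "hom r d n l w f" "\<bar>w\<bar> > int ((n + l) * (\<Sum>k\<le>r. d k))"
  shows "f = (\<lambda>v. 0)"
  using hom_weight_bound[of r d "\<Sum>k\<le>r. d k", OF _ assms(1)] assms(2)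
  by (force intro: member_le_sum)

lemma up_dn_inj:
  assumes f: "hom r d n l 2 f" and 0: "der (up d) (der (dn d) f) = (\<lambda>v. 0)"
  shows "f = (\<lambda>v. 0)"
proof -
  \<comment> \<open>\<open>F E\<^sup>k\<^sup>+\<^sup>1 f\<close> is a nonzero multiple of \<open>E\<^sup>k f\<close>, but \<open>E\<^sup>k f\<close> vanishes for large \<open>k\<close> as weights are bounded.\<close>
  define g where "g k = (der (up d) ^^ k) f" for k
  have g: "hom r d n l (2 + 2 * int k) (g k)" for k
    by (induction k) (use f hom_up in \<open>fastforce simp: g_def algebra_simps\<close>)+
  have g_Suc: "der (up d) (g k) = g (Suc k)" for k by (simp add: g_def)
  \<comment> \<open>Moving F past one more E costs one commutator, that is, the weight of the vector
    in between; \<open>(k + 1) * (k + 2)\<close> is the sum 2 + 4 + ... + 2 (k + 1) of these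
    weights.\<close>
  have F: "der (dn d) (g (Suc k)) v = - of_nat ((k + 1) * (k + 2)) * g k v" for k v
  proof (induction k arbitrary: v)
    case 0
    show ?case using hom_commutator[OF f, of v] by (simp add: assms(2) g_def) (metis minus_minus)
  next
    case (Suc k)
    have "der (dn d) (g (Suc k)) = (\<lambda>v. - of_nat ((k + 1) * (k + 2)) * g k v)"
      using Suc by blast
    hence "der (up d) (der (dn d) (g (Suc k))) v = - of_nat ((k + 1) * (k + 2)) * g (Suc k) v"
      by (simp only: der_cmult[OF g] g_Suc)
    with hom_commutator[OF g, of "Suc k" v] show ?case
      by (simp add: g_Suc algebra_simps eq_neg_iff_add_eq_0)
  qed
  have "g (k - j) = (\<lambda>v. 0)" if "g k = (\<lambda>v. 0)" "j \<le> k" for j k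
    using that(2)
  proof (induction j)
    case (Suc j)
    hence e: "g (Suc (k - Suc j)) = (\<lambda>v. 0)" by (simp add: Suc_diff_Suc)
    show ?case
    proof
      fix v
      from F[of "k - Suc j" v] show "g (k - Suc j) v = 0"
        unfolding e by (auto simp: der_const simp del: of_nat_Suc of_nat_add of_nat_mult)
    qed
  qed (use that in simp)
  moreover have "g ((n + l) * (\<Sum>k\<le>r. d k)) = (\<lambda>v. 0)"
    by (rule hom_zero_of_weight[OF g]) simp
  ultimately have "g 0 = (\<lambda>v. 0)" by (metis diff_self_eq_0 order_refl)
  thus ?thesis by (simp add: g_def)
qed

text \<open>The vector F f has weight -2, and E kills it because the commutator acts on
  \<open>f\<close> as 0. Each further application of F is undone by E up to a nonzero factor, so a
  nonzero F f would start an infinite descent through ever smaller weights, contrary to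
  \<open>hom_zero_of_weight\<close>.\<close>

lemma highest_weight_zero_imp_invariant:
  assumes f: "hom r d n l 0 f" and 0: "der (up d) f = (\<lambda>v. 0)"
  shows "der (dn d) f = (\<lambda>v. 0)"
proof -
  define g where "g k = (der (dn d) ^^ Suc k) f" for k
  have g: "hom r d n l (- 2 - 2 * int k) (g k)" for k
    by (induction k) (use f hom_dn in \<open>fastforce simp: g_def algebra_simps\<close>)+
  have g_Suc: "der (dn d) (g k) = g (Suc k)" for k by (simp add: g_def)
  have E0: "der (up d) (g 0) = (\<lambda>v. 0)"
    using hom_commutator[OF f] by (simp add: assms(2) g_def der_const fun_eq_iff)
  have F: "der (up d) (g (Suc k)) v = - of_nat ((k + 1) * (k + 2)) * g k v" for k v
  proof (induction k arbitrary: v)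
    case 0
    show ?case using hom_commutator[OF g[of 0], of v] by (simp add: E0 der_const g_Suc)
  next
    case (Suc k)
    have "der (up d) (g (Suc k)) = (\<lambda>v. - of_nat ((k + 1) * (k + 2)) * g k v)"
      using Suc by blast
    hence "der (dn d) (der (up d) (g (Suc k))) v = - of_nat ((k + 1) * (k + 2)) * g (Suc k) v"
      by (simp only: der_cmult[OF g] g_Suc)
    with hom_commutator[OF g, of "Suc k" v] show ?case
      by (simp add: g_Suc algebra_simps eq_neg_iff_add_eq_0)
  qed
  have "g (k - j) = (\<lambda>v. 0)" if "g k = (\<lambda>v. 0)" "j \<le> k" for j k
    using that(2)
  proof (induction j)
    case (Suc j)
    hence e: "g (Suc (k - Suc j)) = (\<lambda>v. 0)" by (simp add: Suc_diff_Suc)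
    show ?case
    proof
      fix v
      from F[of "k - Suc j" v] show "g (k - Suc j) v = 0"
        unfolding e by (auto simp: der_const simp del: of_nat_Suc of_nat_add of_nat_mult)
    qed
  qed (use that in simp)
  moreover have "g ((n + l) * (\<Sum>k\<le>r. d k)) = (\<lambda>v. 0)"
    by (rule hom_zero_of_weight[OF g]) simp
  ultimately have "g 0 = (\<lambda>v. 0)" by (metis diff_self_eq_0 order_refl)
  thus ?thesis by (simp add: g_def)
qed

section \<open>Kernels, monomials and highest weight vectors\<close>

no_notation vector_scalar_mult (infixl \<open>*s\<close> 70)

section \<open>Linear algebra: the dimension of a kernel with an explicit complement\<close>

lemma (in vector_space) finite_independent_spans:
  assumes "finite T" "independent S" "S \<subseteq> span T" "card S = card T"
  shows "span S = span T"
proof -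
  have "t \<in> span S" if "t \<in> T" for t
  proof (rule ccontr)
    assume t: "t \<notin> span S"
    hence "independent (insert t S)" using assms(2) by (rule independent_insertI)
    moreover have "insert t S \<subseteq> span T" using that assms(3) by (auto intro: span_base)
    moreover have "t \<notin> S" using t span_base by blast
    ultimately show False
      using independent_span_bound[OF assms(1), of "insert t S"] assms(4) by auto
  qed
  hence "T \<subseteq> span S" by blast
  with assms(3) show ?thesis by (metis span_minimal subspace_span subset_antisym)
qed

text \<open>\<open>der\<close> is known to be additive only on differentiable functions, so
  linearity is demanded on \<open>U\<close> alone.\<close>

locale linear_on_subspaces = vector_space scale for scale :: "'a::field \<Rightarrow> 'b::ab_group_add \<Rightarrow> 'b" (infixr \<open>*s\<close> 75) +
  fixes U V :: "'b set" and T :: "'b \<Rightarrow> 'b"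
  assumes U: "subspace U" and V: "subspace V"
    and maps: "x \<in> U \<Longrightarrow> T x \<in> V"
    and add: "x \<in> U \<Longrightarrow> y \<in> U \<Longrightarrow> T (x + y) = T x + T y"
    and scale: "x \<in> U \<Longrightarrow> T (c *s x) = c *s T x"
begin

lemma zero: "T 0 = 0"
  using scale[of 0 0] subspace_0[OF U] by simp

lemma sum: "(\<And>b. b \<in> B \<Longrightarrow> f b \<in> U) \<Longrightarrow> T (\<Sum>b\<in>B. u b *s f b) = (\<Sum>b\<in>B. u b *s T (f b))"
proof (induction B rule: infinite_finite_induct)
  case (insert x F)
  have "(\<Sum>b\<in>F. u b *s f b) \<in> U" using insert by (intro subspace_sum[OF U] subspace_scale[OF U]) auto
  then show ?case using insert by (simp add: add scale subspace_scale[OF U])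
qed (auto simp: zero)

lemma independent_image:
  assumes "finite B" "B \<subseteq> U" "independent B" and inj: "\<And>x. x \<in> U \<Longrightarrow> T x = 0 \<Longrightarrow> x = 0"
  shows "independent (T ` B)" "inj_on T B"
proof -
  show i: "inj_on T B"
  proof (rule inj_onI)
    fix x y assume xy: "x \<in> B" "y \<in> B" "T x = T y"
    hence "x \<in> U" "y \<in> U" using assms by auto
    hence "T (x + (-1) *s y) = T x + (-1) *s T y"
      by (simp only: add scale subspace_scale[OF U])
    hence "T (x + (-1) *s y) = 0" using xy(3) by simp
    hence "x + (-1) *s y = 0"
      by (rule inj[rotated]) (intro subspace_add[OF U] subspace_scale[OF U] \<open>x \<in> U\<close> \<open>y \<in> U\<close>)
    thus "x = y" by simp
  qed
  show "independent (T ` B)"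
  proof
    assume "dependent (T ` B)"
    then obtain u where u: "\<exists>v\<in>B. u (T v) \<noteq> 0" "(\<Sum>v\<in>B. u (T v) *s T v) = 0"
      using dependent_finite[of "T ` B"] assms(1) by (auto simp: sum.reindex[OF i])
    have "T (\<Sum>v\<in>B. u (T v) *s v) = 0" using u(2) assms(2) by (subst sum) auto
    hence "(\<Sum>v\<in>B. u (T v) *s v) = 0"
      using assms(2) by (intro inj[of "\<Sum>v\<in>B. u (T v) *s v"] subspace_sum[OF U] subspace_scale[OF U]) auto
    with assms(1,3) u(1) show False using dependent_finite[of B] by auto
  qed
qed

end

text \<open>\<open>E \<circ> F\<close> is an injective endomorphism of the finite-dimensional
  \<open>V\<close>, hence bijective. So \<open>E\<close> is onto \<open>V\<close>, and
  \<open>F\<close> maps \<open>V\<close> isomorphically onto a complement of the kernel of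
  \<open>E\<close> in \<open>U\<close>.\<close>

lemma (in vector_space) dim_kernel:
  assumes E: "linear_on_subspaces scale U V E" and F: "linear_on_subspaces scale V U F"
    and inj: "\<And>y. y \<in> V \<Longrightarrow> E (F y) = 0 \<Longrightarrow> y = 0"
    and B: "finite B" "independent B" "V = span B"
    and C: "finite C" "U \<subseteq> span C"
  shows "dim U = dim {x \<in> U. E x = 0} + dim V"
proof -
  interpret E: linear_on_subspaces scale U V E by fact
  interpret F: linear_on_subspaces scale V U F by fact
  interpret EF: linear_on_subspaces scale V V "E \<circ> F"
    by unfold_locales (auto simp: E.add F.add E.scale F.scale E.maps F.maps F.U)
  define K where "K = {x \<in> U. E x = 0}"
  have subK: "subspace K"
    unfolding K_def
    by (rule subspaceI) (auto simp: E.zero E.add E.scale subspace_0[OF E.U] subspace_add[OF E.U] subspace_scale[OF E.U])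
  have BV: "B \<subseteq> V" using B span_base by auto
  have iEF: "independent ((E \<circ> F) ` B)" "inj_on (E \<circ> F) B"
    by (rule EF.independent_image[OF B(1) BV B(2)]; use inj in simp)+
  have "card ((E \<circ> F) ` B) = card B" by (rule card_image) fact
  hence sp: "span ((E \<circ> F) ` B) = V"
    using finite_independent_spans[OF B(1) iEF(1)] BV EF.maps B(3) by blast
  have iF: "independent (F ` B)" "inj_on F B"
    by (rule F.independent_image[OF B(1) BV B(2)]; use inj E.zero in auto)+
  have solve: "\<exists>y\<in>V. E (F y) = z" if "z \<in> V" for z
  proof -
    have "z \<in> span ((E \<circ> F) ` B)" using that sp by simp
    then obtain u where "z = (\<Sum>v\<in>(E \<circ> F) ` B. u v *s v)"
      using span_finite[of "(E \<circ> F) ` B"] B(1) by auto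
    hence "z = (\<Sum>b\<in>B. u ((E \<circ> F) b) *s (E \<circ> F) b)" by (subst (asm) sum.reindex[OF iEF(2)]) (simp add: o_def)
    also have "\<dots> = (E \<circ> F) (\<Sum>b\<in>B. u ((E \<circ> F) b) *s b)"
      by (rule EF.sum[symmetric]) (use BV in auto)
    finally have "z = (E \<circ> F) (\<Sum>b\<in>B. u ((E \<circ> F) b) *s b)" .
    moreover have "(\<Sum>b\<in>B. u ((E \<circ> F) b) *s b) \<in> V"
      using BV by (intro subspace_sum[OF F.U] subspace_scale[OF F.U]) auto
    ultimately show ?thesis by auto
  qed
  obtain A where A: "A \<subseteq> K" "independent A" "K \<subseteq> span A" "card A = dim K"
    using basis_exists by blast
  have finA: "finite A"
    using independent_span_bound[OF C(1) A(2)] A(1) C(2) by (auto simp: K_def)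
  have nz: "b \<noteq> 0" if "b \<in> B" for b using B(2) that dependent_zero by blast
  have disj: "A \<inter> F ` B = {}"
  proof (rule ccontr)
    assume "A \<inter> F ` B \<noteq> {}"
    then obtain b where b: "b \<in> B" "F b \<in> A" by auto
    hence "E (F b) = 0" using A(1) by (auto simp: K_def)
    thus False using inj[of b] nz[of b] b BV by auto
  qed
  have ind: "independent (A \<union> F ` B)"
  proof
    assume "dependent (A \<union> F ` B)"
    then obtain u where u: "\<exists>v\<in>A \<union> F ` B. u v \<noteq> 0" "(\<Sum>v\<in>A. u v *s v) + (\<Sum>v\<in>F ` B. u v *s v) = 0"
      using dependent_finite[of "A \<union> F ` B"] finA B(1) disj by (auto simp: sum.union_disjoint)
    define k where "k = (\<Sum>v\<in>A. u v *s v)"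
    define y where "y = (\<Sum>b\<in>B. u (F b) *s b)"
    have k: "k \<in> K" unfolding k_def using A(1) by (intro subspace_sum[OF subK] subspace_scale[OF subK]) auto
    have y: "y \<in> V" unfolding y_def using BV by (intro subspace_sum[OF F.U] subspace_scale[OF F.U]) auto
    have "(\<Sum>v\<in>F ` B. u v *s v) = F y"
      unfolding y_def using BV by (subst F.sum) (auto simp: sum.reindex[OF iF(2)])
    with u(2) have e: "k + F y = 0" by (simp add: k_def)
    hence "E k + E (F y) = 0" using E.add[of k "F y"] k y F.maps E.zero by (simp add: K_def)
    hence "y = 0" using k y inj by (simp add: K_def)
    hence uB: "u (F b) = 0" if "b \<in> B" for b
      using independentD[OF B(2,1) subset_refl, of "\<lambda>b. u (F b)" b] \<open>y = 0\<close> that by (simp add: y_def)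
    have "k = 0" using e \<open>y = 0\<close> F.zero by simp
    hence "u a = 0" if "a \<in> A" for a
      using independentD[OF A(2) finA subset_refl, of u a] that by (simp add: k_def)
    with uB u(1) show False by auto
  qed
  have "U \<subseteq> span (A \<union> F ` B)"
  proof
    fix x assume x: "x \<in> U"
    \<comment> \<open>The component of \<open>x\<close> in the complement is \<open>F y\<close>,
      where \<open>y\<close> solves \<open>E (F y) = E x\<close>.\<close>
    then obtain y where y: "y \<in> V" "E (F y) = E x" using solve E.maps by blast
    have "x + (-1) *s F y \<in> K"
      using x y E.add[of x "(-1) *s F y"] E.scale[of "F y" "-1"] subspace_scale[OF E.U, of "F y" "-1"]
        subspace_add[OF E.U, of x "(-1) *s F y"] F.maps[of y] by (auto simp: K_def)
    hence "x + (-1) *s F y \<in> span (A \<union> F ` B)" using A(3) span_mono[of A "A \<union> F ` B"] by blast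
    moreover have "F y \<in> span (A \<union> F ` B)"
    proof -
      obtain u where "y = (\<Sum>b\<in>B. u b *s b)" using y(1) B span_finite[OF B(1)] by auto
      hence "F y = (\<Sum>b\<in>B. u b *s F b)" using F.sum[of B "\<lambda>b. b" u] BV by auto
      also have "\<dots> \<in> span (A \<union> F ` B)" by (intro span_sum span_scale span_base) auto
      finally show ?thesis .
    qed
    ultimately have "(x + (-1) *s F y) + F y \<in> span (A \<union> F ` B)" by (rule span_add)
    thus "x \<in> span (A \<union> F ` B)" by simp
  qed
  hence "dim U = card (A \<union> F ` B)"
    using A(1) F.maps BV ind by (intro dim_unique[OF _ _ _ refl]) (auto simp: K_def)
  also have "\<dots> = card A + card (F ` B)" using finA B(1) disj by (intro card_Un_disjoint) auto
  also have "card (F ` B) = card B" by (rule card_image) fact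
  also have "card B = dim V" using B(2,3) dim_span_eq_card_independent by simp
  finally show ?thesis using A(4) by (simp add: K_def)
qed

section \<open>Monomials as bases of the weight spaces\<close>

definition monom_fun :: "'i set \<Rightarrow> ('i \<Rightarrow> nat) \<Rightarrow> ('i \<Rightarrow> complex) \<Rightarrow> complex" where
  "monom_fun Y \<alpha> v = (\<Prod>p\<in>Y. v p ^ \<alpha> p)"

text \<open>Induction on the variables: with the other coordinates fixed, the sum is a polynomial in
  the last variable, so each of its coefficients vanishes. Injectivity of restriction is the form of
  distinctness that survives the step: once the exponent of \<open>x\<close> is fixed, exponent
  functions still differ on the smaller set, although they are not extensional there.\<close>

lemma monom_fun_coeffs_zero:
  assumes "finite Y" "finite A" "inj_on (\<lambda>\<alpha>. restrict \<alpha> Y) A" "\<And>v. (\<Sum>\<alpha>\<in>A. c \<alpha> * monom_fun Y \<alpha> v) = 0" "\<alpha> \<in> A"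
  shows "c \<alpha> = 0"
  using assms
proof (induction Y arbitrary: A \<alpha> rule: finite_induct)
  case empty
  have "A = {\<alpha>}" using empty by (auto simp: inj_on_def)
  then show ?case using empty(3)[of undefined] by (simp add: monom_fun_def)
next
  case (insert x Y)
  have monom_fun_insert: "monom_fun (insert x Y) \<beta> v = v x ^ \<beta> x * monom_fun Y \<beta> v" for \<beta> v
    using insert by (simp add: monom_fun_def)
  define A' where "A' j = {\<beta> \<in> A. \<beta> x = j}" for j
  define N where "N = Max ((\<lambda>\<beta>. \<beta> x) ` A)"
  have N: "\<beta> x \<le> N" if "\<beta> \<in> A" for \<beta> using that insert.prems by (auto simp: N_def)
  have "(\<Sum>\<beta>\<in>A' (\<alpha> x). c \<beta> * monom_fun Y \<beta> v) = 0" for v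
  proof -
    have "(\<Sum>j\<le>N. (\<Sum>\<beta>\<in>A' j. c \<beta> * monom_fun Y \<beta> v) * z ^ j) = 0" for z
    proof -
      have "monom_fun Y \<beta> (v(x := z)) = monom_fun Y \<beta> v" for \<beta>
        unfolding monom_fun_def using insert by (intro prod.cong) auto
      hence e: "monom_fun (insert x Y) \<beta> (v(x := z)) = z ^ \<beta> x * monom_fun Y \<beta> v" for \<beta>
        by (simp only: monom_fun_insert fun_upd_same)
      have "0 = (\<Sum>\<beta>\<in>A. c \<beta> * monom_fun Y \<beta> v * z ^ \<beta> x)"
        using insert.prems(3)[of "v(x := z)"] unfolding e by (simp add: mult_ac)
      also have "\<dots> = (\<Sum>j\<le>N. \<Sum>\<beta>\<in>A' j. c \<beta> * monom_fun Y \<beta> v * z ^ \<beta> x)"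
        unfolding A'_def using insert.prems N by (intro sum.group[symmetric]) auto
      also have "\<dots> = (\<Sum>j\<le>N. (\<Sum>\<beta>\<in>A' j. c \<beta> * monom_fun Y \<beta> v) * z ^ j)"
        by (simp add: A'_def sum_distrib_right)
      finally show ?thesis by simp
    qed
    thus ?thesis using N[OF insert.prems(4)] polyfun_eq_0[of "\<lambda>j. \<Sum>\<beta>\<in>A' j. c \<beta> * monom_fun Y \<beta> v" N] by blast
  qed
  moreover have "inj_on (\<lambda>\<beta>. restrict \<beta> Y) (A' (\<alpha> x))"
  proof (rule inj_onI)
    fix \<beta> \<gamma> assume bg: "\<beta> \<in> A' (\<alpha> x)" "\<gamma> \<in> A' (\<alpha> x)" "restrict \<beta> Y = restrict \<gamma> Y"
    hence "restrict \<beta> (insert x Y) = restrict \<gamma> (insert x Y)"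
      by (auto simp: A'_def fun_eq_iff restrict_def split: if_splits)
    thus "\<beta> = \<gamma>" using inj_onD[OF insert.prems(2), of \<beta> \<gamma>] bg by (simp add: A'_def)
  qed
  moreover have "finite (A' (\<alpha> x))" "\<alpha> \<in> A' (\<alpha> x)"
    using insert.prems by (auto simp: A'_def)
  ultimately show ?case by (intro insert.IH[of "A' (\<alpha> x)"])
qed

lemma monom_fun_inj_independent:
  assumes "finite Y" "A \<subseteq> PiE Y (\<lambda>_. UNIV)"
  shows "inj_on (monom_fun Y) A" "\<not> cfun.dependent (monom_fun Y ` A)"
proof -
  have res: "inj_on (\<lambda>\<alpha>. restrict \<alpha> Y) A'" if "A' \<subseteq> A" for A'
    using that assms(2) by (intro inj_onI) (metis PiE_restrict subsetD)
  show inj: "inj_on (monom_fun Y) A"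
  proof (rule inj_onI, rule ccontr)
    fix \<alpha> \<beta> assume ab: "\<alpha> \<in> A" "\<beta> \<in> A" "monom_fun Y \<alpha> = monom_fun Y \<beta>" "\<alpha> \<noteq> \<beta>"
    from monom_fun_coeffs_zero[OF assms(1) _ res, of "{\<alpha>, \<beta>}" "\<lambda>\<gamma>. if \<gamma> = \<alpha> then 1 else -1" \<alpha>] ab
    show False by auto
  qed
  show "\<not> cfun.dependent (monom_fun Y ` A)"
  proof
    assume "cfun.dependent (monom_fun Y ` A)"
    then obtain S u f where S: "S \<subseteq> monom_fun Y ` A" "finite S" "(\<Sum>f\<in>S. fscale (u f) f) = 0" "f \<in> S" "u f \<noteq> 0"
      unfolding cfun.dependent_explicit by blast
    then obtain A' where A': "A' \<subseteq> A" "S = monom_fun Y ` A'" by (meson subset_imageE)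
    have inj': "inj_on (monom_fun Y) A'" using inj A'(1) inj_on_subset by blast
    have "(\<Sum>\<alpha>\<in>A'. u (monom_fun Y \<alpha>) * monom_fun Y \<alpha> v) = 0" for v
      using fun_cong[OF S(3), of v] by (simp add: sum_fscale_apply A'(2) sum.reindex[OF inj'])
    moreover have "finite A'" using S(2) A'(2) inj' finite_imageD by blast
    ultimately have "u (monom_fun Y \<alpha>) = 0" if "\<alpha> \<in> A'" for \<alpha>
      using that monom_fun_coeffs_zero[OF assms(1) _ res[OF A'(1)], of "\<lambda>\<alpha>. u (monom_fun Y \<alpha>)" \<alpha>] by simp
    thus False using S(4,5) A'(2) by auto
  qed
qed

definition expo :: "nat \<Rightarrow> (nat \<Rightarrow> nat) \<Rightarrow> nat \<Rightarrow> nat \<Rightarrow> int \<Rightarrow> (nat \<times> nat \<Rightarrow> nat) set" where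
  "expo r d n l w = {\<alpha> \<in> PiE (idx r d) (\<lambda>_. UNIV). (\<Sum>p\<in>idx r d. wdeg p * \<alpha> p) = n \<and>
     (\<Sum>p\<in>idx r d. xdeg p * \<alpha> p) = l \<and> (\<Sum>p\<in>idx r d. int (\<alpha> p) * weight d p) = w}"

lemma finite_idx: "finite (idx r d)" by (simp add: idx_def)

lemma finite_expo: "finite (expo r d n l w)"
proof (rule finite_subset)
  show "expo r d n l w \<subseteq> PiE (idx r d) (\<lambda>_. {..n + l})"
  proof
    fix \<alpha> assume a: "\<alpha> \<in> expo r d n l w"
    have "\<alpha> p \<le> n + l" if "p \<in> idx r d" for p
    proof -
      have "\<alpha> p = wdeg p * \<alpha> p + xdeg p * \<alpha> p" by (simp add: wdeg_def xdeg_def)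
      also have "\<dots> \<le> (\<Sum>p\<in>idx r d. wdeg p * \<alpha> p) + (\<Sum>p\<in>idx r d. xdeg p * \<alpha> p)"
        using that finite_idx by (intro add_mono member_le_sum) auto
      finally show ?thesis using a by (simp add: expo_def)
    qed
    with a show "\<alpha> \<in> PiE (idx r d) (\<lambda>_. {..n + l})" by (auto simp: expo_def PiE_iff)
  qed
qed (auto intro: finite_PiE finite_idx)

lemma span_mult:
  fixes f g :: "'a \<Rightarrow> complex"
  assumes "f \<in> cfun.span A" "g \<in> cfun.span B" and AB: "\<And>a b. a \<in> A \<Longrightarrow> b \<in> B \<Longrightarrow> (\<lambda>v. a v * b v) \<in> cfun.span C"
  shows "(\<lambda>v. f v * g v) \<in> cfun.span C"
proof -
  have 1: "(\<lambda>v. f v * b v) \<in> cfun.span C" if b: "b \<in> B" for b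
    using assms(1)
  proof (induction rule: cfun.span_induct_alt)
    case base
    then show ?case using cfun.span_zero by (simp add: zero_fun_def)
  next
    case (step c x y)
    have "(\<lambda>v. (fscale c x + y) v * b v) = fscale c (\<lambda>v. x v * b v) + (\<lambda>v. y v * b v)"
      by (auto simp: fscale_def algebra_simps)
    then show ?case using step AB[OF step(1) b] by (simp add: cfun.span_add cfun.span_scale)
  qed
  from assms(2) show ?thesis
  proof (induction rule: cfun.span_induct_alt)
    case base
    then show ?case using cfun.span_zero by (simp add: zero_fun_def)
  next
    case (step c x y)
    have "(\<lambda>v. f v * (fscale c x + y) v) = fscale c (\<lambda>v. f v * x v) + (\<lambda>v. f v * y v)"
      by (auto simp: fscale_def algebra_simps)
    then show ?case using step 1[OF step(1)] by (simp add: cfun.span_add cfun.span_scale)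
  qed
qed

lemma hom_pow:
  assumes "hom r d n l w f"
  shows "hom r d (k * n) (k * l) (int k * w) (\<lambda>v. f v ^ k)"
proof (induction k)
  case 0
  then show ?case using hom.const[of r d 1] by simp
next
  case (Suc k)
  from hom.mult[OF assms this] show ?case by (simp add: algebra_simps)
qed

lemma hom_monom_fun:
  assumes "Y \<subseteq> idx r d"
  shows "hom r d (\<Sum>p\<in>Y. wdeg p * \<alpha> p) (\<Sum>p\<in>Y. xdeg p * \<alpha> p) (\<Sum>p\<in>Y. int (\<alpha> p) * weight d p) (monom_fun Y \<alpha>)"
proof -
  have "finite Y" using assms finite_idx finite_subset by blast
  thus ?thesis using assms
  proof (induction Y rule: finite_induct)
    case empty
    then show ?case using hom.const[of r d 1] by (simp add: monom_fun_def[abs_def])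
  next
    case (insert p Y)
    have p: "hom r d (\<alpha> p * wdeg p) (\<alpha> p * xdeg p) (int (\<alpha> p) * weight d p) (\<lambda>v. v p ^ \<alpha> p)"
      using insert by (intro hom_pow hom.coord) auto
    have "hom r d (\<alpha> p * wdeg p + (\<Sum>p\<in>Y. wdeg p * \<alpha> p)) (\<alpha> p * xdeg p + (\<Sum>p\<in>Y. xdeg p * \<alpha> p))
       (int (\<alpha> p) * weight d p + (\<Sum>p\<in>Y. int (\<alpha> p) * weight d p)) (\<lambda>v. v p ^ \<alpha> p * monom_fun Y \<alpha> v)"
      using insert by (intro hom.mult[OF p]) auto
    then show ?case using insert by (simp add: monom_fun_def[abs_def] mult.commute)
  qed
qed

lemma hom_subspace: "cfun.subspace {f. hom r d n l w f}"
  by (rule cfun.subspaceI) (auto simp: zero_fun_def plus_fun_def fscale_def intro: hom.zero hom.add hom_scale)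

text \<open>Products of monomials are monomials with added bidegree and weight, so the span contains
  everything that the rules of \<open>hom\<close> generate. This turns dimensions into numbers of
  exponent vectors.\<close>

lemma hom_eq_span: "{f. hom r d n l w f} = cfun.span (monom_fun (idx r d) ` expo r d n l w)"
proof
  show "cfun.span (monom_fun (idx r d) ` expo r d n l w) \<subseteq> {f. hom r d n l w f}"
  proof (rule cfun.span_minimal[OF _ hom_subspace], safe)
    fix \<alpha> assume "\<alpha> \<in> expo r d n l w"
    with hom_monom_fun[OF order_refl, of r d \<alpha>] show "hom r d n l w (monom_fun (idx r d) \<alpha>)"
      by (simp add: expo_def)
  qed
  have "f \<in> cfun.span (monom_fun (idx r d) ` expo r d n l w)" if "hom r d n l w f" for f
    using that
  proof (induction rule: hom.induct)
    case (zero n l w)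
    then show ?case using cfun.span_zero by (simp add: zero_fun_def)
  next
    case (const c)
    have "restrict (\<lambda>_. 0) (idx r d) \<in> expo r d 0 0 0" by (simp add: expo_def)
    moreover have "monom_fun (idx r d) (restrict (\<lambda>_. 0) (idx r d)) = (\<lambda>v. 1)" by (simp add: monom_fun_def[abs_def])
    ultimately have 1: "(\<lambda>v. 1) \<in> cfun.span (monom_fun (idx r d) ` expo r d 0 0 0)" by (metis cfun.span_base imageI)
    have "fscale c (\<lambda>v. 1) = (\<lambda>v. c)" by (simp add: fscale_def)
    from cfun.span_scale[OF 1, of c, unfolded this] show ?case .
  next
    case (coord p)
    define \<alpha> where "\<alpha> = restrict (\<lambda>q. if q = p then 1 else 0 :: nat) (idx r d)"
    have "(\<Sum>q\<in>idx r d. g q * \<alpha> q) = (\<Sum>q\<in>idx r d. if q = p then g p else 0)" for g :: "_ \<Rightarrow> nat"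
      unfolding \<alpha>_def by (rule sum.cong) auto
    moreover have "(\<Sum>q\<in>idx r d. int (\<alpha> q) * g q) = (\<Sum>q\<in>idx r d. if q = p then g p else 0)" for g :: "_ \<Rightarrow> int"
      unfolding \<alpha>_def by (rule sum.cong) auto
    moreover have "\<alpha> \<in> PiE (idx r d) (\<lambda>_. UNIV)" by (simp add: \<alpha>_def)
    ultimately have "\<alpha> \<in> expo r d (wdeg p) (xdeg p) (weight d p)"
      using coord finite_idx by (simp add: expo_def)
    moreover have "monom_fun (idx r d) \<alpha> = (\<lambda>v. v p)"
    proof
      fix v
      have "monom_fun (idx r d) \<alpha> v = (\<Prod>q\<in>idx r d. if q = p then v p else 1)"
        unfolding monom_fun_def \<alpha>_def by (intro prod.cong) auto
      thus "monom_fun (idx r d) \<alpha> v = v p" using coord finite_idx by simp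
    qed
    ultimately show ?case by (intro cfun.span_base image_eqI[of _ _ \<alpha>]) simp_all
  next
    case (add n l w f g)
    then show ?case using cfun.span_add by (fastforce simp: plus_fun_def)
  next
    case (mult n l w f n' l' w' g)
    show ?case
    proof (rule span_mult[OF mult.IH])
      fix a b assume "a \<in> monom_fun (idx r d) ` expo r d n l w" "b \<in> monom_fun (idx r d) ` expo r d n' l' w'"
      then obtain \<alpha> \<beta> where ab: "a = monom_fun (idx r d) \<alpha>" "b = monom_fun (idx r d) \<beta>" "\<alpha> \<in> expo r d n l w" "\<beta> \<in> expo r d n' l' w'"
        by auto
      define \<gamma> where "\<gamma> = restrict (\<lambda>p. \<alpha> p + \<beta> p) (idx r d)"
      have "\<gamma> \<in> expo r d (n + n') (l + l') (w + w')"
      proof -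
        have "(\<Sum>p\<in>idx r d. g p * \<gamma> p) = (\<Sum>p\<in>idx r d. g p * \<alpha> p) + (\<Sum>p\<in>idx r d. g p * \<beta> p)" for g :: "_ \<Rightarrow> nat"
          unfolding \<gamma>_def by (subst sum.distrib[symmetric]) (simp add: distrib_left)
        moreover have "(\<Sum>p\<in>idx r d. int (\<gamma> p) * weight d p) =
          (\<Sum>p\<in>idx r d. int (\<alpha> p) * weight d p) + (\<Sum>p\<in>idx r d. int (\<beta> p) * weight d p)"
          unfolding \<gamma>_def by (subst sum.distrib[symmetric]) (simp add: distrib_right)
        ultimately show ?thesis using ab(3,4) by (simp add: expo_def) (simp add: \<gamma>_def)
      qed
      moreover have "(\<lambda>v. a v * b v) = monom_fun (idx r d) \<gamma>"
        unfolding ab monom_fun_def \<gamma>_def by (intro ext) (simp add: power_add prod.distrib)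
      ultimately show "(\<lambda>v. a v * b v) \<in> cfun.span (monom_fun (idx r d) ` expo r d (n + n') (l + l') (w + w'))"
        by (intro cfun.span_base image_eqI[of _ _ \<gamma>])
    qed
  qed
  thus "{f. hom r d n l w f} \<subseteq> cfun.span (monom_fun (idx r d) ` expo r d n l w)" by blast
qed

lemma dim_hom: "cfun.dim {f. hom r d n l w f} = card (expo r d n l w)"
proof -
  have sub: "expo r d n l w \<subseteq> PiE (idx r d) (\<lambda>_. UNIV)" by (auto simp: expo_def)
  note mi = monom_fun_inj_independent[OF finite_idx sub]
  show ?thesis
    unfolding hom_eq_span cfun.dim_span_eq_card_independent[OF mi(2)] by (rule card_image[OF mi(1)])
qed

text \<open>Instance of \<open>dim_kernel\<close> with E from weight 0 to weight 2 and F back;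
  \<open>up_dn_inj\<close> provides the injectivity of E F.\<close>

lemma dim_highest_weight:
  "card (expo r d n l 0) = cfun.dim {f. hom r d n l 0 f \<and> der (up d) f = 0} + card (expo r d n l 2)"
proof -
  have sub: "expo r d n l 2 \<subseteq> PiE (idx r d) (\<lambda>_. UNIV)" by (auto simp: expo_def)
  have E: "linear_on_subspaces fscale {f. hom r d n l 0 f} {f. hom r d n l 2 f} (der (up d))"
    using hom_up[of r d n l 0]
    by unfold_locales (auto simp: hom_subspace plus_fun_def fscale_def der_add der_cmult)
  have F: "linear_on_subspaces fscale {f. hom r d n l 2 f} {f. hom r d n l 0 f} (der (dn d))"
    using hom_dn[of r d n l 2]
    by unfold_locales (auto simp: hom_subspace plus_fun_def fscale_def der_add der_cmult)
  have inj: "f = 0" if "f \<in> {f. hom r d n l 2 f}" "der (up d) (der (dn d) f) = 0" for f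
    using up_dn_inj[of r d n l f] that by (simp add: zero_fun_def)
  have "cfun.dim {f. hom r d n l 0 f} =
     cfun.dim {f \<in> {f. hom r d n l 0 f}. der (up d) f = 0} + cfun.dim {f. hom r d n l 2 f}"
    by (rule cfun.dim_kernel[OF E F, of "monom_fun (idx r d) ` expo r d n l 2" "monom_fun (idx r d) ` expo r d n l 0"])
      (use inj monom_fun_inj_independent[OF finite_idx sub] in \<open>simp_all add: finite_expo hom_eq_span\<close>)
  thus ?thesis by (simp add: dim_hom)
qed

section \<open>The group action in coordinates\<close>

definition mat2 :: "complex \<Rightarrow> complex \<Rightarrow> complex \<Rightarrow> complex \<Rightarrow> complex^2^2" where
  "mat2 a b c e = vector [vector [a, b], vector [c, e]]"

lemma mat2_nth [simp]: "mat2 a b c e $ 1 $ 1 = a" "mat2 a b c e $ 1 $ 2 = b"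
  "mat2 a b c e $ 2 $ 1 = c" "mat2 a b c e $ 2 $ 2 = e"
  by (simp_all add: mat2_def)

lemma mat2_cases: "\<exists>a b c e. (g :: complex^2^2) = mat2 a b c e"
  by (rule exI[of _ "g $ 1 $ 1"], rule exI[of _ "g $ 1 $ 2"], rule exI[of _ "g $ 2 $ 1"], rule exI[of _ "g $ 2 $ 2"])
     (simp add: vec_eq_iff forall_2)

lemma mat2_mult: "mat2 a b c e ** mat2 a' b' c' e' =
   mat2 (a * a' + b * c') (a * b' + b * e') (c * a' + e * c') (c * b' + e * e')"
  by (simp add: vec_eq_iff forall_2 matrix_matrix_mult_def sum_2)

lemma mat2_vec: "mat2 a b c e *v x = vector [a * x $ 1 + b * x $ 2, c * x $ 1 + e * x $ 2]"
  by (simp add: vec_eq_iff forall_2 matrix_vector_mult_def sum_2)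

lemma det_mat2: "det (mat2 a b c e) = a * e - b * c"
  by (simp add: det_2)

lemma matrix_inv_eqI:
  fixes A B :: "'a::comm_ring_1^'n^'n"
  assumes "A ** B = mat 1" "B ** A = mat 1"
  shows "matrix_inv A = B"
proof -
  have "A ** matrix_inv A = mat 1 \<and> matrix_inv A ** A = mat 1"
    unfolding matrix_inv_def by (rule someI[of _ B]) (use assms in simp)
  hence "matrix_inv A = (B ** A) ** matrix_inv A" "B ** (A ** matrix_inv A) = B"
    using assms by simp_all
  thus ?thesis by (simp add: matrix_mul_assoc)
qed

lemma matrix_inv_mat2:
  assumes "a * e - b * c = 1"
  shows "matrix_inv (mat2 a b c e) = mat2 e (- b) (- c) a"
  using assms
  by (intro matrix_inv_eqI) (simp_all add: mat2_mult vec_eq_iff forall_2 mat_def algebra_simps)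

lemma form_act_mat2:
  "a * e - b * c = 1 \<Longrightarrow> form_act (mat2 a b c e) f = (\<lambda>y. f (vector [e * y $ 1 - b * y $ 2, - c * y $ 1 + a * y $ 2]))"
  by (simp add: form_act_def matrix_inv_mat2 mat2_vec)

section \<open>Coordinates on the representation and on the plane\<close>

definition aug :: "(nat \<Rightarrow> nat) \<Rightarrow> nat \<Rightarrow> nat" where "aug d = d(0 := 1)"

lemma aug_apply: "aug d k = (if k = 0 then 1 else d k)"
  by (simp add: aug_def)

definition form_of :: "nat \<Rightarrow> (nat \<Rightarrow> nat) \<Rightarrow> (nat \<times> nat \<Rightarrow> complex) \<Rightarrow> form_family" where
  "form_of r d v = (\<lambda>k. if k \<in> {1..r} then (\<lambda>y. \<Sum>i\<le>d k. v (k, i) * (y $ 1) ^ i * (y $ 2) ^ (d k - i)) else 0)"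

text \<open>The sign makes the evaluation point equivariantly a linear form, so that it can be treated as
  a summand of degree one with index \<open>0\<close>.\<close>

definition vec_of :: "(nat \<times> nat \<Rightarrow> complex) \<Rightarrow> complex^2" where
  "vec_of v = vector [v (0, 0), - v (0, 1)]"

text \<open>Inverse of \<open>form_of\<close> together with \<open>vec_of\<close>. A form is only
  given as a function, so its coefficients have to be chosen; by \<open>form_coeffs_unique\<close>
  those up to the degree are determined. For families outside \<open>rep r d\<close> the values
  carry no meaning.\<close>

definition crd :: "(nat \<Rightarrow> nat) \<Rightarrow> form_family \<Rightarrow> complex^2 \<Rightarrow> nat \<times> nat \<Rightarrow> complex" where
  "crd d w x = (\<lambda>(k, i). if k = 0 then (if i = 0 then x $ 1 else - x $ 2) else
     (SOME c. \<forall>y. w k y = (\<Sum>i\<le>d k. c i * (y $ 1) ^ i * (y $ 2) ^ (d k - i))) i)"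

text \<open>Setting the second variable to 1 reduces this to polynomials in one variable.\<close>

lemma form_coeffs_unique:
  assumes "\<And>y :: complex^2. (\<Sum>i\<le>n. a i * (y $ 1) ^ i * (y $ 2) ^ (n - i)) = (\<Sum>i\<le>n. b i * (y $ 1) ^ i * (y $ 2) ^ (n - i))" "i \<le> n"
  shows "a i = b i"
proof -
  have "(\<Sum>i\<le>n. (a i - b i) * z ^ i) = 0" for z
    using assms(1)[of "vector [z, 1]"] by (simp add: sum_subtractf algebra_simps)
  hence "a i - b i = 0" using polyfun_eq_0[of "\<lambda>i. a i - b i" n] assms(2) by blast
  thus ?thesis by simp
qed

lemma crd_vec: "crd d w x (0, 0) = x $ 1" "crd d w x (0, Suc i) = - x $ 2"
  by (simp_all add: crd_def)

lemma vec_of_crd: "vec_of (crd d w x) = x"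
  by (simp add: vec_of_def vec_eq_iff forall_2 crd_vec)

lemma form_of_in_rep: "form_of r d v \<in> rep r d"
  by (auto simp: rep_def form_of_def binary_forms_def)

lemma form_of_crd:
  assumes "w \<in> rep r d"
  shows "form_of r d (crd d w x) = w"
proof
  fix k
  show "form_of r d (crd d w x) k = w k"
  proof (cases "k \<in> {1..r}")
    case True
    define P where "P = (\<lambda>c. \<forall>y. w k y = (\<Sum>i\<le>d k. c i * (y $ 1) ^ i * (y $ 2) ^ (d k - i)))"
    have "\<exists>c. P c" using assms True by (auto simp: rep_def binary_forms_def P_def)
    define c where "c = Eps P"
    have "P c" unfolding c_def using \<open>\<exists>c. P c\<close> by (rule someI_ex)
    hence "w k y = (\<Sum>i\<le>d k. c i * (y $ 1) ^ i * (y $ 2) ^ (d k - i))" for y by (simp add: P_def)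
    moreover have "crd d w x (k, i) = c i" for i using True by (simp add: crd_def P_def c_def)
    ultimately show ?thesis using True by (simp add: form_of_def fun_eq_iff)
  next
    case False
    then show ?thesis using assms by (auto simp: form_of_def rep_def)
  qed
qed

lemma crd_form_of:
  assumes "k \<in> {1..r}" "i \<le> d k"
  shows "crd d (form_of r d v) x (k, i) = v (k, i)"
proof (rule form_coeffs_unique[where n = "d k" and a = "\<lambda>i. crd d (form_of r d v) x (k, i)" and b = "\<lambda>i. v (k, i)"])
  fix y :: "complex^2"
  have "form_of r d (crd d (form_of r d v) x) k y = form_of r d v k y"
    by (simp add: form_of_crd form_of_in_rep)
  thus "(\<Sum>i\<le>d k. crd d (form_of r d v) x (k, i) * (y $ 1) ^ i * (y $ 2) ^ (d k - i)) =
    (\<Sum>i\<le>d k. v (k, i) * (y $ 1) ^ i * (y $ 2) ^ (d k - i))"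
    using assms(1) by (simp add: form_of_def)
qed fact

lemma crd_form_vec_of:
  assumes "p \<in> idx r (aug d)"
  shows "crd d (form_of r d v) (vec_of v) p = v p"
proof (cases p)
  case (Pair k i)
  show ?thesis
  proof (cases "k = 0")
    case True
    then have "i = 0 \<or> i = Suc 0" using assms Pair by (auto simp: idx_def aug_apply)
    then show ?thesis using True Pair by (auto simp: crd_vec vec_of_def)
  next
    case False
    then show ?thesis using assms Pair by (simp add: crd_form_of idx_def aug_apply)
  qed
qed

lemma hom_cong: "hom r d n l w f \<Longrightarrow> (\<And>p. p \<in> idx r d \<Longrightarrow> u p = v p) \<Longrightarrow> f u = f v"
  by (induction rule: hom.induct) auto

section \<open>The one-parameter subgroups in coordinates\<close>

definition flip :: "(nat \<Rightarrow> nat) \<Rightarrow> (nat \<times> nat \<Rightarrow> complex) \<Rightarrow> nat \<times> nat \<Rightarrow> complex" where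
  "flip d v = (\<lambda>(k, i). v (k, d k - i))"
text \<open>Coefficients of the form \<open>f (y1 - x * y2, y2)\<close>, by the binomial theorem;
  for \<open>j < i\<close> the binomial coefficient vanishes, so the truncated exponent does no
  harm. Conjugation by \<open>flip\<close>, the exchange of the two variables, gives
  \<open>f (y1, y2 - x * y1)\<close> in \<open>shear'\<close>.\<close>

definition shear :: "(nat \<Rightarrow> nat) \<Rightarrow> complex \<Rightarrow> (nat \<times> nat \<Rightarrow> complex) \<Rightarrow> nat \<times> nat \<Rightarrow> complex" where
  "shear d x v = (\<lambda>(k, i). \<Sum>j\<le>d k. of_nat (j choose i) * (- x) ^ (j - i) * v (k, j))"
definition shear' :: "(nat \<Rightarrow> nat) \<Rightarrow> complex \<Rightarrow> (nat \<times> nat \<Rightarrow> complex) \<Rightarrow> nat \<times> nat \<Rightarrow> complex" where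
  "shear' d x v = flip d (shear d x (flip d v))"

lemma shear_0: "p \<in> idx r d \<Longrightarrow> shear d 0 v p = v p"
proof (cases p)
  case (Pair k i)
  assume "p \<in> idx r d"
  hence "i \<le> d k" by (simp add: Pair idx_def)
  have "shear d 0 v p = (\<Sum>j\<le>d k. if j = i then v (k, j) else 0)"
    unfolding shear_def Pair prod.case
  proof (rule sum.cong)
    fix j
    show "of_nat (j choose i) * (- 0) ^ (j - i) * v (k, j) = (if j = i then v (k, j) else 0)"
      by (cases j i rule: linorder_cases) (simp_all add: binomial_eq_0 power_0_left)
  qed simp
  thus ?thesis using \<open>i \<le> d k\<close> by (simp add: Pair)
qed

lemma shear'_0: "p \<in> idx r d \<Longrightarrow> shear' d 0 v p = v p"
proof (cases p)
  case (Pair k i)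
  assume "p \<in> idx r d"
  hence "(k, d k - i) \<in> idx r d" "i \<le> d k" by (simp_all add: Pair idx_def)
  thus ?thesis using shear_0[of "(k, d k - i)" r d "flip d v"] by (simp add: Pair shear'_def flip_def)
qed

text \<open>So \<open>shear\<close> is the flow of the vector field \<open>up\<close>: the
  derivative is known at every \<open>x\<close>, not just at 0, which later makes polynomials with E
  f = 0 constant along whole curves. The identity behind it is
  \<open>(j choose i) * (j - i) = (i + 1) * (j choose (i + 1))\<close>.\<close>

lemma DERIV_shear_coord:
  "((\<lambda>x. shear d x v p) has_field_derivative up d (shear d x v) p) (at x)"
proof (cases p)
  case (Pair k i)
  have "((\<lambda>x. shear d x v p) has_field_derivative
     (\<Sum>j\<le>d k. of_nat (j choose i) * (of_nat (j - i) * (- x) ^ (j - i - 1) * (- 1)) * v (k, j))) (at x)"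
    unfolding shear_def Pair by (auto intro!: derivative_eq_intros sum.cong)
  also have "(\<Sum>j\<le>d k. of_nat (j choose i) * (of_nat (j - i) * (- x) ^ (j - i - 1) * (- 1)) * v (k, j)) =
     - of_nat (i + 1) * (\<Sum>j\<le>d k. of_nat (j choose (i + 1)) * (- x) ^ (j - (i + 1)) * v (k, j))"
    unfolding sum_distrib_left
  proof (rule sum.cong)
    fix j
    have "(j choose i) * (j - i) = (i + 1) * (j choose (i + 1))"
      using binomial_absorb_comp[of j i] binomial_absorption[of i j] by (simp add: mult.commute)
    hence "of_nat (j choose i) * of_nat (j - i) = (of_nat (i + 1) * of_nat (j choose (i + 1)) :: complex)"
      by (metis of_nat_mult)
    thus "of_nat (j choose i) * (of_nat (j - i) * (- x) ^ (j - i - 1) * (- 1)) * v (k, j) =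
       - of_nat (i + 1) * (of_nat (j choose (i + 1)) * (- x) ^ (j - (i + 1)) * v (k, j))"
      by (simp add: mult_ac del: of_nat_Suc of_nat_add)
  qed simp
  also have "\<dots> = up d (shear d x v) p"
  proof (cases "i < d k")
    case False
    hence "of_nat (j choose (i + 1)) = (0 :: complex)" if "j \<le> d k" for j
      using that by (simp add: binomial_eq_0)
    hence "(\<Sum>j\<le>d k. of_nat (j choose (i + 1)) * (- x) ^ (j - (i + 1)) * v (k, j)) = 0"
      by (intro sum.neutral) auto
    thus ?thesis using False by (simp add: up_def Pair)
  qed (simp add: up_def shear_def Pair)
  finally show ?thesis .
qed

text \<open>Conjugate of the previous lemma by \<open>flip\<close>, which undoes itself on indices
  with \<open>i \<le> d k\<close>; hence the restriction to \<open>idx\<close>.\<close>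

lemma DERIV_shear'_coord:
  assumes "p \<in> idx r d"
  shows "((\<lambda>x. shear' d x v p) has_field_derivative dn d (shear' d x v) p) (at x)"
proof (cases p)
  case (Pair k i)
  with assms have "i \<le> d k" by (simp add: idx_def)
  hence "up d (shear d x (flip d v)) (k, d k - i) = dn d (shear' d x v) p"
    by (auto simp: Pair up_def dn_def shear'_def flip_def Suc_diff_le)
  thus ?thesis using DERIV_shear_coord[of d "flip d v" "(k, d k - i)" x]
    by (simp add: Pair shear'_def flip_def)
qed

text \<open>The chain rule along an integral curve \<open>a\<close> of the vector field
  \<open>N\<close>.\<close>

lemma DERIV_hom:
  assumes "hom r d n l w f" and c: "\<And>p x. p \<in> idx r d \<Longrightarrow> ((\<lambda>x. a x p) has_field_derivative N (a x) p) (at x)"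
  shows "((\<lambda>x. f (a x)) has_field_derivative der N f (a x)) (at x)"
  using assms(1)
proof (induction rule: hom.induct)
  case (mult n l w f n' l' w' g)
  show ?case unfolding der_mult[OF mult.hyps]
    using DERIV_mult[OF mult.IH] by (simp add: algebra_simps)
qed (auto simp: der_const der_coord der_add intro: c DERIV_add)

lemma form_of_flip: "form_of r d (flip d v) k y = form_of r d v k (vector [y $ 2, y $ 1])"
proof -
  have "(\<Sum>i\<le>d k. v (k, d k - i) * (y $ 1) ^ i * (y $ 2) ^ (d k - i)) =
    (\<Sum>i\<le>d k. v (k, i) * (y $ 2) ^ i * (y $ 1) ^ (d k - i))"
    by (rule sum.reindex_bij_witness[of _ "\<lambda>i. d k - i" "\<lambda>i. d k - i"]) auto
  thus ?thesis by (simp add: form_of_def flip_def)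
qed

lemma form_of_shear: "form_of r d (shear d x v) k y = form_of r d v k (vector [y $ 1 - x * y $ 2, y $ 2])"
proof -
  have "(\<Sum>i\<le>d k. shear d x v (k, i) * (y $ 1) ^ i * (y $ 2) ^ (d k - i)) =
    (\<Sum>j\<le>d k. \<Sum>i\<le>d k. of_nat (j choose i) * (- x) ^ (j - i) * v (k, j) * (y $ 1) ^ i * (y $ 2) ^ (d k - i))"
    unfolding shear_def by (subst sum.swap) (simp add: sum_distrib_right)
  also have "\<dots> = (\<Sum>j\<le>d k. v (k, j) * (y $ 1 - x * y $ 2) ^ j * (y $ 2) ^ (d k - j))"
  proof (rule sum.cong)
    fix j assume j: "j \<in> {..d k}"
    have "(\<Sum>i\<le>d k. of_nat (j choose i) * (- x) ^ (j - i) * v (k, j) * (y $ 1) ^ i * (y $ 2) ^ (d k - i)) =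
      (\<Sum>i\<le>j. of_nat (j choose i) * (- x) ^ (j - i) * v (k, j) * (y $ 1) ^ i * (y $ 2) ^ (d k - i))"
      using j by (intro sum.mono_neutral_right) (auto simp: binomial_eq_0)
    also have "\<dots> = (\<Sum>i\<le>j. of_nat (j choose i) * (y $ 1) ^ i * (- x * y $ 2) ^ (j - i)) * (v (k, j) * (y $ 2) ^ (d k - j))"
      unfolding sum_distrib_right
    proof (rule sum.cong)
      fix i assume "i \<in> {..j}"
      hence "d k - i = (j - i) + (d k - j)" using j by simp
      hence "(y $ 2) ^ (d k - i) = (y $ 2) ^ (j - i) * (y $ 2) ^ (d k - j)" by (metis power_add)
      thus "of_nat (j choose i) * (- x) ^ (j - i) * v (k, j) * (y $ 1) ^ i * (y $ 2) ^ (d k - i) =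
        of_nat (j choose i) * (y $ 1) ^ i * (- x * y $ 2) ^ (j - i) * (v (k, j) * (y $ 2) ^ (d k - j))"
        unfolding power_mult_distrib by (simp only: mult_ac)
    qed simp
    also have "(\<Sum>i\<le>j. of_nat (j choose i) * (y $ 1) ^ i * (- x * y $ 2) ^ (j - i)) = (y $ 1 - x * y $ 2) ^ j"
      using binomial_ring[of "y $ 1" "- x * y $ 2" j] by simp
    finally show "(\<Sum>i\<le>d k. of_nat (j choose i) * (- x) ^ (j - i) * v (k, j) * (y $ 1) ^ i * (y $ 2) ^ (d k - i)) =
      v (k, j) * (y $ 1 - x * y $ 2) ^ j * (y $ 2) ^ (d k - j)" by (simp only: mult_ac)
  qed simp
  finally show ?thesis by (simp add: form_of_def)
qed

lemma form_of_cong: "(\<And>k i. k \<in> {1..r} \<Longrightarrow> i \<le> d k \<Longrightarrow> u (k, i) = v (k, i)) \<Longrightarrow> form_of r d u = form_of r d v"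
  by (auto simp: form_of_def fun_eq_iff intro!: sum.cong)

lemma rep_act_shear:
  "rep_act (mat2 1 x 0 1) (form_of r d v) = form_of r d (shear d x v)"
  "mat2 1 x 0 1 *v vec_of v = vec_of (shear (aug d) x v)"
  by (simp_all add: rep_act_def form_act_mat2 fun_eq_iff form_of_shear)
    (simp add: mat2_vec vec_of_def shear_def aug_apply)

lemma rep_act_shear':
  "rep_act (mat2 1 0 x 1) (form_of r d v) = form_of r d (shear' d x v)"
  "mat2 1 0 x 1 *v vec_of v = vec_of (shear' (aug d) x v)"
  by (simp_all add: rep_act_def form_act_mat2 fun_eq_iff shear'_def form_of_flip form_of_shear)
    (simp add: mat2_vec vec_of_def shear_def flip_def aug_apply)

lemma form_of_upd0: "form_of r d (shear d x v) = form_of r d (shear (aug d) x v)"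
  "form_of r d (shear' d x v) = form_of r d (shear' (aug d) x v)"
  by (rule form_of_cong; simp add: shear_def shear'_def flip_def aug_apply)+

text \<open>The exponent is minus the weight because \<open>form_act\<close> substitutes the inverse
  matrix: the first variable is multiplied by \<open>inverse a\<close>, the second by
  \<open>a\<close>.\<close>

definition torus :: "(nat \<Rightarrow> nat) \<Rightarrow> complex \<Rightarrow> (nat \<times> nat \<Rightarrow> complex) \<Rightarrow> nat \<times> nat \<Rightarrow> complex" where
  "torus d a v = (\<lambda>p. a powi (- weight d p) * v p)"

lemma rep_act_torus:
  assumes "a \<noteq> 0"
  shows "rep_act (mat2 a 0 0 (inverse a)) (form_of r d v) = form_of r d (torus (aug d) a v)"
  and "mat2 a 0 0 (inverse a) *v vec_of v = vec_of (torus (aug d) a v)"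
proof -
  have "inverse a ^ i * a ^ (d k - i) = a powi (int (d k) - 2 * int i)" if "i \<le> d k" for i k
  proof -
    have "a powi (int (d k) - 2 * int i) = a powi (int (d k - i) + - int i)" using that by (simp add: of_nat_diff)
    also have "\<dots> = a ^ (d k - i) * inverse a ^ i"
      using assms by (subst power_int_add) (simp_all add: power_int_minus power_inverse)
    finally show ?thesis by simp
  qed
  hence "v (k, i) * (inverse a * y1) ^ i * (a * y2) ^ (d k - i) =
     a powi (int (d k) - 2 * int i) * v (k, i) * y1 ^ i * y2 ^ (d k - i)" if "i \<le> d k" for i k y1 y2
    using that by (simp add: power_mult_distrib mult_ac) 
  thus "rep_act (mat2 a 0 0 (inverse a)) (form_of r d v) = form_of r d (torus (aug d) a v)"
    using assms by (auto simp: rep_act_def form_act_mat2 fun_eq_iff form_of_def torus_def weight_def aug_apply intro!: sum.cong)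
  show "mat2 a 0 0 (inverse a) *v vec_of v = vec_of (torus (aug d) a v)"
    using assms by (simp add: mat2_vec vec_of_def torus_def weight_def aug_apply power_int_minus)
qed

lemma hom_torus:
  assumes "a \<noteq> 0"
  shows "hom r d n l w f \<Longrightarrow> f (torus d a v) = a powi (- w) * f v"
proof (induction rule: hom.induct)
  case (mult n l w f n' l' w' g)
  then show ?case using assms power_int_add[of a "-w" "-w'"] by simp
qed (auto simp: torus_def algebra_simps)

section \<open>Covariants as highest weight vectors\<close>

text \<open>The weight is left open: pulling back a tensor yields a sum of weight vectors, and only
  invariance under the torus singles out weight 0.\<close>

definition bihom :: "nat \<Rightarrow> (nat \<Rightarrow> nat) \<Rightarrow> nat \<Rightarrow> nat \<Rightarrow> ((nat \<times> nat \<Rightarrow> complex) \<Rightarrow> complex) set" where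
  "bihom r d n l = cfun.span {f. \<exists>w. hom r d n l w f}"

lemma hom_bihom: "hom r d n l w f \<Longrightarrow> f \<in> bihom r d n l"
  unfolding bihom_def by (rule cfun.span_base) auto

lemma bihom_mult: "f \<in> bihom r d n l \<Longrightarrow> g \<in> bihom r d n' l' \<Longrightarrow> (\<lambda>v. f v * g v) \<in> bihom r d (n + n') (l + l')"
  unfolding bihom_def by (rule span_mult) (auto intro!: cfun.span_base hom.mult)

lemma bihom_sum: "(\<And>a. a \<in> A \<Longrightarrow> f a \<in> bihom r d n l) \<Longrightarrow> (\<lambda>v. \<Sum>a\<in>A. f a v) \<in> bihom r d n l"
proof (induction A rule: infinite_finite_induct)
  case (insert x F)
  then show ?case
    using cfun.span_add[of "f x" "{f. \<exists>w. hom r d n l w f}" "\<lambda>v. \<Sum>a\<in>F. f a v"]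
    by (simp add: bihom_def plus_fun_def)
qed (auto intro: hom_bihom hom.zero)

lemma span_pullback:
  fixes f :: "'a \<Rightarrow> complex" and \<phi> :: "'b \<Rightarrow> 'a"
  assumes "f \<in> cfun.span S" "\<And>g. g \<in> S \<Longrightarrow> (\<lambda>v. g (\<phi> v)) \<in> cfun.span C"
  shows "(\<lambda>v. f (\<phi> v)) \<in> cfun.span C"
  using assms(1)
proof (induction rule: cfun.span_induct_alt)
  case base
  then show ?case using cfun.span_zero by (simp add: zero_fun_def)
next
  case (step c x y)
  have "(\<lambda>v. (fscale c x + y) (\<phi> v)) = fscale c (\<lambda>v. x (\<phi> v)) + (\<lambda>v. y (\<phi> v))"
    by (auto simp: fscale_def)
  then show ?case using step assms(2)[OF step(1)] by (simp add: cfun.span_add cfun.span_scale)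
qed

lemma span_vanish:
  fixes f :: "'a \<Rightarrow> complex"
  assumes "f \<in> cfun.span S" "\<And>g. g \<in> S \<Longrightarrow> g a = 0"
  shows "f a = 0"
  using assms(1) by (induction rule: cfun.span_induct_alt) (auto simp: fscale_def assms(2))

lemma form_of_add: "form_of r d (\<lambda>p. u p + v p) = form_of r d u + form_of r d v"
  by (auto simp: form_of_def fun_eq_iff sum.distrib algebra_simps)

lemma form_of_scale: "form_of r d (\<lambda>p. c * v p) = (\<lambda>k. fscale c (form_of r d v k))"
  by (auto simp: form_of_def fun_eq_iff fscale_def sum_distrib_left algebra_simps)

definition widx :: "nat \<Rightarrow> (nat \<Rightarrow> nat) \<Rightarrow> (nat \<times> nat) set" where
  "widx r d = (SIGMA k:{1..r}. {..d k})"

lemma finite_widx: "finite (widx r d)" by (simp add: widx_def)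

lemma idx_eq: "idx r (aug d) = insert (0, 0) (insert (0, 1) (widx r d))"
  by (auto simp: idx_def widx_def aug_apply le_Suc_eq split: if_splits)

text \<open>A member of \<open>linear_forms_on\<close> is linear only on \<open>rep r d\<close>; all
  families formed in the induction are values of \<open>form_of\<close>, hence stay in that
  space.\<close>

lemma linear_form_expand:
  assumes "l \<in> linear_forms_on (rep r d)"
  shows "l (form_of r d v) = (\<Sum>p\<in>widx r d. v p * l (form_of r d (\<lambda>q. if q = p then 1 else 0)))"
proof -
  have add: "l (form_of r d u + form_of r d v) = l (form_of r d u) + l (form_of r d v)"
    and scale: "l (\<lambda>k. fscale c (form_of r d v k)) = c * l (form_of r d v)" for u v c
    using assms by (auto simp: linear_forms_on_def form_of_in_rep)
  have "l (form_of r d (\<lambda>p. if p \<in> Y then v p else 0)) =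
      (\<Sum>p\<in>Y. v p * l (form_of r d (\<lambda>q. if q = p then 1 else 0)))" if "finite Y" for Y
    using that
  proof (induction Y rule: finite_induct)
    case empty
    have "form_of r d (\<lambda>p. 0) = (\<lambda>k. fscale 0 (form_of r d v k))" using form_of_scale[of r d 0 v] by simp
    hence "l (form_of r d (\<lambda>p. 0)) = 0 * l (form_of r d v)" by (simp only: scale)
    thus ?case by simp
  next
    case (insert x Y)
    have eq: "(\<lambda>p. if p \<in> insert x Y then v p else 0) =
        (\<lambda>p. v x * (if p = x then 1 else 0) + (if p \<in> Y then v p else 0))"
      using insert by (auto simp: fun_eq_iff)
    show ?case unfolding eq form_of_add add unfolding form_of_scale scale
      using insert by (subst sum.insert) auto
  qed
  from this[OF finite_widx]
  have "l (form_of r d (\<lambda>p. if p \<in> widx r d then v p else 0)) =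
      (\<Sum>p\<in>widx r d. v p * l (form_of r d (\<lambda>q. if q = p then 1 else 0)))" .
  moreover have "form_of r d (\<lambda>p. if p \<in> widx r d then v p else 0) = form_of r d v"
    by (rule form_of_cong) (auto simp: widx_def)
  ultimately show ?thesis by (simp only:)
qed

lemma linear_form_bihom:
  assumes "l \<in> linear_forms_on (rep r d)"
  shows "(\<lambda>v. l (form_of r d v)) \<in> bihom r (aug d) 1 0"
proof -
  have "(\<lambda>v. l (form_of r d (\<lambda>q. if q = p then 1 else 0)) * v p) \<in> bihom r (aug d) 1 0"
    if p: "p \<in> widx r d" for p
  proof -
    have "p \<in> idx r (aug d)" "wdeg p = 1" "xdeg p = 0"
      using p by (auto simp: idx_eq wdeg_def xdeg_def widx_def)
    with hom.coord[OF this(1)] show ?thesis by (intro hom_bihom hom_scale) auto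
  qed
  from bihom_sum[of "widx r d", OF this]
  show ?thesis by (subst linear_form_expand[OF assms]) (simp add: mult.commute)
qed

lemma coord_ring_bihom:
  assumes "p \<in> coord_ring (rep r d) n"
  shows "(\<lambda>v. p (form_of r d v)) \<in> bihom r (aug d) n 0"
proof -
  have prod: "(\<lambda>v. \<Prod>j<n. l j (form_of r d v)) \<in> bihom r (aug d) n 0"
    if "\<forall>j<n. l j \<in> linear_forms_on (rep r d)" for n l
    using that
  proof (induction n)
    case 0
    show ?case using hom_bihom[OF hom.const[of r "aug d" 1]] by simp
  next
    case (Suc n)
    then show ?case using bihom_mult[of _ r "aug d" n 0 _ 1 0] linear_form_bihom by simp
  qed
  show ?thesis
    unfolding bihom_def
    by (rule span_pullback[OF assms[unfolded coord_ring_def]])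
      (use prod in \<open>auto simp: form_of_in_rep bihom_def\<close>)
qed

lemma binary_forms_bihom:
  assumes "g \<in> binary_forms L"
  shows "(\<lambda>v. g (vec_of v)) \<in> bihom r (aug d) 0 L"
proof -
  obtain c where c: "g x = (\<Sum>i\<le>L. c i * (x $ 1) ^ i * (x $ 2) ^ (L - i))" for x
    using assms by (auto simp: binary_forms_def)
  have c0: "hom r (aug d) 0 1 (weight (aug d) (0, j)) (\<lambda>v. v (0, j))" if "j \<le> 1" for j
    using hom.coord[of "(0, j)" r "aug d"] that by (auto simp: idx_def aug_apply wdeg_def xdeg_def)
  have "(\<lambda>v. c i * (- 1) ^ (L - i) * (v (0, 0) ^ i * v (0, 1) ^ (L - i))) \<in> bihom r (aug d) 0 L"
    if "i \<le> L" for i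
  proof -
    have "L = i * 1 + (L - i) * 1" "0 = i * 0 + (L - i) * 0" using that by simp_all
    thus ?thesis
      using hom.mult[OF hom_pow[OF c0[of 0], of i] hom_pow[OF c0[of 1], of "L - i"]]
      by (intro hom_bihom hom_scale) auto
  qed
  hence "(\<lambda>v. \<Sum>i\<le>L. c i * (- 1) ^ (L - i) * (v (0, 0) ^ i * v (0, 1) ^ (L - i))) \<in> bihom r (aug d) 0 L"
    by (intro bihom_sum) auto
  moreover have "(- v (0, 1)) ^ (L - i) = (- 1) ^ (L - i) * v (0, 1) ^ (L - i)" for v :: "nat \<times> nat \<Rightarrow> complex" and i
    by (rule power_minus)
  ultimately show ?thesis by (simp add: c vec_of_def mult_ac)
qed

lemma tensor_bihom:
  assumes "F \<in> tensor (coord_ring (rep r d) n) (binary_forms L)"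
  shows "(\<lambda>v. F (form_of r d v, vec_of v)) \<in> bihom r (aug d) n L"
  unfolding bihom_def
proof (rule span_pullback[OF assms[unfolded tensor_def]])
  fix G assume "G \<in> {tensor_fun f g | f g. f \<in> coord_ring (rep r d) n \<and> g \<in> binary_forms L}"
  then obtain f g where "G = tensor_fun f g" "f \<in> coord_ring (rep r d) n" "g \<in> binary_forms L" by auto
  thus "(\<lambda>v. G (form_of r d v, vec_of v)) \<in> cfun.span {f. \<exists>w. hom r (aug d) n L w f}"
    using bihom_mult[OF coord_ring_bihom binary_forms_bihom] by (simp add: tensor_fun_def bihom_def)
qed

lemma coord_ring_vanish: "p \<in> coord_ring W n \<Longrightarrow> w \<notin> W \<Longrightarrow> p w = 0"
  unfolding coord_ring_def by (erule span_vanish) auto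

lemma tensor_vanish: "F \<in> tensor (coord_ring W n) V \<Longrightarrow> w \<notin> W \<Longrightarrow> F (w, x) = 0"
  unfolding tensor_def by (erule span_vanish) (auto simp: tensor_fun_def coord_ring_vanish)

text \<open>One torus element is enough because 2 is not a root of unity: comparing coefficients of
  monomials gives \<open>c \<alpha> * (2 powi (- wt \<alpha>) - 1) = 0\<close>, so a monomial of
  nonzero weight has coefficient 0.\<close>

lemma bihom_torus_invariant:
  assumes "f \<in> bihom r d n l" and inv: "\<And>v. f (torus d 2 v) = f v"
  shows "hom r d n l 0 f"
proof -
  define M where "M = monom_fun (idx r d) ` (\<Union>w. expo r d n l w)"
  have sub: "(\<Union>w. expo r d n l w) \<subseteq> PiE (idx r d) (\<lambda>_. UNIV)" by (auto simp: expo_def)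
  note mi = monom_fun_inj_independent[OF finite_idx sub]
  have "f \<in> cfun.span M"
  proof (rule subsetD[OF cfun.span_minimal[OF _ cfun.subspace_span] assms(1)[unfolded bihom_def]], safe)
    fix f w assume "hom r d n l w f"
    hence "f \<in> cfun.span (monom_fun (idx r d) ` expo r d n l w)" using hom_eq_span by blast
    thus "f \<in> cfun.span M" using cfun.span_mono[of "monom_fun (idx r d) ` expo r d n l w" M] by (auto simp: M_def)
  qed
  then obtain S u where S: "finite S" "S \<subseteq> M" "f = (\<Sum>a\<in>S. fscale (u a) a)"
    unfolding cfun.span_explicit by auto
  define wt where "wt \<alpha> = (\<Sum>p\<in>idx r d. int (\<alpha> p) * weight d p)" for \<alpha>
  obtain A where A: "A \<subseteq> (\<Union>w. expo r d n l w)" "S = monom_fun (idx r d) ` A"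
    using S(2) unfolding M_def by (meson subset_imageE)
  have injA: "inj_on (monom_fun (idx r d)) A" using mi(1) A(1) inj_on_subset by blast
  have finA: "finite A" using S(1) A(2) injA finite_imageD by blast
  define c where "c \<alpha> = u (monom_fun (idx r d) \<alpha>)" for \<alpha>
  have f: "f v = (\<Sum>\<alpha>\<in>A. c \<alpha> * monom_fun (idx r d) \<alpha> v)" for v
    by (simp add: S(3) A(2) sum.reindex[OF injA] sum_fscale_apply c_def)
  have hA: "hom r d n l (wt \<alpha>) (monom_fun (idx r d) \<alpha>)" if "\<alpha> \<in> A" for \<alpha>
    using hom_monom_fun[OF order_refl, of r d \<alpha>] that A(1) by (auto simp: expo_def wt_def)
  have "(\<Sum>\<alpha>\<in>A. c \<alpha> * (2 powi (- wt \<alpha>) - 1) * monom_fun (idx r d) \<alpha> v) = 0" for v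
  proof -
    have "f (torus d 2 v) = (\<Sum>\<alpha>\<in>A. c \<alpha> * (2 powi (- wt \<alpha>) * monom_fun (idx r d) \<alpha> v))"
      unfolding f by (intro sum.cong refl) (simp add: hom_torus[OF _ hA])
    with inv[of v] show ?thesis by (simp add: f algebra_simps sum_subtractf)
  qed
  moreover have "inj_on (\<lambda>\<alpha>. restrict \<alpha> (idx r d)) A"
  proof (rule inj_onI)
    fix \<alpha> \<beta> assume ab: "\<alpha> \<in> A" "\<beta> \<in> A" "restrict \<alpha> (idx r d) = restrict \<beta> (idx r d)"
    have "\<alpha> \<in> PiE (idx r d) (\<lambda>_. UNIV)" "\<beta> \<in> PiE (idx r d) (\<lambda>_. UNIV)" using ab A(1) sub by blast+
    thus "\<alpha> = \<beta>" using ab(3) PiE_restrict by metis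
  qed
  ultimately have c0: "c \<alpha> * (2 powi (- wt \<alpha>) - 1) = 0" if "\<alpha> \<in> A" for \<alpha>
    using monom_fun_coeffs_zero[OF finite_idx finA, of r d "\<lambda>\<alpha>. c \<alpha> * (2 powi (- wt \<alpha>) - 1)" \<alpha>] that by blast
  have "(2 :: complex) powi k = 1 \<Longrightarrow> k = 0" for k
  proof -
    assume "(2 :: complex) powi k = 1"
    hence "(2 :: real) powi k = 1" by (metis norm_numeral norm_one norm_power_int)
    thus "k = 0" using power_int_strict_increasing[of 0 k "2::real"] power_int_strict_increasing[of k 0 "2::real"]
      by (cases k "0::int" rule: linorder_cases) auto
  qed
  hence "c \<alpha> = 0 \<or> wt \<alpha> = 0" if "\<alpha> \<in> A" for \<alpha> using c0[OF that] by fastforce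
  hence "hom r d n l 0 (\<lambda>v. c \<alpha> * monom_fun (idx r d) \<alpha> v)" if "\<alpha> \<in> A" for \<alpha>
    using hA[OF that] that hom_scale hom.zero by fastforce
  hence "hom r d n l 0 (\<lambda>v. \<Sum>\<alpha>\<in>A. c \<alpha> * monom_fun (idx r d) \<alpha> v)" by (rule hom_sum)
  thus ?thesis by (simp add: f[abs_def])
qed

section \<open>Generation of the group and extension of highest weight vectors\<close>

lemma rep_act_mult:
  assumes "g \<in> SL2" "h \<in> SL2"
  shows "rep_act (g ** h) w = rep_act g (rep_act h w)"
proof -
  obtain a b c e a' b' c' e' where gh: "g = mat2 a b c e" "h = mat2 a' b' c' e'" using mat2_cases by metis
  have "a * e - b * c = 1" "a' * e' - b' * c' = 1" using assms by (auto simp: SL2_def gh det_mat2)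
  moreover have "det (g ** h) = 1" using assms by (simp add: SL2_def det_mul)
  ultimately show ?thesis
    by (simp add: gh mat2_mult rep_act_def form_act_def matrix_inv_mat2 det_mat2 mat2_vec fun_eq_iff algebra_simps)
qed

lemma SL2_induct:
  assumes g: "g \<in> SL2"
    and u: "\<And>x. P (mat2 1 x 0 1)" and l: "\<And>x. P (mat2 1 0 x 1)"
    and m: "\<And>g h. g \<in> SL2 \<Longrightarrow> h \<in> SL2 \<Longrightarrow> P g \<Longrightarrow> P h \<Longrightarrow> P (g ** h)"
  shows "P g"
proof -
  have SL: "mat2 1 x 0 1 \<in> SL2" "mat2 1 0 x 1 \<in> SL2" for x by (simp_all add: SL2_def det_mat2)
  have 1: "P (mat2 a b c e)" if "c \<noteq> 0" "a * e - b * c = 1" for a b c e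
  proof -
    \<comment> \<open>Upper, lower, upper: \<open>c\<close> fixes the middle factor and the diagonal
      entries \<open>a\<close> and \<open>e\<close> fix the outer two; the determinant then takes
      care of \<open>b\<close>.\<close>
    have "mat2 a b c e = mat2 1 ((a - 1) / c) 0 1 ** (mat2 1 0 c 1 ** mat2 1 ((e - 1) / c) 0 1)"
    proof -
      have "b = (a * e - 1) / c" using that by (simp add: field_simps)
      moreover have "1 + (a - 1) / c * c = a" "1 + c * ((e - 1) / c) = e"
        "(e - 1) / c + (a - 1) / c * (c * ((e - 1) / c) + 1) = (a * e - 1) / c"
        using that(1) by (simp_all add: field_simps)
      ultimately show ?thesis using that(1) by (simp add: mat2_mult)
    qed
    moreover have "mat2 1 0 c 1 ** mat2 1 ((e - 1) / c) 0 1 \<in> SL2" using SL by (simp add: SL2_def det_mul)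
    ultimately show ?thesis by (simp add: m SL u l)
  qed
  obtain a b c e where g': "g = mat2 a b c e" using mat2_cases by metis
  have det: "a * e - b * c = 1" using g by (simp add: g' SL2_def det_mat2)
  show ?thesis
  proof (cases "c = 0")
    case True
    hence "a \<noteq> 0" using det by auto
    \<comment> \<open>Adding the first row to the second makes the lower left entry nonzero;
      \<open>mat2 1 0 (-1) 1\<close> undoes this.\<close>
    have "P (mat2 a b a (b + e))" using det True \<open>a \<noteq> 0\<close> by (intro 1) (auto simp: algebra_simps)
    moreover have "mat2 a b a (b + e) \<in> SL2" using det True by (simp add: SL2_def det_mat2 algebra_simps)
    ultimately have "P (mat2 1 0 (-1) 1 ** mat2 a b a (b + e))" by (intro m SL l)
    thus ?thesis using True by (simp add: g' mat2_mult)
  qed (use 1 det g' in simp)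
qed

lemma tensor_act_invariant_iff:
  "(\<forall>g\<in>SL2. tensor_act g F = F) \<longleftrightarrow> (\<forall>g\<in>SL2. \<forall>w x. F (rep_act g w, g *v x) = F (w, x))"
proof -
  have inv: "matrix_inv g \<in> SL2 \<and> matrix_inv (matrix_inv g) = g" if "g \<in> SL2" for g
  proof -
    obtain a b c e where g: "g = mat2 a b c e" using mat2_cases by metis
    thus ?thesis using that by (simp add: SL2_def det_mat2 matrix_inv_mat2 algebra_simps)
  qed
  show ?thesis unfolding tensor_act_def fun_eq_iff using inv by auto metis+
qed

text \<open>The value 0 off \<open>rep r d\<close> matches the padding in \<open>coord_ring\<close>,
  so that extending the pullback of a tensor returns it as a function, not merely on
  \<open>rep r d\<close>.\<close>

definition extend :: "nat \<Rightarrow> (nat \<Rightarrow> nat) \<Rightarrow> ((nat \<times> nat \<Rightarrow> complex) \<Rightarrow> complex) \<Rightarrow> form_family \<times> (complex^2) \<Rightarrow> complex" where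
  "extend r d f = (\<lambda>(w, x). if w \<in> rep r d then f (crd d w x) else 0)"

lemma extend_form_of:
  assumes "hom r (aug d) n l w f"
  shows "extend r d f (form_of r d v, vec_of v) = f v"
  using hom_cong[OF assms, of "crd d (form_of r d v) (vec_of v)" v]
  by (simp add: extend_def form_of_in_rep crd_form_vec_of)

lemma extend_pullback:
  assumes "F \<in> tensor (coord_ring (rep r d) n) V"
  shows "extend r d (\<lambda>v. F (form_of r d v, vec_of v)) = F"
  using tensor_vanish[OF assms] by (auto simp: extend_def form_of_crd vec_of_crd)

text \<open>E f = 0 and F f = 0 make \<open>f\<close> constant along the flows \<open>shear\<close>
  and \<open>shear'\<close>, and the unipotent matrices realised by these flows generate
  \<open>SL2\<close>.\<close>

lemma extend_invariant:
  assumes f: "hom r (aug d) n l 0 f" and up: "der (up (aug d)) f = (\<lambda>v. 0)" and g: "g \<in> SL2"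
  shows "extend r d f (rep_act g w, g *v x) = extend r d f (w, x)"
proof -
  let ?D = "aug d"
  have dn: "der (dn ?D) f = (\<lambda>v. 0)" by (rule highest_weight_zero_imp_invariant[OF f up])
  have su: "f (shear ?D x v) = f v" for x v
  proof -
    have "((\<lambda>x. f (shear ?D x v)) has_field_derivative 0) (at x)" for x
      using DERIV_hom[OF f, of "\<lambda>x. shear ?D x v" "up ?D" x] DERIV_shear_coord up by simp
    from has_field_derivative_zero_constant[of UNIV "\<lambda>x. f (shear ?D x v)", OF _ this]
    have "f (shear ?D x v) = f (shear ?D 0 v)" by (metis UNIV_I convex_UNIV)
    also have "\<dots> = f v" by (rule hom_cong[OF f shear_0])
    finally show ?thesis .
  qed
  have sl: "f (shear' ?D x v) = f v" for x v
  proof -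
    have "((\<lambda>x. f (shear' ?D x v)) has_field_derivative 0) (at x)" for x
      using DERIV_hom[OF f, of "\<lambda>x. shear' ?D x v" "dn ?D" x] DERIV_shear'_coord dn by simp
    from has_field_derivative_zero_constant[of UNIV "\<lambda>x. f (shear' ?D x v)", OF _ this]
    have "f (shear' ?D x v) = f (shear' ?D 0 v)" by (metis UNIV_I convex_UNIV)
    also have "\<dots> = f v" by (rule hom_cong[OF f shear'_0])
    finally show ?thesis .
  qed
  \<comment> \<open>The inverse \<open>h'\<close> serves the families outside
    \<open>rep r d\<close>: since it maps \<open>rep r d\<close> into itself, \<open>h\<close>
    cannot move an outside family into it.\<close>
  have act: "extend r d f (rep_act h w, h *v x) = extend r d f (w, x)"
    if h: "h \<in> SL2" "h' \<in> SL2" "h' ** h = mat 1" "\<And>v. rep_act h (form_of r d v) = form_of r d (a v)"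
      "\<And>v. rep_act h' (form_of r d v) = form_of r d (a' v)" "\<And>v. h *v vec_of v = vec_of (a v)" "\<And>v. f (a v) = f v"
    for h h' a a' w x
  proof (cases "w \<in> rep r d")
    case True
    define v where "v = crd d w x"
    have w: "w = form_of r d v" "x = vec_of v" using True by (simp_all add: v_def form_of_crd vec_of_crd)
    show ?thesis by (simp only: w h(4,6,7) extend_form_of[OF f])
  next
    case False
    have "rep_act h' (rep_act h w) = rep_act (mat 1) w" using rep_act_mult[OF h(2,1), of w] h(3) by simp
    also have "\<dots> = w" 
      using matrix_inv_eqI[of "mat 1 :: complex^2^2" "mat 1"] by (simp add: rep_act_def form_act_def)
    finally have "rep_act h w \<notin> rep r d"
      using False h(5) form_of_crd form_of_in_rep by metis
    thus ?thesis using False by (simp add: extend_def)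
  qed
  have id: "mat2 1 0 0 1 = mat 1" by (simp add: vec_eq_iff forall_2 mat_def)
  define P where "P g \<longleftrightarrow> (\<forall>w x. extend r d f (rep_act g w, g *v x) = extend r d f (w, x))" for g
  from g have "P g"
  proof (rule SL2_induct)
    fix y
    show "P (mat2 1 y 0 1)" unfolding P_def
      by (intro allI, rule act[of _ "mat2 1 (- y) 0 1" "shear ?D y" "shear ?D (- y)"])
        (simp_all add: SL2_def det_mat2 mat2_mult id rep_act_shear form_of_upd0 su)
    show "P (mat2 1 0 y 1)" unfolding P_def
      by (intro allI, rule act[of _ "mat2 1 0 (- y) 1" "shear' ?D y" "shear' ?D (- y)"])
        (simp_all add: SL2_def det_mat2 mat2_mult id rep_act_shear' form_of_upd0 sl)
  next
    fix g h :: "complex^2^2" assume "g \<in> SL2" "h \<in> SL2" "P g" "P h"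
    thus "P (g ** h)" by (simp add: P_def rep_act_mult matrix_vector_mul_assoc[symmetric])
  qed
  thus ?thesis by (simp add: P_def)
qed

definition ring_gens :: "form_family set \<Rightarrow> nat \<Rightarrow> (form_family \<Rightarrow> complex) set" where
  "ring_gens W n = {(\<lambda>w. if w \<in> W then \<Prod>j<n. l j w else 0) | l. \<forall>j<n. l j \<in> linear_forms_on W}"

lemma ring_gens_mult:
  assumes "(\<lambda>w. if w \<in> W then f w else 0) \<in> ring_gens W n" "l \<in> linear_forms_on W"
  shows "(\<lambda>w. if w \<in> W then l w ^ k * f w else 0) \<in> ring_gens W (k + n)"
proof (induction k)
  case 0
  then show ?case using assms by (simp cong: if_cong)
next
  case (Suc k)
  then obtain m where m: "(\<lambda>w. if w \<in> W then l w ^ k * f w else 0) = (\<lambda>w. if w \<in> W then \<Prod>j<k + n. m j w else 0)"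
    "\<forall>j<k + n. m j \<in> linear_forms_on W" by (auto simp: ring_gens_def)
  have e: "l w ^ k * f w = (\<Prod>j<k + n. m j w)" if "w \<in> W" for w using fun_cong[OF m(1), of w] that by simp
  show ?case unfolding ring_gens_def
  proof (intro CollectI exI[of _ "m(k + n := l)"] conjI ext)
    fix w
    have "(\<Prod>j<k + n. (m(k + n := l)) j w) = (\<Prod>j<k + n. m j w)" by (intro prod.cong) auto
    thus "(if w \<in> W then l w ^ Suc k * f w else 0) = (if w \<in> W then \<Prod>j<Suc k + n. (m(k + n := l)) j w else 0)"
      using e[of w] by (simp add: mult.assoc mult.commute)
  qed (use assms(2) m(2) in auto)
qed

lemma crd_linear_form:
  assumes "p \<in> widx r d"
  shows "(\<lambda>w. crd d w x p) \<in> linear_forms_on (rep r d)"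
proof -
  have p: "crd d (form_of r d v) x p = v p" for v using assms crd_form_of by (cases p) (auto simp: widx_def)
  have rep: "w = form_of r d (crd d w x)" if "w \<in> rep r d" for w using form_of_crd[OF that] by simp
  have "crd d (u + v) x p = crd d u x p + crd d v x p" if "u \<in> rep r d" "v \<in> rep r d" for u v
    using p[of "\<lambda>p. crd d u x p + crd d v x p"] rep that by (metis form_of_add)
  moreover have "crd d (\<lambda>k. fscale c (u k)) x p = c * crd d u x p" if "u \<in> rep r d" for u c
    using p[of "\<lambda>p. c * crd d u x p"] form_of_scale[of r d c "crd d u x"] rep[OF that] by metis
  ultimately show ?thesis by (auto simp: linear_forms_on_def)
qed

lemma ring_gens_monom:
  assumes "Y \<subseteq> widx r d"
  shows "(\<lambda>w. if w \<in> rep r d then monom_fun Y \<alpha> (crd d w x) else 0) \<in> ring_gens (rep r d) (\<Sum>p\<in>Y. \<alpha> p)"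
proof -
  have "finite Y" using assms finite_widx finite_subset by blast
  thus ?thesis using assms
  proof (induction Y rule: finite_induct)
    case (insert p Y)
    thus ?case
      using ring_gens_mult[of "rep r d" "\<lambda>w. monom_fun Y \<alpha> (crd d w x)" "\<Sum>p\<in>Y. \<alpha> p" "\<lambda>w. crd d w x p" "\<alpha> p"] crd_linear_form[of p r d x]
      by (simp add: monom_fun_def cong: if_cong)
  qed (auto simp: ring_gens_def monom_fun_def cong: if_cong)
qed

lemma extend_tensor:
  assumes "hom r (aug d) n L w f"
  shows "extend r d f \<in> tensor (coord_ring (rep r d) n) (binary_forms L)"
proof -
  let ?T = "tensor (coord_ring (rep r d) n) (binary_forms L)"
  have sub: "cfun.subspace ?T" unfolding tensor_def by (rule cfun.subspace_span)
  have mon: "extend r d (monom_fun (idx r (aug d)) \<alpha>) \<in> ?T" if \<alpha>: "\<alpha> \<in> expo r (aug d) n L w" for \<alpha>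
  proof -
    have notin: "(0, 0) \<notin> widx r d" "(0, 1) \<notin> widx r d" by (auto simp: widx_def)
    have n: "(\<Sum>p\<in>widx r d. \<alpha> p) = n"
    proof -
      have "(\<Sum>p\<in>idx r (aug d). wdeg p * \<alpha> p) = (\<Sum>p\<in>widx r d. wdeg p * \<alpha> p)"
        using notin finite_widx by (simp add: idx_eq wdeg_def)
      also have "\<dots> = (\<Sum>p\<in>widx r d. \<alpha> p)" by (intro sum.cong) (auto simp: widx_def wdeg_def)
      finally show ?thesis using \<alpha> by (simp add: expo_def)
    qed
    have L: "\<alpha> (0, 0) + \<alpha> (0, 1) = L"
    proof -
      have "(\<Sum>p\<in>widx r d. xdeg p * \<alpha> p) = 0" by (intro sum.neutral) (auto simp: widx_def xdeg_def)
      hence "(\<Sum>p\<in>idx r (aug d). xdeg p * \<alpha> p) = \<alpha> (0, 0) + \<alpha> (0, 1)"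
        using notin finite_widx by (simp add: idx_eq xdeg_def)
      thus ?thesis using \<alpha> by (simp add: expo_def)
    qed
    \<comment> \<open>Coordinates with index in \<open>widx\<close> do not depend on the evaluation
      point, so 0 serves here; the sign in \<open>g\<close> is that of \<open>crd\<close> at the
      index \<open>(0, 1)\<close>.\<close>
    define p where "p = (\<lambda>w. if w \<in> rep r d then monom_fun (widx r d) \<alpha> (crd d w 0) else 0)"
    define g where "g = (\<lambda>x :: complex^2. (x $ 1) ^ \<alpha> (0, 0) * (- x $ 2) ^ \<alpha> (0, 1))"
    have "p \<in> coord_ring (rep r d) n"
      using ring_gens_monom[of "widx r d" r d \<alpha> 0] unfolding coord_ring_def n p_def ring_gens_def
      by (intro cfun.span_base) simp
    moreover have "g \<in> binary_forms L"
    proof -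
      have "g x = (\<Sum>i\<le>L. (if i = \<alpha> (0, 0) then (- 1) ^ \<alpha> (0, 1) else 0) * (x $ 1) ^ i * (x $ 2) ^ (L - i))" for x
      proof -
        have "(\<Sum>i\<le>L. (if i = \<alpha> (0, 0) then (- 1) ^ \<alpha> (0, 1) else 0) * (x $ 1) ^ i * (x $ 2) ^ (L - i)) =
          (\<Sum>i\<le>L. if i = \<alpha> (0, 0) then (- 1) ^ \<alpha> (0, 1) * (x $ 1) ^ i * (x $ 2) ^ (L - i) else 0)"
          by (intro sum.cong) auto
        also have "\<dots> = (- 1) ^ \<alpha> (0, 1) * (x $ 1) ^ \<alpha> (0, 0) * (x $ 2) ^ \<alpha> (0, 1)"
          using L by (auto simp: sum.delta)
        finally show ?thesis using power_minus[of "x $ 2" "\<alpha> (0, 1)"] by (simp add: g_def mult_ac)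
      qed
      thus ?thesis unfolding binary_forms_def
        by (intro CollectI exI[of _ "\<lambda>i. if i = \<alpha> (0, 0) then (- 1) ^ \<alpha> (0, 1) else 0"] allI)
    qed
    ultimately have "tensor_fun p g \<in> ?T" unfolding tensor_def by (intro cfun.span_base) auto
    moreover have "extend r d (monom_fun (idx r (aug d)) \<alpha>) = tensor_fun p g"
    proof (intro ext, clarify)
      fix w x
      have "monom_fun (widx r d) \<alpha> (crd d w 0) = monom_fun (widx r d) \<alpha> (crd d w x)"
        unfolding monom_fun_def by (intro prod.cong) (auto simp: widx_def crd_def)
      thus "extend r d (monom_fun (idx r (aug d)) \<alpha>) (w, x) = tensor_fun p g (w, x)"
        using notin finite_widx
        by (simp add: extend_def tensor_fun_def p_def g_def idx_eq monom_fun_def crd_vec mult_ac)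
    qed
    ultimately show ?thesis by simp
  qed
  have "f \<in> cfun.span (monom_fun (idx r (aug d)) ` expo r (aug d) n L w)"
    using assms hom_eq_span by blast
  thus ?thesis
  proof (induction rule: cfun.span_induct_alt)
    case base
    have "extend r d 0 = 0" by (auto simp: extend_def)
    then show ?case by (subst \<open>extend r d 0 = 0\<close>) (rule cfun.subspace_0[OF sub])
  next
    case (step c x y)
    have eq: "extend r d (fscale c x + y) = fscale c (extend r d x) + extend r d y"
      by (auto simp: extend_def fscale_def)
    have "extend r d x \<in> ?T" using step(1) mon by auto
    thus ?case unfolding eq
      by (intro cfun.subspace_add[OF sub] cfun.subspace_scale[OF sub] step.IH)
  qed
qed

text \<open>Pulled back to coordinates, a covariant is fixed by the torus, hence has weight 0, and
  its constancy under \<open>shear\<close> differentiates to E f = 0. The converse combines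
  \<open>extend_tensor\<close> and \<open>extend_invariant\<close>.\<close>

lemma covariants_eq_image:
  "covariants r d L n = extend r d ` {f. hom r (aug d) n L 0 f \<and> der (up (aug d)) f = 0}"
proof (intro equalityI subsetI)
  fix F assume "F \<in> covariants r d L n"
  hence F: "F \<in> tensor (coord_ring (rep r d) n) (binary_forms L)"
    and "\<forall>g\<in>SL2. \<forall>w x. F (rep_act g w, g *v x) = F (w, x)"
    using tensor_act_invariant_iff[of F] by (auto simp: covariants_def)
  hence inv: "F (rep_act g w, g *v x) = F (w, x)" if "g \<in> SL2" for g w x
    using that by blast
  define f where "f = (\<lambda>v. F (form_of r d v, vec_of v))"
  have f: "hom r (aug d) n L 0 f"
  proof (rule bihom_torus_invariant)
    show "f \<in> bihom r (aug d) n L" unfolding f_def by (rule tensor_bihom[OF F])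
    fix v
    have "mat2 2 0 0 (inverse 2) \<in> SL2" by (simp add: SL2_def det_mat2)
    moreover have "(2 :: complex) \<noteq> 0" by simp
    ultimately show "f (torus (aug d) 2 v) = f v"
      unfolding f_def by (metis inv rep_act_torus)
  qed
  have "der (up (aug d)) f v = 0" for v
  proof -
    have sl: "mat2 1 x 0 1 \<in> SL2" for x by (simp add: SL2_def det_mat2)
    have "f (shear (aug d) x v) = f v" for x
      using inv[OF sl, of x "form_of r d v" "vec_of v"]
      by (simp add: f_def rep_act_shear(1) rep_act_shear(2)[where d = d] form_of_upd0)
    \<comment> \<open>The derivative is obtained at \<open>shear (aug d) 0 v\<close>, whose
      agreement with \<open>v\<close> is known on \<open>idx\<close>; \<open>hom_cong\<close> then
      carries the result over to \<open>v\<close>.\<close>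
    hence "((\<lambda>x. f v) has_field_derivative der (up (aug d)) f (shear (aug d) 0 v)) (at 0)"
      using DERIV_hom[OF f, of "\<lambda>x. shear (aug d) x v" "up (aug d)" 0] DERIV_shear_coord by simp
    hence "der (up (aug d)) f (shear (aug d) 0 v) = 0" using DERIV_unique DERIV_const by blast
    thus ?thesis using hom_cong[OF hom_up[OF f], of "shear (aug d) 0 v" v] shear_0[of _ r "aug d" v] by simp
  qed
  hence "f \<in> {f. hom r (aug d) n L 0 f \<and> der (up (aug d)) f = 0}" using f by (auto simp: zero_fun_def)
  moreover have "F = extend r d f" unfolding f_def by (rule extend_pullback[OF F, symmetric])
  ultimately show "F \<in> extend r d ` {f. hom r (aug d) n L 0 f \<and> der (up (aug d)) f = 0}" by blast
next
  fix F assume "F \<in> extend r d ` {f. hom r (aug d) n L 0 f \<and> der (up (aug d)) f = 0}"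
  then obtain f where f: "hom r (aug d) n L 0 f" "der (up (aug d)) f = (\<lambda>v. 0)" and F: "F = extend r d f"
    by (auto simp: zero_fun_def)
  have "F \<in> tensor (coord_ring (rep r d) n) (binary_forms L)" unfolding F by (rule extend_tensor[OF f(1)])
  thus "F \<in> covariants r d L n"
    using extend_invariant[OF f] tensor_act_invariant_iff[of F] by (auto simp: covariants_def F)
qed

text \<open>\<open>extend\<close> is injective on \<open>K\<close> because
  \<open>extend_form_of\<close> recovers \<open>f\<close>, so it carries a basis of \<open>K\<close>
  to a basis of the covariants.\<close>

lemma dim_covariants_expo:
  "card (expo r (aug d) n L 0) = cfun.dim (covariants r d L n) + card (expo r (aug d) n L 2)"
proof -
  define K where "K = {f. hom r (aug d) n L 0 f \<and> der (up (aug d)) f = 0}"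
  interpret P: vector_space_pair "fscale :: complex \<Rightarrow> ((nat \<times> nat \<Rightarrow> complex) \<Rightarrow> complex) \<Rightarrow> _"
    "fscale :: complex \<Rightarrow> (form_family \<times> (complex^2) \<Rightarrow> complex) \<Rightarrow> _" by unfold_locales
  have lin: "Vector_Spaces.linear fscale fscale (extend r d)"
    unfolding Vector_Spaces.linear_iff by (auto simp: extend_def fscale_def fun_eq_iff cfun.vector_space_axioms)
  have subK: "cfun.subspace K"
    unfolding K_def
    by (rule cfun.subspaceI)
      (auto simp: zero_fun_def plus_fun_def fscale_def der_const der_add der_cmult intro: hom.zero hom.add hom_scale)
  obtain B where B: "B \<subseteq> K" "\<not> cfun.dependent B" "K \<subseteq> cfun.span B" "card B = cfun.dim K"
    using cfun.basis_exists by blast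
  have spB: "cfun.span B = K" using B(1,3) subK cfun.span_minimal by blast
  have inj: "inj_on (extend r d) K"
  proof (rule inj_onI)
    fix f g assume fg: "f \<in> K" "g \<in> K" "extend r d f = extend r d g"
    thus "f = g" using extend_form_of[of r d n L 0 f] extend_form_of[of r d n L 0 g]
      unfolding K_def fun_eq_iff by (metis (mono_tags, lifting) fg(3) mem_Collect_eq)
  qed
  have "cfun.dim (extend r d ` K) = card (extend r d ` B)"
    using P.linear_independent_injective_image[OF lin B(2)] inj P.linear_span_image[OF lin, of B]
      cfun.dim_span_eq_card_independent[of "extend r d ` B"] by (simp add: spB)
  also have "\<dots> = card B" using inj B(1) by (intro card_image) (rule inj_on_subset)
  finally have "cfun.dim (covariants r d L n) = cfun.dim K"
    using B(4) by (simp add: covariants_eq_image K_def)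
  thus ?thesis using dim_highest_weight[of r "aug d" n L] by (simp add: K_def)
qed

section \<open>Counting weights\<close>

definition wexpo :: "nat \<Rightarrow> (nat \<Rightarrow> nat) \<Rightarrow> nat \<Rightarrow> int \<Rightarrow> (nat \<times> nat \<Rightarrow> nat) set" where
  "wexpo r d n w = {\<beta> \<in> PiE (widx r d) (\<lambda>_. UNIV). (\<Sum>p\<in>widx r d. \<beta> p) = n \<and>
     (\<Sum>p\<in>widx r d. int (\<beta> p) * weight d p) = w}"

lemma finite_wexpo: "finite (wexpo r d n w)"
proof (rule finite_subset)
  show "wexpo r d n w \<subseteq> PiE (widx r d) (\<lambda>_. {..n})"
  proof
    fix \<beta> assume b: "\<beta> \<in> wexpo r d n w"
    have "\<beta> p \<le> n" if "p \<in> widx r d" for p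
      using b member_le_sum[OF that, of \<beta>] finite_widx by (simp add: wexpo_def)
    with b show "\<beta> \<in> PiE (widx r d) (\<lambda>_. {..n})" by (auto simp: wexpo_def PiE_iff)
  qed
qed (auto intro: finite_PiE finite_widx)

lemma zero_notin_widx: "(0, i) \<notin> widx r d" by (simp add: widx_def)

lemma sum_idx: "(\<Sum>p\<in>idx r (aug d). g p) = g (0, 0) + (g (0, 1) + (\<Sum>p\<in>widx r d. g p))"
  by (simp add: idx_eq zero_notin_widx finite_widx)

lemma expo_iff:
  "\<alpha> \<in> expo r (aug d) n L w \<longleftrightarrow> \<alpha> \<in> PiE (idx r (aug d)) (\<lambda>_. UNIV) \<and> (\<Sum>p\<in>widx r d. \<alpha> p) = n \<and>
     \<alpha> (0, 0) + \<alpha> (0, 1) = L \<and>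
     (\<Sum>p\<in>widx r d. int (\<alpha> p) * weight d p) = w + int L - 2 * int (\<alpha> (0, 1))"
proof -
  have "(\<Sum>p\<in>widx r d. wdeg p * \<alpha> p) = (\<Sum>p\<in>widx r d. \<alpha> p)"
    "(\<Sum>p\<in>widx r d. xdeg p * \<alpha> p) = 0"
    "(\<Sum>p\<in>widx r d. int (\<alpha> p) * weight (aug d) p) = (\<Sum>p\<in>widx r d. int (\<alpha> p) * weight d p)"
    by (auto intro!: sum.cong simp: widx_def wdeg_def xdeg_def weight_def aug_apply)
  thus ?thesis by (auto simp: expo_def sum_idx wdeg_def xdeg_def weight_def aug_apply)
qed

text \<open>Sort by the exponent \<open>j\<close> of the coordinate \<open>(0, 1)\<close>, which has
  weight 1. The coordinate \<open>(0, 0)\<close> has weight -1 and exponent \<open>L - j\<close>, so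
  the plane contributes the weight \<open>2 * j - L\<close>.\<close>

lemma card_expo: "card (expo r (aug d) n L w) = (\<Sum>j\<le>L. card (wexpo r d n (w + int L - 2 * int j)))"
proof -
  have "bij_betw (\<lambda>\<alpha>. (\<alpha> (0, 1), restrict \<alpha> (widx r d))) (expo r (aug d) n L w)
     (SIGMA j:{..L}. wexpo r d n (w + int L - 2 * int j))"
  proof (rule bij_betw_byWitness[where f' = "\<lambda>(j, \<beta>). \<beta>((0, 0) := L - j, (0, 1) := j)"])
    show "\<forall>\<alpha>\<in>expo r (aug d) n L w. (case (\<alpha> (0, 1), restrict \<alpha> (widx r d)) of (j, \<beta>) \<Rightarrow> \<beta>((0, 0) := L - j, (0, 1) := j)) = \<alpha>"
    proof
      fix \<alpha> assume \<alpha>: "\<alpha> \<in> expo r (aug d) n L w"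
      have "\<alpha> (0, 0) = L - \<alpha> (0, 1)" using \<alpha> by (auto simp: expo_iff)
      moreover have "\<alpha> p = undefined" if "p \<notin> idx r (aug d)" for p
        using \<alpha> that by (cases p) (auto simp: expo_iff PiE_iff extensional_def)
      ultimately show "(case (\<alpha> (0, 1), restrict \<alpha> (widx r d)) of (j, \<beta>) \<Rightarrow> \<beta>((0, 0) := L - j, (0, 1) := j)) = \<alpha>"
        by (auto simp: fun_eq_iff idx_eq)
    qed
    show "\<forall>x\<in>SIGMA j:{..L}. wexpo r d n (w + int L - 2 * int j).
       ((case x of (j, \<beta>) \<Rightarrow> \<beta>((0, 0) := L - j, (0, 1) := j)) (0, 1),
        restrict (case x of (j, \<beta>) \<Rightarrow> \<beta>((0, 0) := L - j, (0, 1) := j)) (widx r d)) = x"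
      by (auto simp: fun_eq_iff wexpo_def PiE_iff extensional_def widx_def)
    show "(\<lambda>\<alpha>. (\<alpha> (0, 1), restrict \<alpha> (widx r d))) ` expo r (aug d) n L w
       \<subseteq> (SIGMA j:{..L}. wexpo r d n (w + int L - 2 * int j))"
      by (auto simp: expo_iff wexpo_def)
    show "(\<lambda>(j, \<beta>). \<beta>((0, 0) := L - j, (0, 1) := j)) ` (SIGMA j:{..L}. wexpo r d n (w + int L - 2 * int j))
       \<subseteq> expo r (aug d) n L w"
    proof (rule image_subsetI)
      fix x assume "x \<in> (SIGMA j:{..L}. wexpo r d n (w + int L - 2 * int j))"
      then obtain j \<beta> where x: "x = (j, \<beta>)" and j: "j \<in> {..L}" and b: "\<beta> \<in> wexpo r d n (w + int L - 2 * int j)"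
        by auto
      define \<alpha> where "\<alpha> = \<beta>((0, 0) := L - j, (0, 1) := j)"
      have e: "\<alpha> p = \<beta> p" if "p \<in> widx r d" for p using that by (auto simp: \<alpha>_def widx_def)
      have "\<alpha> \<in> PiE (idx r (aug d)) (\<lambda>_. UNIV)"
        using b by (auto simp: \<alpha>_def wexpo_def PiE_iff extensional_def idx_eq)
      moreover have "(\<Sum>p\<in>widx r d. \<alpha> p) = n"
        "(\<Sum>p\<in>widx r d. int (\<alpha> p) * weight d p) = w + int L - 2 * int j"
        using b by (simp_all add: wexpo_def e)
      ultimately have "\<alpha> \<in> expo r (aug d) n L w" using j by (simp add: expo_iff \<alpha>_def)
      thus "(case x of (j, \<beta>) \<Rightarrow> \<beta>((0, 0) := L - j, (0, 1) := j)) \<in> expo r (aug d) n L w"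
        by (simp add: x \<alpha>_def)
    qed
  qed
  from bij_betw_same_card[OF this] show ?thesis by (simp add: card_SigmaI finite_wexpo)
qed

text \<open>The counts for weight 0 run over the weights \<open>L - 2 * j\<close>, those for weight
  2 over the same range shifted by one step, so the difference telescopes to the two ends
  \<open>- L\<close> and \<open>L + 2\<close>.\<close>

lemma dim_covariants:
  "int (cfun.dim (covariants r d L n)) = int (card (wexpo r d n (- int L))) - int (card (wexpo r d n (int L + 2)))"
proof -
  define g where "g j = int (card (wexpo r d n (2 + int L - 2 * int j)))" for j
  have "int (cfun.dim (covariants r d L n)) = int (card (expo r (aug d) n L 0)) - int (card (expo r (aug d) n L 2))"
    using dim_covariants_expo[of r d n L] by simp
  also have "\<dots> = (\<Sum>j<Suc L. g (Suc j) - g j)"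
    by (simp add: card_expo sum_subtractf g_def lessThan_Suc_atMost algebra_simps del: sum.lessThan_Suc)
  also have "\<dots> = g (Suc L) - g 0" by (rule sum_lessThan_telescope)
  finally show ?thesis by (simp add: g_def algebra_simps)
qed

section \<open>Constant terms of rational functions\<close>

lemma contour_integral_powi_circlepath:
  assumes "\<rho> > 0"
  shows "((\<lambda>z. z powi k) has_contour_integral (if k = - 1 then 2 * of_real pi * \<i> else 0)) (circlepath 0 \<rho>)"
proof (cases "k = - 1")
  case True
  have "((\<lambda>z. 1 / (z - 0)) has_contour_integral 2 * of_real pi * \<i> * 1) (circlepath 0 \<rho>)"
    using Cauchy_integral_circlepath_simple[of "\<lambda>_. 1" 0 \<rho> 0] assms by simp
  thus ?thesis using True by (simp add: power_int_minus divide_inverse)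
next
  case False
  have "((\<lambda>z. z powi k) has_contour_integral 0) (circlepath 0 \<rho>)"
  proof (rule Cauchy_theorem_primitive[where S = "- {0}" and f = "\<lambda>z. z powi (k + 1) / of_int (k + 1)"])
    fix x :: complex assume x: "x \<in> - {0}"
    have "of_int (k + 1) \<noteq> (0 :: complex)" using False by (metis add.commute add_eq_0_iff of_int_eq_0_iff)
    thus "((\<lambda>z. z powi (k + 1) / of_int (k + 1)) has_field_derivative x powi k) (at x within - {0})"
      using x by (auto intro!: derivative_eq_intros)
  qed (use assms in auto)
  thus ?thesis using False by simp
qed

lemma summable_prod_geometric:
  fixes y :: "'i \<Rightarrow> 'c :: {real_normed_field, banach, second_countable_topology}"
  assumes "finite Q" "\<And>q. q \<in> Q \<Longrightarrow> norm (y q) < 1"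
  shows "(\<lambda>\<gamma>. norm (\<Prod>q\<in>Q. y q ^ \<gamma> q)) summable_on PiE Q (\<lambda>_. UNIV)"
    and "((\<lambda>\<gamma>. \<Prod>q\<in>Q. y q ^ \<gamma> q) has_sum (\<Prod>q\<in>Q. 1 / (1 - y q))) (PiE Q (\<lambda>_. UNIV))"
proof -
  have geo: "(\<lambda>n. norm (y q ^ n)) summable_on UNIV" if "q \<in> Q" for q
    using assms(2)[OF that] by (simp add: norm_power summable_on_UNIV_nonneg_real_iff summable_geometric)
  show s: "(\<lambda>\<gamma>. norm (\<Prod>q\<in>Q. y q ^ \<gamma> q)) summable_on PiE Q (\<lambda>_. UNIV)"
    using abs_summable_on_prod_PiE[OF assms(1), of "\<lambda>_. UNIV :: nat set" "\<lambda>q n. y q ^ n"] geo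
    by (simp add: abs_summable_equivalent[symmetric])
  have "infsum (\<lambda>n. y q ^ n) UNIV = 1 / (1 - y q)" if "q \<in> Q" for q
  proof (rule infsumI, rule norm_summable_imp_has_sum)
    show "summable (\<lambda>n. norm (y q ^ n))" using assms(2)[OF that] by (simp add: norm_power summable_geometric)
    show "(\<lambda>n. y q ^ n) sums (1 / (1 - y q))" using assms(2)[OF that] by (rule geometric_sums)
  qed
  hence "infsum (\<lambda>\<gamma>. \<Prod>q\<in>Q. y q ^ \<gamma> q) (PiE Q (\<lambda>_. UNIV)) = (\<Prod>q\<in>Q. 1 / (1 - y q))"
    using infsum_prod_PiE_abs[OF assms(1), of "\<lambda>q n. y q ^ n" "\<lambda>_. UNIV"] geo by simp
  thus "((\<lambda>\<gamma>. \<Prod>q\<in>Q. y q ^ \<gamma> q) has_sum (\<Prod>q\<in>Q. 1 / (1 - y q))) (PiE Q (\<lambda>_. UNIV))"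
    using abs_summable_summable[OF s] has_sum_infsum by metis
qed

text \<open>Expand each factor in a geometric series and integrate term by term; only the terms with
  total exponent -1 survive. Used on the unit circle for the numbers of monomials and on a small
  circle for the residue at 0.\<close>

lemma has_sum_circle_coefficient:
  fixes c :: "'i \<Rightarrow> complex" and m :: "'i \<Rightarrow> int" and k :: int and \<rho> :: real
  assumes Q: "finite Q" and \<rho>: "\<rho> > 0" and lt: "\<And>q. q \<in> Q \<Longrightarrow> norm (c q) * \<rho> powi m q < 1"
  defines "I \<equiv> contour_integral (circlepath 0 \<rho>) (\<lambda>z. z powi (k - 1) * (\<Prod>q\<in>Q. 1 / (1 - c q * z powi m q)))"
  shows "((\<lambda>\<gamma>. \<Prod>q\<in>Q. c q ^ \<gamma> q) has_sum (I / (2 * of_real pi * \<i>)))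
    {\<gamma> \<in> PiE Q (\<lambda>_. UNIV). k + (\<Sum>q\<in>Q. int (\<gamma> q) * m q) = 0}"
proof -
  define T where "T = (\<lambda>\<gamma> z. z powi (k - 1) * (\<Prod>q\<in>Q. (c q * z powi m q) ^ \<gamma> q))"
  define G where "G = (\<lambda>z. z powi (k - 1) * (\<Prod>q\<in>Q. 1 / (1 - c q * z powi m q)))"
  define P where "P = PiE Q (\<lambda>_. UNIV :: nat set)"
  have nrm: "norm (c q * z powi m q) = norm (c q) * \<rho> powi m q" if "norm z = \<rho>" for q and z :: complex
    using that by (simp add: norm_mult norm_power_int)
  have norm_eq: "norm (T \<gamma> z) = \<rho> powi (k - 1) * norm (\<Prod>q\<in>Q. (of_real (norm (c q) * \<rho> powi m q) :: real) ^ \<gamma> q)"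
    if "norm z = \<rho>" for \<gamma> z
    using that \<rho> lt by (simp add: T_def norm_mult norm_power_int norm_power prod_norm[symmetric] abs_mult power_mult_distrib)
      (simp add: abs_prod abs_mult power_abs)
  have M: "(\<lambda>\<gamma>. \<rho> powi (k - 1) * norm (\<Prod>q\<in>Q. (of_real (norm (c q) * \<rho> powi m q) :: real) ^ \<gamma> q)) summable_on P"
    unfolding P_def using lt \<rho> by (intro summable_on_cmult_right summable_prod_geometric Q) (auto simp: abs_mult)
  have hs: "((\<lambda>\<gamma>. T \<gamma> z) has_sum G z) P" if "norm z = \<rho>" for z
    unfolding T_def G_def P_def using lt by (intro has_sum_cmult_right summable_prod_geometric Q) (simp add: nrm[OF that])
  \<comment> \<open>On the circle the norm of \<open>T \<gamma> z\<close> does not depend on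
    \<open>z\<close>, so it is its own majorant in the M-test.\<close>
  have ul: "uniform_limit (sphere 0 \<rho>) (\<lambda>X z. \<Sum>\<gamma>\<in>X. T \<gamma> z) G (finite_subsets_at_top P)"
    by (rule Weierstrass_m_test_general'[OF _ _ M]) (auto simp: norm_eq hs)
  have T_int: "(T \<gamma> has_contour_integral (if k + (\<Sum>q\<in>Q. int (\<gamma> q) * m q) = 0 then (\<Prod>q\<in>Q. c q ^ \<gamma> q) else 0) * (2 * of_real pi * \<i>))
      (circlepath 0 \<rho>)" for \<gamma>
  proof -
    have eq: "(\<Prod>q\<in>Q. c q ^ \<gamma> q) * z powi (k - 1 + (\<Sum>q\<in>Q. int (\<gamma> q) * m q)) = T \<gamma> z" if "z \<noteq> 0" for z
    proof -
      have "z powi (\<Sum>q\<in>Q. int (\<gamma> q) * m q) = (\<Prod>q\<in>Q. (z powi m q) ^ \<gamma> q)"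
        using Q by (induction Q rule: finite_induct) (use that in \<open>auto simp: power_int_add power_int_power' mult.commute\<close>)
      thus ?thesis using that by (simp add: T_def power_mult_distrib prod.distrib power_int_add)
    qed
    have "((\<lambda>z. (\<Prod>q\<in>Q. c q ^ \<gamma> q) * z powi (k - 1 + (\<Sum>q\<in>Q. int (\<gamma> q) * m q))) has_contour_integral
        (\<Prod>q\<in>Q. c q ^ \<gamma> q) * (if k - 1 + (\<Sum>q\<in>Q. int (\<gamma> q) * m q) = - 1 then 2 * of_real pi * \<i> else 0)) (circlepath 0 \<rho>)"
      by (intro has_contour_integral_lmul contour_integral_powi_circlepath \<rho>)
    hence "(T \<gamma> has_contour_integral
        (\<Prod>q\<in>Q. c q ^ \<gamma> q) * (if k - 1 + (\<Sum>q\<in>Q. int (\<gamma> q) * m q) = - 1 then 2 * of_real pi * \<i> else 0)) (circlepath 0 \<rho>)"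
      by (rule has_contour_integral_eq) (use \<rho> in \<open>auto intro!: eq\<close>)
    moreover have "k - 1 + (\<Sum>q\<in>Q. int (\<gamma> q) * m q) = - 1 \<longleftrightarrow> k + (\<Sum>q\<in>Q. int (\<gamma> q) * m q) = 0" by linarith
    ultimately show ?thesis by (simp only: if_distrib if_distribR mult_zero_right mult_zero_left)
  qed
  define t where "t \<gamma> = (if k + (\<Sum>q\<in>Q. int (\<gamma> q) * m q) = 0 then (\<Prod>q\<in>Q. c q ^ \<gamma> q) else 0)" for \<gamma>
  have sum_int: "((\<lambda>z. \<Sum>\<gamma>\<in>X. T \<gamma> z) has_contour_integral (\<Sum>\<gamma>\<in>X. t \<gamma> * (2 * of_real pi * \<i>))) (circlepath 0 \<rho>)"
    if "finite X" for X
    using that T_int by (intro has_contour_integral_sum) (auto simp: t_def)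
  have fin: "eventually (\<lambda>X. finite X) (finite_subsets_at_top P)"
    by (simp add: eventually_finite_subsets_at_top_weakI)
  have "((\<lambda>X. contour_integral (circlepath 0 \<rho>) (\<lambda>z. \<Sum>\<gamma>\<in>X. T \<gamma> z)) \<longlongrightarrow> contour_integral (circlepath 0 \<rho>) G) (finite_subsets_at_top P)"
    by (rule contour_integral_uniform_limit_circlepath(2)[OF _ ul _ \<rho>])
      (use fin sum_int in \<open>auto elim!: eventually_mono simp: contour_integrable_on_def finite_subsets_at_top_neq_bot\<close>)
  moreover have "eventually (\<lambda>X. contour_integral (circlepath 0 \<rho>) (\<lambda>z. \<Sum>\<gamma>\<in>X. T \<gamma> z) = (\<Sum>\<gamma>\<in>X. t \<gamma> * (2 * of_real pi * \<i>))) (finite_subsets_at_top P)"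
    using fin by eventually_elim (rule contour_integral_unique[OF sum_int])
  ultimately have "((\<lambda>\<gamma>. t \<gamma> * (2 * of_real pi * \<i>)) has_sum I) P"
    unfolding has_sum_def I_def G_def[symmetric] by (rule Lim_transform_eventually)
  hence "((\<lambda>\<gamma>. t \<gamma> * (2 * of_real pi * \<i>) * (1 / (2 * of_real pi * \<i>))) has_sum (I * (1 / (2 * of_real pi * \<i>)))) P"
    by (rule has_sum_cmult_left)
  hence "(t has_sum (I / (2 * of_real pi * \<i>))) P" by simp
  also have "?this \<longleftrightarrow> ?thesis"
    by (intro has_sum_cong_neutral) (auto simp: P_def t_def)
  finally show ?thesis .
qed

section \<open>The Hilbert series as a contour integral\<close>

lemma finite_pos_weights: "finite (pos_weights r d)"
  by (rule finite_subset[OF _ finite_widx[of r d]]) (auto simp: pos_weights_def widx_def)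

lemma pos_weights_eq: "pos_weights r d = {p \<in> widx r d. weight d p > 0}"
  by (auto simp: pos_weights_def widx_def weight_def)

lemma weight_pos: "p \<in> pos_weights r d \<Longrightarrow> weight d p > 0"
  by (simp add: pos_weights_eq)

text \<open>The reflection from \<open>i\<close> to \<open>d k - i\<close> changes the sign of the
  weight, and weight 0 occurs once for every even \<open>d k\<close>.\<close>

lemma prod_widx:
  fixes g :: "int \<Rightarrow> complex"
  shows "(\<Prod>q\<in>widx r d. g (weight d q)) = g 0 ^ num_even r d * (\<Prod>p\<in>pos_weights r d. g (weight d p) * g (- weight d p))"
proof -
  define N where "N = {p \<in> widx r d. weight d p < 0}"
  define Z where "Z = {p \<in> widx r d. weight d p = 0}"
  have fin: "finite N" "finite Z" using finite_widx by (auto simp: N_def Z_def)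
  have "widx r d = pos_weights r d \<union> (N \<union> Z)" by (auto simp: pos_weights_eq N_def Z_def)
  hence "(\<Prod>q\<in>widx r d. g (weight d q)) = (\<Prod>q\<in>pos_weights r d \<union> (N \<union> Z). g (weight d q))" by simp
  also have "\<dots> = (\<Prod>q\<in>pos_weights r d. g (weight d q)) * ((\<Prod>q\<in>N. g (weight d q)) * (\<Prod>q\<in>Z. g (weight d q)))"
  proof -
    have "N \<inter> Z = {}" "pos_weights r d \<inter> (N \<union> Z) = {}" by (auto simp: N_def Z_def pos_weights_eq)
    thus ?thesis using fin finite_pos_weights[of r d] by (simp add: prod.union_disjoint)
  qed
  also have "(\<Prod>q\<in>N. g (weight d q)) = (\<Prod>p\<in>pos_weights r d. g (- weight d p))"
    by (rule prod.reindex_bij_witness[of _ "\<lambda>(k, i). (k, d k - i)" "\<lambda>(k, i). (k, d k - i)"])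
      (auto simp: N_def pos_weights_eq widx_def weight_def of_nat_diff)
  also have "(\<Prod>q\<in>Z. g (weight d q)) = g 0 ^ card Z"
    by (simp add: Z_def)
  also have "card Z = num_even r d"
  proof -
    have "Z = (\<lambda>k. (k, d k div 2)) ` {k \<in> {1..r}. even (d k)}"
    proof (intro equalityI subsetI)
      fix p assume p: "p \<in> Z"
      obtain k i where ki: "p = (k, i)" by (cases p)
      have "2 * int i = int (d k)" "k \<in> {1..r}" using p by (auto simp: Z_def widx_def weight_def ki)
      moreover from this have "d k = 2 * i" by linarith
      ultimately show "p \<in> (\<lambda>k. (k, d k div 2)) ` {k \<in> {1..r}. even (d k)}" by (auto simp: ki)
    qed (auto simp: Z_def widx_def weight_def elim!: evenE)
    moreover have "inj_on (\<lambda>k. (k, d k div 2)) {k \<in> {1..r}. even (d k)}" by (auto simp: inj_on_def)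
    ultimately show ?thesis unfolding num_even_def by (simp only: card_image)
  qed
  finally show ?thesis by (simp add: prod.distrib mult_ac)
qed

text \<open>Up to the factor \<open>(1 - t) ^ num_even r d\<close>, this is the integrand of Weyl's integration formula
  for the Hilbert series.\<close>

definition integrand :: "nat \<Rightarrow> (nat \<Rightarrow> nat) \<Rightarrow> nat \<Rightarrow> complex \<Rightarrow> complex \<Rightarrow> complex" where
  "integrand r d L t z = (z powi (- int L - 1) - z powi (int L + 1)) *
     (\<Prod>p\<in>pos_weights r d. 1 / ((1 - t * z powi (- weight d p)) * (1 - t * z powi weight d p)))"

lemma sums_wexpo:
  fixes r :: nat and d :: "nat \<Rightarrow> nat" and k :: int and t :: complex
  assumes "norm t < 1"
  defines "I \<equiv> (\<lambda>k. contour_integral (circlepath 0 1) (\<lambda>z. z powi (k - 1) * (\<Prod>q\<in>widx r d. 1 / (1 - t * z powi (- weight d q)))))"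
  shows "(\<lambda>n. of_nat (card (wexpo r d n k)) * t ^ n) sums (I k / (2 * of_real pi * \<i>))"
proof -
  have "((\<lambda>\<gamma>. \<Prod>q\<in>widx r d. t ^ \<gamma> q) has_sum (I k / (2 * of_real pi * \<i>)))
    {\<gamma> \<in> PiE (widx r d) (\<lambda>_. UNIV). k + (\<Sum>q\<in>widx r d. int (\<gamma> q) * (- weight d q)) = 0}"
    unfolding I_def by (rule has_sum_circle_coefficient[OF finite_widx]) (use assms in auto)
  \<comment> \<open>Grouping exponent vectors by total degree \<open>n\<close> turns the unordered
    sum into a power series in \<open>t\<close>.\<close>
  also have "?this \<longleftrightarrow> ((\<lambda>(n, \<gamma>). t ^ n) has_sum (I k / (2 * of_real pi * \<i>))) (SIGMA n:UNIV. wexpo r d n k)"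
    by (rule has_sum_reindex_bij_witness[of _ snd "\<lambda>\<gamma>. (\<Sum>q\<in>widx r d. \<gamma> q, \<gamma>)"])
      (auto simp: wexpo_def power_sum sum_negf)
  finally have "((\<lambda>n. of_nat (card (wexpo r d n k)) * t ^ n) has_sum (I k / (2 * of_real pi * \<i>))) UNIV"
  proof (rule has_sum_Sigma')
    fix n
    have "((\<lambda>\<gamma>. t ^ n) has_sum (\<Sum>\<gamma>\<in>wexpo r d n k. t ^ n)) (wexpo r d n k)"
      by (rule has_sum_finite[OF finite_wexpo])
    thus "((\<lambda>\<gamma>. case (n, \<gamma>) of (n, \<gamma>) \<Rightarrow> t ^ n) has_sum of_nat (card (wexpo r d n k)) * t ^ n) (wexpo r d n k)"
      by simp
  qed
  thus ?thesis by (rule has_sum_imp_sums)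
qed

lemma circle_factor_neq_1:
  fixes t z :: complex
  assumes "norm t < 1" "norm z = 1"
  shows "t * z powi k \<noteq> 1"
proof
  assume "t * z powi k = 1"
  hence "norm (t * z powi k) = 1" by simp
  thus False using assms by (simp add: norm_mult norm_power_int)
qed

lemma continuous_on_circle_factor:
  "norm (t :: complex) < 1 \<Longrightarrow> continuous_on (sphere 0 1) (\<lambda>z. z powi j * (\<Prod>q\<in>Q. 1 / (1 - t * z powi k q)))"
  by (intro continuous_intros) (auto simp: circle_factor_neq_1)

lemma sums_dim_covariants:
  assumes t: "norm t < 1"
  shows "(\<lambda>n. of_nat (cfun.dim (covariants r d L n)) * t ^ n) sums
    (contour_integral (circlepath 0 1) (integrand r d L t) / (2 * of_real pi * \<i>) / (1 - t) ^ num_even r d)"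
proof -
  define G where "G = (\<lambda>z. \<Prod>q\<in>widx r d. 1 / (1 - t * z powi (- weight d q)))"
  have int: "(\<lambda>z. z powi k * G z) contour_integrable_on circlepath 0 1" for k
    unfolding G_def using t by (intro contour_integrable_continuous_circlepath) (simp add: continuous_on_circle_factor)
  have "of_nat (cfun.dim (covariants r d L n)) * t ^ n =
     of_nat (card (wexpo r d n (- int L))) * t ^ n - of_nat (card (wexpo r d n (int L + 2))) * t ^ n" for n
  proof -
    have "of_int (int (cfun.dim (covariants r d L n))) =
      (of_int (int (card (wexpo r d n (- int L))) - int (card (wexpo r d n (int L + 2)))) :: complex)"
      by (simp only: dim_covariants)
    thus ?thesis by (simp add: left_diff_distrib)
  qed
  hence "(\<lambda>n. of_nat (cfun.dim (covariants r d L n)) * t ^ n) sums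
     (contour_integral (circlepath 0 1) (\<lambda>z. z powi (- int L - 1) * G z) / (2 * of_real pi * \<i>) -
      contour_integral (circlepath 0 1) (\<lambda>z. z powi (int L + 2 - 1) * G z) / (2 * of_real pi * \<i>))"
    unfolding G_def by (simp only:) (intro sums_diff sums_wexpo t)
  also have "contour_integral (circlepath 0 1) (\<lambda>z. z powi (- int L - 1) * G z) / (2 * of_real pi * \<i>) -
      contour_integral (circlepath 0 1) (\<lambda>z. z powi (int L + 2 - 1) * G z) / (2 * of_real pi * \<i>) =
      contour_integral (circlepath 0 1) (\<lambda>z. z powi (- int L - 1) * G z - z powi (int L + 2 - 1) * G z) / (2 * of_real pi * \<i>)"
    by (subst contour_integral_diff) (use int in \<open>auto simp: diff_divide_distrib\<close>)
  also have "contour_integral (circlepath 0 1) (\<lambda>z. z powi (- int L - 1) * G z - z powi (int L + 2 - 1) * G z) =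
     contour_integral (circlepath 0 1) (\<lambda>z. (1 / (1 - t) ^ num_even r d) * integrand r d L t z)"
    by (intro contour_integral_cong refl)
      (simp add: G_def integrand_def prod_widx[of "\<lambda>k. 1 / (1 - t * _ powi (- k))"] power_one_over algebra_simps)
  also have "\<dots> = 1 / (1 - t) ^ num_even r d * contour_integral (circlepath 0 1) (integrand r d L t)"
  proof (rule contour_integral_lmul, rule contour_integrable_continuous_circlepath)
    show "continuous_on (path_image (circlepath 0 1)) (integrand r d L t)"
      unfolding integrand_def by (intro continuous_intros) (auto simp: circle_factor_neq_1[OF t])
  qed
  finally show ?thesis by (simp add: mult_ac)
qed

section \<open>The poles of the integrand\<close>

text \<open>For 0 < |t| < 1 these are the candidates for nonzero poles inside the unit circle; the
  zeros of the other factors, with \<open>t * z powi weight d p = 1\<close>, lie outside by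
  \<open>outer_poles\<close>.\<close>

definition poles :: "nat \<Rightarrow> (nat \<Rightarrow> nat) \<Rightarrow> complex \<Rightarrow> complex set" where
  "poles r d t = {z. \<exists>p\<in>pos_weights r d. z powi weight d p = t}"

lemma finite_powi_roots:
  assumes "k > 0"
  shows "finite {z :: complex. z powi k = c}"
proof -
  have "z powi k = z ^ nat k" for z :: complex using assms by (simp add: power_int_nonneg_exp)
  thus ?thesis using finite_nth_roots[of "nat k" c] assms by simp
qed

lemma finite_poles: "finite (poles r d t)"
proof -
  have "poles r d t = (\<Union>p\<in>pos_weights r d. {z. z powi weight d p = t})" by (auto simp: poles_def)
  thus ?thesis using finite_powi_roots weight_pos finite_pos_weights by auto
qed

text \<open>The lower bound keeps the punctured disc of radius \<open>norm t\<close> around 0 free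
  of poles, which fixes the circle for the residue at 0.\<close>

lemma norm_poles:
  assumes t: "t \<noteq> 0" "norm t < 1" and z: "z \<in> poles r d t"
  shows "norm t \<le> norm z" "norm z < 1" "z \<noteq> 0"
proof -
  obtain p where p: "p \<in> pos_weights r d" "z powi weight d p = t" using z by (auto simp: poles_def)
  obtain m where m: "weight d p = int (Suc m)"
    using weight_pos[OF p(1)] by (metis Suc_pred' pos_int_cases)
  have e: "norm z ^ Suc m = norm t" using p(2) unfolding m by (metis norm_power power_int_of_nat)
  show "norm z < 1"
    by (rule ccontr) (use e t one_le_power[of "norm z" "Suc m"] in linarith)
  thus "norm t \<le> norm z" using power_decreasing[of 1 "Suc m" "norm z"] e by simp
  show "z \<noteq> 0" using e t by auto
qed

lemma integrand_holomorphic: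
  assumes "0 \<notin> A"
    and "\<And>z p. z \<in> A \<Longrightarrow> p \<in> pos_weights r d \<Longrightarrow> z powi weight d p \<noteq> t \<and> t * z powi weight d p \<noteq> 1"
  shows "integrand r d L t holomorphic_on A"
proof -
  have "(1 - t * z powi (- weight d p)) * (1 - t * z powi weight d p) \<noteq> 0"
    if "z \<in> A" "p \<in> pos_weights r d" for z p
  proof -
    have "z \<noteq> 0" using assms(1) that(1) by blast
    hence "1 - t * z powi (- weight d p) = (z powi weight d p - t) / z powi weight d p"
      by (simp add: power_int_minus field_simps)
    thus ?thesis using assms(2)[OF that] \<open>z \<noteq> 0\<close> by simp
  qed
  moreover have "z \<noteq> 0" if "z \<in> A" for z using that assms(1) by blast
  ultimately show ?thesis
    unfolding integrand_def[abs_def] by (intro holomorphic_intros) auto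
qed

lemma prod_power_int:
  fixes z :: "'a :: field"
  assumes "z \<noteq> 0"
  shows "(\<Prod>p\<in>P. z powi f p) = z powi (\<Sum>p\<in>P. f p)"
  using assms by (induction P rule: infinite_finite_induct) (auto simp: power_int_add)

lemma outer_poles:
  fixes t z :: complex
  assumes "norm t < 1" "p \<in> pos_weights r d" "t * z powi weight d p = 1"
  shows "norm z > 1"
proof (rule ccontr)
  assume "\<not> norm z > 1"
  hence "norm z powi weight d p \<le> 1" using weight_pos[OF assms(2)] by (intro power_int_le_one) auto
  moreover have "norm t * norm z powi weight d p = 1"
    using arg_cong[OF assms(3), of norm] by (simp add: norm_mult norm_power_int)
  ultimately show False using assms(1) mult_left_mono[of "norm z powi weight d p" 1 "norm t"] by simp
qed

lemma contour_integral_integrand: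
  assumes t: "t \<noteq> 0" "norm t < 1"
  shows "contour_integral (circlepath 0 1) (integrand r d L t) =
    2 * of_real pi * \<i> * (residue (integrand r d L t) 0 + (\<Sum>z\<in>poles r d t. residue (integrand r d L t) z))"
proof -
  define outer where "outer = (\<Union>p\<in>pos_weights r d. {z. t * z powi weight d p = 1})"
  have fin: "finite outer"
  proof -
    have "{z. t * z powi weight d p = 1} = {z. z powi weight d p = 1 / t}" for p using t(1) by (auto simp: field_simps)
    thus ?thesis unfolding outer_def using finite_powi_roots weight_pos finite_pos_weights by auto
  qed
  have out: "norm z > 1" if "z \<in> outer" for z using that outer_poles[OF t(2)] by (auto simp: outer_def)
  \<comment> \<open>The outer poles are listed because the residue theorem is applied on the whole
    plane; their winding number is 0.\<close>
  let ?S = "insert 0 (poles r d t \<union> outer)"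
  have "contour_integral (circlepath 0 1) (integrand r d L t) =
    2 * pi * \<i> * (\<Sum>z\<in>?S. winding_number (circlepath 0 1) z * residue (integrand r d L t) z)"
  proof (rule Residue_theorem[of UNIV])
    show "finite ?S" using fin finite_poles by simp
    show "integrand r d L t holomorphic_on UNIV - ?S"
      by (rule integrand_holomorphic) (auto simp: poles_def outer_def)
    show "path_image (circlepath 0 1) \<subseteq> UNIV - ?S"
      using out norm_poles(2)[OF t] by (fastforce simp: sphere_def)
  qed auto
  also have "(\<Sum>z\<in>?S. winding_number (circlepath 0 1) z * residue (integrand r d L t) z) =
      (\<Sum>z\<in>insert 0 (poles r d t). winding_number (circlepath 0 1) z * residue (integrand r d L t) z)"
  proof (rule sum.mono_neutral_right)
    show "\<forall>z\<in>?S - insert 0 (poles r d t). winding_number (circlepath 0 1) z * residue (integrand r d L t) z = 0"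
    proof
      fix z assume "z \<in> ?S - insert 0 (poles r d t)"
      hence "norm z > 1" using out by auto
      hence "winding_number (circlepath 0 1) z = 0"
        by (intro winding_number_zero_outside[of _ "cball 0 1"]) auto
      thus "winding_number (circlepath 0 1) z * residue (integrand r d L t) z = 0" by simp
    qed
  qed (use fin finite_poles in auto)
  also have "\<dots> = (\<Sum>z\<in>insert 0 (poles r d t). residue (integrand r d L t) z)"
  proof (rule sum.cong)
    fix z assume "z \<in> insert 0 (poles r d t)"
    hence "norm z < 1" using norm_poles(2)[OF t] by auto
    hence "winding_number (circlepath 0 1) z = 1" by (intro winding_number_circlepath) simp
    thus "winding_number (circlepath 0 1) z * residue (integrand r d L t) z = residue (integrand r d L t) z" by simp
  qed simp
  also have "\<dots> = residue (integrand r d L t) 0 + (\<Sum>z\<in>poles r d t. residue (integrand r d L t) z)"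
    using norm_poles(3)[OF t] finite_poles by (subst sum.insert) auto
  finally show ?thesis by simp
qed

section \<open>The residue at 0\<close>

lemma finite_exponent_pairs: "finite (exponent_pairs r d L)"
proof (rule finite_subset)
  let ?P = "pos_weights r d" and ?N = "nat (nu r d L - 1)"
  show "exponent_pairs r d L \<subseteq> PiE ?P (\<lambda>_. {..?N}) \<times> PiE ?P (\<lambda>_. {..?N})"
  proof clarify
    fix I J assume IJ: "(I, J) \<in> exponent_pairs r d L"
    have "I p \<le> ?N \<and> J p \<le> ?N" if p: "p \<in> ?P" for p
    proof -
      have "int (I p + J p) * 1 \<le> int (I p + J p) * weight d p"
        using weight_pos[OF p] by (intro mult_left_mono) auto
      also have "\<dots> \<le> (\<Sum>p\<in>?P. int (I p + J p) * weight d p)"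
        using p finite_pos_weights weight_pos by (intro member_le_sum) (auto simp: less_imp_le)
      also have "\<dots> = nu r d L - 1" using IJ by (simp add: exponent_pairs_def)
      finally have "int (I p) \<le> nu r d L - 1" "int (J p) \<le> nu r d L - 1" by simp_all
      from nat_mono[OF this(1)] nat_mono[OF this(2)] show ?thesis by simp
    qed
    thus "I \<in> PiE ?P (\<lambda>_. {..?N}) \<and> J \<in> PiE ?P (\<lambda>_. {..?N})"
      using IJ by (auto simp: exponent_pairs_def PiE_iff)
  qed
qed (auto intro!: finite_PiE finite_pos_weights)

lemma exponent_pairs_empty: "nu r d L \<le> 0 \<Longrightarrow> exponent_pairs r d L = {}"
proof -
  assume "nu r d L \<le> 0"
  moreover have "0 \<le> (\<Sum>p\<in>pos_weights r d. int (I p + J p) * weight d p)" for I J :: "nat \<times> nat \<Rightarrow> nat"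
    using weight_pos by (intro sum_nonneg mult_nonneg_nonneg) (auto simp: less_imp_le)
  ultimately show ?thesis unfolding exponent_pairs_def by (smt (verit) Collect_empty_eq case_prodE)
qed

text \<open>For \<open>norm z < norm t\<close> write \<open>1 - t * z powi (- a)\<close> as
  \<open>- t * z powi (- a) * (1 - z powi a / t)\<close> and expand. Each weight gives a factor
  \<open>- 1 / t * z powi a\<close>, the origin of the sign and of the \<open>- 1\<close> in the
  exponents of \<open>t\<close>, and two geometric series: in \<open>t * z powi a\<close> with
  exponent \<open>I\<close> and in \<open>z powi a / t\<close> with exponent
  \<open>J\<close>.\<close>

lemma residue_integrand_0:
  assumes t: "t \<noteq> 0" "norm t < 1"
  shows "residue (integrand r d L t) 0 = (- 1) ^ card (pos_weights r d) *
    (\<Sum>(I, J)\<in>exponent_pairs r d L. \<Prod>p\<in>pos_weights r d. t powi (int (I p) - int (J p) - 1))"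
proof -
  let ?P = "pos_weights r d"
  define Q where "Q = ?P \<times> (UNIV :: bool set)"
  define c where "c q = (if snd q then 1 / t else t)" for q :: "(nat \<times> nat) \<times> bool"
  define m where "m q = weight d (fst q)" for q :: "(nat \<times> nat) \<times> bool"
  \<comment> \<open>Below \<open>norm t\<close>, so that the series in \<open>z powi a / t\<close>
    converges on the circle as well.\<close>
  define \<rho> where "\<rho> = norm t / 2"
  define A where "A = (\<Sum>p\<in>?P. weight d p)"
  define I where "I k = contour_integral (circlepath 0 \<rho>) (\<lambda>z. z powi (k - 1) * (\<Prod>q\<in>Q. 1 / (1 - c q * z powi m q)))" for k
  define C where "C = (- 1) ^ card ?P * (1 / t) ^ card ?P"
  have \<rho>: "0 < \<rho>" "\<rho> < norm t" "\<rho> < 1" using t by (auto simp: \<rho>_def)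
  have finQ: "finite Q" by (simp add: Q_def finite_pos_weights)
  have prod_Q: "(\<Prod>q\<in>Q. g q) = (\<Prod>p\<in>?P. g (p, True) * g (p, False))" for g :: "_ \<Rightarrow> complex"
    unfolding Q_def by (simp add: prod.cartesian_product' UNIV_bool mult.commute)
  have sum_Q: "(\<Sum>q\<in>Q. g q) = (\<Sum>p\<in>?P. g (p, True) + g (p, False))" for g :: "_ \<Rightarrow> int"
    unfolding Q_def by (simp add: sum.cartesian_product' UNIV_bool add.commute)
  have lt: "norm (c q) * \<rho> powi m q < 1" if "q \<in> Q" for q
  proof -
    have m: "m q \<ge> 1" using that weight_pos by (force simp: Q_def m_def)
    have "\<rho> powi m q \<le> \<rho> powi 1" using \<rho> m by (intro power_int_decreasing) auto
    hence le: "\<rho> powi m q \<le> \<rho>" by simp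
    have "norm (c q) * \<rho> powi m q \<le> norm (c q) * \<rho>" by (intro mult_left_mono le) simp
    also have "norm (c q) * \<rho> < 1"
    proof (cases "snd q")
      case True
      then show ?thesis using \<rho> t by (simp add: c_def norm_divide \<rho>_def)
    next
      case False
      then show ?thesis using \<rho> t mult_strict_mono[of "norm t" 1 \<rho> 1] by (simp add: c_def)
    qed
    finally show ?thesis .
  qed
  have I_sum: "((\<lambda>\<gamma>. \<Prod>q\<in>Q. c q ^ \<gamma> q) has_sum (I k / (2 * of_real pi * \<i>)))
      {\<gamma> \<in> PiE Q (\<lambda>_. UNIV). k + (\<Sum>q\<in>Q. int (\<gamma> q) * m q) = 0}" for k
    unfolding I_def by (rule has_sum_circle_coefficient[OF finQ \<rho>(1) lt])
  have A0: "A \<ge> 0" unfolding A_def using weight_pos by (intro sum_nonneg) (auto simp: less_imp_le)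
  \<comment> \<open>After expansion all exponents of \<open>z\<close> in this half of the numerator
    are nonnegative, so it has no residue at 0.\<close>
  have I2: "I (int L + 2 + A) = 0"
  proof -
    have ge: "(\<Sum>q\<in>Q. int (\<gamma> q) * m q) \<ge> 0" for \<gamma>
      using weight_pos by (intro sum_nonneg mult_nonneg_nonneg) (auto simp: Q_def m_def less_imp_le)
    hence "int L + 2 + A + (\<Sum>q\<in>Q. int (\<gamma> q) * m q) \<noteq> 0" for \<gamma> using A0 ge[of \<gamma>] by linarith
    hence "((\<lambda>\<gamma>. \<Prod>q\<in>Q. c q ^ \<gamma> q) has_sum (I (int L + 2 + A) / (2 * of_real pi * \<i>))) {}"
      using I_sum[of "int L + 2 + A"] by simp
    from has_sum_unique[OF this has_sum_empty] show ?thesis by simp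
  qed
  \<comment> \<open>The surviving exponent vectors have weighted sum \<open>L - A\<close>, which is
    \<open>nu r d L - 1\<close>; the flag \<open>True\<close> marks the exponents
    \<open>J\<close>.\<close>
  have I1: "I (A - int L) / (2 * of_real pi * \<i>) =
     (\<Sum>(I, J)\<in>exponent_pairs r d L. \<Prod>p\<in>?P. t ^ I p * (1 / t) ^ J p)"
  proof -
    have "((\<lambda>(I, J). \<Prod>p\<in>?P. t ^ I p * (1 / t) ^ J p) has_sum (I (A - int L) / (2 * of_real pi * \<i>))) (exponent_pairs r d L)
      \<longleftrightarrow> ((\<lambda>\<gamma>. \<Prod>q\<in>Q. c q ^ \<gamma> q) has_sum (I (A - int L) / (2 * of_real pi * \<i>)))
        {\<gamma> \<in> PiE Q (\<lambda>_. UNIV). A - int L + (\<Sum>q\<in>Q. int (\<gamma> q) * m q) = 0}"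
    proof (rule has_sum_reindex_bij_witness[of _ "\<lambda>\<gamma>. (restrict (\<lambda>p. \<gamma> (p, False)) ?P, restrict (\<lambda>p. \<gamma> (p, True)) ?P)"
          "\<lambda>(I, J). restrict (\<lambda>(p, b). if b then J p else I p) Q"])
      fix x assume x: "x \<in> exponent_pairs r d L"
      obtain I J where IJ: "x = (I, J)" by (cases x)
      have ext: "I \<in> extensional ?P" "J \<in> extensional ?P"
        and S: "(\<Sum>p\<in>?P. int (I p + J p) * weight d p) = nu r d L - 1"
        using x by (auto simp: IJ exponent_pairs_def)
      define \<gamma> where "\<gamma> = restrict (\<lambda>(p, b). if b then J p else I p) Q"
      have g: "\<gamma> (p, b) = (if b then J p else I p)" if "p \<in> ?P" for p b using that by (simp add: \<gamma>_def Q_def)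
      have "(\<Sum>q\<in>Q. int (\<gamma> q) * m q) = (\<Sum>p\<in>?P. int (I p + J p) * weight d p)"
        unfolding sum_Q by (intro sum.cong) (auto simp: g m_def algebra_simps)
      hence "A - int L + (\<Sum>q\<in>Q. int (\<gamma> q) * m q) = 0" using S by (simp add: nu_def A_def)
      thus "(case x of (I, J) \<Rightarrow> restrict (\<lambda>(p, b). if b then J p else I p) Q) \<in>
          {\<gamma> \<in> PiE Q (\<lambda>_. UNIV). A - int L + (\<Sum>q\<in>Q. int (\<gamma> q) * m q) = 0}"
        by (simp add: IJ \<gamma>_def)
      show "(\<lambda>\<gamma>. (restrict (\<lambda>p. \<gamma> (p, False)) ?P, restrict (\<lambda>p. \<gamma> (p, True)) ?P))
          (case x of (I, J) \<Rightarrow> restrict (\<lambda>(p, b). if b then J p else I p) Q) = x"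
        using ext by (auto simp: IJ Q_def fun_eq_iff extensional_def restrict_def)
      have "(\<Prod>q\<in>Q. c q ^ \<gamma> q) = (\<Prod>p\<in>?P. t ^ I p * (1 / t) ^ J p)"
        unfolding prod_Q by (intro prod.cong) (auto simp: g c_def mult.commute)
      thus "(\<Prod>q\<in>Q. c q ^ (case x of (I, J) \<Rightarrow> restrict (\<lambda>(p, b). if b then J p else I p) Q) q) =
          (case x of (I, J) \<Rightarrow> \<Prod>p\<in>?P. t ^ I p * (1 / t) ^ J p)"
        by (simp add: IJ \<gamma>_def)
    next
      fix \<gamma> assume g: "\<gamma> \<in> {\<gamma> \<in> PiE Q (\<lambda>_. UNIV). A - int L + (\<Sum>q\<in>Q. int (\<gamma> q) * m q) = 0}"
      have "(\<Sum>q\<in>Q. int (\<gamma> q) * m q) = (\<Sum>p\<in>?P. int (\<gamma> (p, False) + \<gamma> (p, True)) * weight d p)"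
        unfolding sum_Q by (intro sum.cong) (auto simp: m_def algebra_simps)
      thus "(restrict (\<lambda>p. \<gamma> (p, False)) ?P, restrict (\<lambda>p. \<gamma> (p, True)) ?P) \<in> exponent_pairs r d L"
        using g by (simp add: exponent_pairs_def nu_def A_def)
      show "(case (restrict (\<lambda>p. \<gamma> (p, False)) ?P, restrict (\<lambda>p. \<gamma> (p, True)) ?P) of
          (I, J) \<Rightarrow> restrict (\<lambda>(p, b). if b then J p else I p) Q) = \<gamma>"
        using g by (auto simp: Q_def fun_eq_iff PiE_iff extensional_def restrict_def)
    qed simp
    with I_sum[of "A - int L"] have "((\<lambda>(I, J). \<Prod>p\<in>?P. t ^ I p * (1 / t) ^ J p) has_sum (I (A - int L) / (2 * of_real pi * \<i>))) (exponent_pairs r d L)"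
      by blast
    thus ?thesis using has_sum_finite[OF finite_exponent_pairs] has_sum_unique by blast
  qed
  have "2 * pi * \<i> * residue (integrand r d L t) 0 = contour_integral (circlepath 0 \<rho>) (integrand r d L t)"
  proof (rule contour_integral_unique[symmetric], rule base_residue[of "ball 0 (norm t)"])
    show "integrand r d L t holomorphic_on ball 0 (norm t) - {0}"
    proof (rule integrand_holomorphic, simp)
      fix z :: complex and p assume z: "z \<in> ball 0 (norm t) - {0}" and p: "p \<in> ?P"
      have "z \<notin> poles r d t" using norm_poles(1)[OF t, of z] z by fastforce
      thus "z powi weight d p \<noteq> t \<and> t * z powi weight d p \<noteq> 1"
        using outer_poles[OF t(2) p, of z] z p t by (auto simp: poles_def)
    qed
  qed (use \<rho> t in auto)
  also have "\<dots> = contour_integral (circlepath 0 \<rho>) (\<lambda>z. C * (z powi (A - int L - 1) * (\<Prod>q\<in>Q. 1 / (1 - c q * z powi m q)) -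
      z powi (int L + 2 + A - 1) * (\<Prod>q\<in>Q. 1 / (1 - c q * z powi m q))))"
  proof (rule contour_integral_cong)
    fix z assume "z \<in> path_image (circlepath 0 \<rho>)"
    hence z: "z \<noteq> 0" "norm z = \<rho>" using \<rho> by auto
    have f: "1 / ((1 - t * z powi (- weight d p)) * (1 - t * z powi weight d p)) =
       (- 1) * (1 / t) * z powi weight d p * (1 / (1 - 1 / t * z powi weight d p) * (1 / (1 - t * z powi weight d p)))" for p
    proof -
      have "1 - t * z powi (- weight d p) = - t * inverse (z powi weight d p) * (1 - 1 / t * z powi weight d p)"
        using t z by (simp add: power_int_minus field_simps)
      thus ?thesis by (simp only:) (simp add: divide_inverse mult_ac)
    qed
    have "(\<Prod>p\<in>?P. z powi weight d p) = z powi A"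
      unfolding A_def by (rule prod_power_int[OF z(1)])
    hence "(\<Prod>p\<in>?P. 1 / ((1 - t * z powi (- weight d p)) * (1 - t * z powi weight d p))) =
        C * z powi A * (\<Prod>q\<in>Q. 1 / (1 - c q * z powi m q))"
      unfolding f prod_Q
      by (simp only: prod.distrib prod_constant C_def c_def m_def fst_conv snd_conv if_True if_False mult.assoc)
    thus "integrand r d L t z = C * (z powi (A - int L - 1) * (\<Prod>q\<in>Q. 1 / (1 - c q * z powi m q)) -
      z powi (int L + 2 + A - 1) * (\<Prod>q\<in>Q. 1 / (1 - c q * z powi m q)))"
      using z power_int_add[of z "- int L - 1" A] power_int_add[of z "int L + 1" A]
      by (simp add: integrand_def algebra_simps)
  qed simp
  also have "\<dots> = C * (I (A - int L) - I (int L + 2 + A))"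
  proof -
    have int: "(\<lambda>z. z powi k * (\<Prod>q\<in>Q. 1 / (1 - c q * z powi m q))) contour_integrable_on circlepath 0 \<rho>" for k
    proof (rule contour_integrable_continuous_circlepath, intro continuous_intros ballI)
      fix q z assume "q \<in> Q" "z \<in> path_image (circlepath 0 \<rho>)"
      hence "norm (c q * z powi m q) < 1" using lt[of q] \<rho> by (simp add: norm_mult norm_power_int)
      thus "1 - c q * z powi m q \<noteq> 0" by auto
    qed (use \<rho> in auto)
    show ?thesis
      unfolding I_def contour_integral_diff[OF int int, symmetric]
      by (rule contour_integral_lmul[OF contour_integrable_diff[OF int int]])
  qed
  also have "\<dots> = C * I (A - int L)" by (simp only: I2 diff_0_right)
  finally have "residue (integrand r d L t) 0 = C * (I (A - int L) / (2 * of_real pi * \<i>))"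
    by (simp add: field_simps)
  also have "\<dots> = (- 1) ^ card ?P * (\<Sum>(I, J)\<in>exponent_pairs r d L. (1 / t) ^ card ?P * (\<Prod>p\<in>?P. t ^ I p * (1 / t) ^ J p))"
    unfolding I1 C_def by (simp add: sum_distrib_left case_prod_unfold mult.assoc)
  finally have res: "residue (integrand r d L t) 0 = (- 1) ^ card ?P *
    (\<Sum>(I, J)\<in>exponent_pairs r d L. (1 / t) ^ card ?P * (\<Prod>p\<in>?P. t ^ I p * (1 / t) ^ J p))" .
  have "(1 / t) ^ card ?P * (\<Prod>p\<in>?P. t ^ I p * (1 / t) ^ J p) = (\<Prod>p\<in>?P. t powi (int (I p) - int (J p) - 1))"
    for I J :: "nat \<times> nat \<Rightarrow> nat"
  proof -
    have "t powi (int (I p) - int (J p) - 1) = 1 / t * (t ^ I p * (1 / t) ^ J p)" for p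
      using t by (simp add: power_int_diff power_int_add power_one_over field_simps)
    thus ?thesis by (simp only: prod.distrib prod_constant)
  qed
  thus ?thesis unfolding res by (simp only:)
qed

section \<open>Residues and the perturbed integrand\<close>

text \<open>The left side is the integral of \<open>f\<close> over the image curve. That curve winds
  once around \<open>\<phi> x0\<close>, because the logarithmic derivative of
  \<open>\<phi> - \<phi> x0\<close> has residue 1 at its simple zero, and it does not wind around
  points outside the image of the ball, so the residue theorem applies on that image.\<close>

lemma residue_change_of_variables:
  assumes holo: "\<phi> holomorphic_on ball x0 R" and inj: "inj_on \<phi> (ball x0 R)"
    and \<epsilon>: "0 < \<epsilon>" "\<epsilon> < R" and f: "f holomorphic_on \<phi> ` ball x0 R - {\<phi> x0}"
  shows "contour_integral (circlepath x0 \<epsilon>) (\<lambda>x. deriv \<phi> x * f (\<phi> x)) = 2 * of_real pi * \<i> * residue f (\<phi> x0)"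
proof -
  define B where "B = ball x0 R"
  define \<gamma> where "\<gamma> = circlepath x0 \<epsilon>"
  have x0: "x0 \<in> B" using \<epsilon> by (simp add: B_def)
  have pi: "path_image \<gamma> \<subseteq> B - {x0}" using \<epsilon> by (auto simp: \<gamma>_def B_def)
  have vp: "valid_path \<gamma>" "pathfinish \<gamma> = pathstart \<gamma>" by (simp_all add: \<gamma>_def)
  have an: "\<phi> analytic_on B" using holo by (simp add: B_def analytic_on_open)
  have vpc: "valid_path (\<phi> \<circ> \<gamma>)"
    using pi holo by (intro valid_path_compose_holomorphic[OF vp(1)]) (auto simp: B_def)
  have comp: "contour_integral (\<phi> \<circ> \<gamma>) g = contour_integral \<gamma> (\<lambda>w. deriv \<phi> w * g (\<phi> w))" for g
    using pi by (intro contour_integral_comp_analyticW[OF an vp(1)]) auto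
  have dh: "deriv \<phi> holomorphic_on B" using holo by (auto simp: B_def intro: holomorphic_deriv)
  have reg: "deriv \<phi> x0 \<noteq> 0"
    using holomorphic_injective_imp_regular[OF holo _ inj, of x0] x0 by (simp add: B_def)
  have wn: "winding_number (\<phi> \<circ> \<gamma>) z = 1 / (2 * pi * \<i>) * contour_integral \<gamma> (\<lambda>w. deriv \<phi> w * (1 / (\<phi> w - z)))"
    if "z \<notin> \<phi> ` path_image \<gamma>" for z
    using winding_number_valid_path[OF vpc, of z] that comp by (simp add: path_image_compose)
  have wn0: "winding_number (\<phi> \<circ> \<gamma>) z = 0" if "z \<notin> \<phi> ` B" for z
  proof -
    have "((\<lambda>w. deriv \<phi> w * (1 / (\<phi> w - z))) has_contour_integral 0) \<gamma>"
    proof (rule Cauchy_theorem_convex_simple[of _ B])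
      show "(\<lambda>w. deriv \<phi> w * (1 / (\<phi> w - z))) holomorphic_on B"
        using that holo dh by (auto intro!: holomorphic_intros simp: B_def)
    qed (use pi vp in \<open>auto simp: B_def\<close>)
    thus ?thesis using wn[of z] that pi contour_integral_unique by fastforce
  qed
  have avoid: "\<phi> x0 \<notin> \<phi> ` path_image \<gamma>"
    using pi x0 inj by (auto simp: B_def inj_on_def)
  have wn1: "winding_number (\<phi> \<circ> \<gamma>) (\<phi> x0) = 1"
  proof -
    have nz: "\<phi> w - \<phi> x0 \<noteq> 0" if "w \<in> B - {x0}" for w using that inj x0 by (auto simp: B_def inj_on_def)
    have "contour_integral \<gamma> (\<lambda>w. deriv \<phi> w / (\<phi> w - \<phi> x0)) = 2 * pi * \<i> * residue (\<lambda>w. deriv \<phi> w / (\<phi> w - \<phi> x0)) x0"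
      unfolding \<gamma>_def
    proof (rule contour_integral_unique, rule base_residue[of B])
      show "(\<lambda>w. deriv \<phi> w / (\<phi> w - \<phi> x0)) holomorphic_on B - {x0}"
        using holo dh nz by (intro holomorphic_intros) (auto simp: B_def intro: holomorphic_on_subset)
    qed (use \<epsilon> in \<open>auto simp: B_def\<close>)
    also have "residue (\<lambda>w. deriv \<phi> w / (\<phi> w - \<phi> x0)) x0 = deriv \<phi> x0 / deriv \<phi> x0"
    proof (rule residue_simple_pole_deriv[of _ B])
      show "((\<lambda>w. \<phi> w - \<phi> x0) has_field_derivative deriv \<phi> x0) (at x0)"
        using holo x0 by (auto intro!: derivative_eq_intros holomorphic_derivI[of \<phi> B] simp: B_def)
      show "(\<lambda>w. \<phi> w - \<phi> x0) holomorphic_on B" using holo by (intro holomorphic_intros) (simp add: B_def)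
    qed (use dh x0 reg in \<open>auto simp: B_def\<close>)
    finally show ?thesis using wn[OF avoid] reg by simp
  qed
  have "contour_integral (\<phi> \<circ> \<gamma>) f = 2 * pi * \<i> * (\<Sum>p\<in>{\<phi> x0}. winding_number (\<phi> \<circ> \<gamma>) p * residue f p)"
  proof (rule Residue_theorem[of "\<phi> ` B"])
    show "open (\<phi> ` B)" using open_mapping_thm3[OF holo _ inj] by (simp add: B_def)
    show "connected (\<phi> ` B)"
      using holo by (intro connected_continuous_image holomorphic_on_imp_continuous_on) (simp_all add: B_def)
    show "path_image (\<phi> \<circ> \<gamma>) \<subseteq> \<phi> ` B - {\<phi> x0}" 
      unfolding path_image_compose using pi avoid by blast
  qed (use f wn0 vpc vp in \<open>auto simp: B_def pathfinish_compose pathstart_compose\<close>)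
  thus ?thesis unfolding \<gamma>_def[symmetric] by (simp add: wn1 comp)
qed

lemma residue_simple_quotient:
  assumes "open S" "z \<in> S" "f holomorphic_on S" "g holomorphic_on S" "g z = 0"
    and g': "(g has_field_derivative g') (at z)" "g' \<noteq> 0" and nz: "\<And>w. w \<in> S - {z} \<Longrightarrow> g w \<noteq> 0"
  shows "residue (\<lambda>w. f w / g w) z = f z / g'"
proof (rule residue_simple'[OF assms(1,2)])
  show "(\<lambda>w. f w / g w) holomorphic_on S - {z}"
    using assms(3,4) nz by (intro holomorphic_intros) (auto intro: holomorphic_on_subset)
  have "isCont f z" using assms(1-3) holomorphic_on_imp_continuous_on continuous_on_eq_continuous_at by blast
  hence 1: "(f \<longlongrightarrow> f z) (at z)" by (simp add: isCont_def)
  have "((\<lambda>w. (g w - g z) / (w - z)) \<longlongrightarrow> g') (at z)"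
    using g'(1) by (simp add: has_field_derivative_iff)
  from tendsto_divide[OF 1 this g'(2)]
  show "((\<lambda>w. f w / g w * (w - z)) \<longlongrightarrow> f z / g') (at z)" by (simp add: assms(5))
qed

section \<open>The integrand in the logarithmic variable\<close>

lemma exp_eq_1_small:
  assumes "exp u = 1" "norm u < 2 * pi"
  shows "u = (0 :: complex)"
proof -
  obtain n :: int where n: "Re u = 0" "Im u = of_int (2 * n) * pi" using assms(1) exp_eq_1 by auto
  have "\<bar>Im u\<bar> < 2 * pi" using assms(2) abs_Im_le_cmod[of u] by linarith
  hence "\<bar>real_of_int n\<bar> * (2 * pi) < 1 * (2 * pi)" by (simp add: n(2) abs_mult)
  hence "\<bar>real_of_int n\<bar> < 1" using mult_less_cancel_right_pos[of "2 * pi" "\<bar>real_of_int n\<bar>" 1] by simp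
  hence "n = 0" by linarith
  with n show ?thesis by (simp add: complex_eq_iff)
qed

text \<open>With \<open>t = exp s\<close>, \<open>z = \<zeta> * exp (s * x)\<close> and
  \<open>b p\<close> equal to the weight \<open>a\<close>, this is
  \<open>1 - t * z powi (- a)\<close>. Only the exponent of \<open>exp (s * x)\<close> is perturbed;
  \<open>\<zeta>\<close> keeps its integral power, so the factor stays entire in
  \<open>x\<close>.\<close>

definition factor1 :: "(nat \<Rightarrow> nat) \<Rightarrow> complex \<Rightarrow> complex \<Rightarrow> (nat \<times> nat \<Rightarrow> real) \<Rightarrow> nat \<times> nat \<Rightarrow> complex \<Rightarrow> complex" where
  "factor1 d s \<zeta> b p x = 1 - \<zeta> powi (- weight d p) * exp (s * (1 - of_real (b p) * x))"
definition factor2 :: "(nat \<Rightarrow> nat) \<Rightarrow> complex \<Rightarrow> complex \<Rightarrow> (nat \<times> nat \<Rightarrow> real) \<Rightarrow> nat \<times> nat \<Rightarrow> complex \<Rightarrow> complex" where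
  "factor2 d s \<zeta> b p x = 1 - \<zeta> powi weight d p * exp (s * (1 + of_real (b p) * x))"
text \<open>The numerator of \<open>integrand\<close> times one more \<open>z\<close>, which comes
  from \<open>dz = s * z * dx\<close>.\<close>

definition numer :: "nat \<Rightarrow> complex \<Rightarrow> complex \<Rightarrow> complex \<Rightarrow> complex" where
  "numer L s \<zeta> x = \<zeta> powi (- int L) * exp (- of_nat L * s * x) - \<zeta> ^ (L + 2) * exp (of_nat (L + 2) * s * x)"

text \<open>In the variable \<open>x = log (z / \<zeta>) / s\<close>, the poles of the perturbed integrand near \<open>1 / a\<close> are the
  simple poles \<open>1 / b p\<close> with \<open>weight d p = a\<close>.\<close>

definition perturbed :: "nat \<Rightarrow> (nat \<Rightarrow> nat) \<Rightarrow> nat \<Rightarrow> complex \<Rightarrow> complex \<Rightarrow> (nat \<times> nat \<Rightarrow> real) \<Rightarrow> complex \<Rightarrow> complex" where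
  "perturbed r d L s \<zeta> b x = numer L s \<zeta> x / (\<Prod>p\<in>pos_weights r d. factor1 d s \<zeta> b p x * factor2 d s \<zeta> b p x)"

lemma perturbed_at_weights:
  assumes "\<zeta> \<noteq> 0" "\<And>p. p \<in> pos_weights r d \<Longrightarrow> b p = of_int (weight d p)" "t = exp s"
  shows "perturbed r d L s \<zeta> b x = \<zeta> * exp (s * x) * integrand r d L t (\<zeta> * exp (s * x))"
proof -
  define z where "z = \<zeta> * exp (s * x)"
  have z: "z \<noteq> 0" using assms(1) by (simp add: z_def)
  have zp: "z powi k = \<zeta> powi k * exp (of_int k * s * x)" for k
    by (simp add: z_def power_int_mult_distrib exp_power_int mult_ac)
  have "factor1 d s \<zeta> b p x = 1 - t * z powi (- weight d p)" "factor2 d s \<zeta> b p x = 1 - t * z powi weight d p"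
    if "p \<in> pos_weights r d" for p
    by (simp_all add: factor1_def factor2_def zp assms(2)[OF that] assms(3) exp_add[symmetric] algebra_simps
        flip: exp_minus exp_diff)
  moreover have "numer L s \<zeta> x = z * (z powi (- int L - 1) - z powi (int L + 1))"
  proof -
    have "z * z powi (- int L - 1) = z powi (- int L)" "z * z powi (int L + 1) = z powi (int (L + 2))"
      using z power_int_add[of z 1 "- int L - 1"] power_int_add[of z 1 "int L + 1"] by (simp_all add: add_ac)
    hence "z * (z powi (- int L - 1) - z powi (int L + 1)) = z powi (- int L) - z powi (int (L + 2))"
      by (simp only: right_diff_distrib)
    also have "\<dots> = numer L s \<zeta> x" unfolding numer_def zp by (simp only: power_int_of_nat of_int_of_nat_eq of_int_minus)
    finally show ?thesis ..
  qed
  ultimately show ?thesis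
    by (simp add: perturbed_def integrand_def z_def[symmetric] prod_dividef divide_inverse cong: prod.cong)
      (simp add: prod_inversef[symmetric] o_def)
qed

text \<open>At \<open>1 / b q\<close> only \<open>factor1\<close> for \<open>q\<close> vanishes,
  with derivative \<open>s * b q\<close>; its partner \<open>factor2\<close> takes the value
  \<open>1 - t ^ 2\<close>, and the other factors are those of the perturbed sum. The
  \<open>s\<close> in front is the one of \<open>dz = s * z * dx\<close> and cancels the one in the
  derivative.\<close>

lemma residue_perturbed:
  assumes q: "q \<in> pos_weights r d" "\<zeta> powi weight d q = 1" "b q > 0" and s: "exp s = t" "s \<noteq> 0" and t2: "t ^ 2 \<noteq> 1"
    and S: "open S" "of_real (1 / b q) \<in> S"
    and nz: "\<And>p x. p \<in> pos_weights r d \<Longrightarrow> x \<in> S \<Longrightarrow> factor2 d s \<zeta> b p x \<noteq> 0 \<and>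
       (factor1 d s \<zeta> b p x = 0 \<longrightarrow> p = q \<and> x = of_real (1 / b q))"
  shows "s * residue (perturbed r d L s \<zeta> b) (of_real (1 / b q)) / (1 - t) ^ e =
    (\<zeta> powi (- int L) * logpow s (- real L / b q) - \<zeta> ^ (L + 2) * logpow s (real (L + 2) / b q)) /
        (of_real (b q) * (1 - t ^ 2) * (1 - t) ^ e *
          (\<Prod>p\<in>pos_weights r d - {q}.
             (1 - \<zeta> powi (- weight d p) * logpow s ((b q - b p) / b q)) *
             (1 - \<zeta> powi (weight d p) * logpow s ((b q + b p) / b q))))"
proof -
  let ?P = "pos_weights r d"
  define x where "x = complex_of_real (1 / b q)"
  define f where "f = (\<lambda>x. numer L s \<zeta> x / (factor2 d s \<zeta> b q x * (\<Prod>p\<in>?P - {q}. factor1 d s \<zeta> b p x * factor2 d s \<zeta> b p x)))"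
  have zq: "\<zeta> powi (- weight d q) = 1" using q(2) by (simp add: power_int_minus)
  have eq: "perturbed r d L s \<zeta> b = (\<lambda>x. f x / factor1 d s \<zeta> b q x)"
  proof
    fix x
    have "(\<Prod>p\<in>?P. factor1 d s \<zeta> b p x * factor2 d s \<zeta> b p x) =
        factor1 d s \<zeta> b q x * factor2 d s \<zeta> b q x * (\<Prod>p\<in>?P - {q}. factor1 d s \<zeta> b p x * factor2 d s \<zeta> b p x)"
      by (rule prod.remove[OF finite_pos_weights q(1)])
    thus "perturbed r d L s \<zeta> b x = f x / factor1 d s \<zeta> b q x"
      by (simp add: perturbed_def f_def mult_ac)
  qed
  have fh: "factor1 d s \<zeta> b p holomorphic_on S" "factor2 d s \<zeta> b p holomorphic_on S" for p
    unfolding factor1_def factor2_def by (auto intro!: holomorphic_intros)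
  have "residue (\<lambda>x. f x / factor1 d s \<zeta> b q x) x = f x / (s * of_real (b q))"
  proof (rule residue_simple_quotient[OF S(1)])
    show "x \<in> S" using S(2) by (simp add: x_def)
    show "f holomorphic_on S"
      unfolding f_def numer_def using nz q(1)
      by (intro holomorphic_intros fh) (auto simp: finite_pos_weights)
    show "factor1 d s \<zeta> b q holomorphic_on S" by (rule fh)
    show "factor1 d s \<zeta> b q x = 0" using q(3) by (simp add: factor1_def zq x_def)
    show "(factor1 d s \<zeta> b q has_field_derivative s * of_real (b q)) (at x)"
      unfolding factor1_def using q(3) by (auto intro!: derivative_eq_intros simp: zq x_def)
    show "s * of_real (b q) \<noteq> 0" using s q by simp
    show "\<And>w. w \<in> S - {x} \<Longrightarrow> factor1 d s \<zeta> b q w \<noteq> 0" using nz[OF q(1)] by (auto simp: x_def)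
  qed
  moreover have "factor1 d s \<zeta> b p x = 1 - \<zeta> powi (- weight d p) * logpow s ((b q - b p) / b q)"
    "factor2 d s \<zeta> b p x = 1 - \<zeta> powi (weight d p) * logpow s ((b q + b p) / b q)" for p
    using q(3) by (simp_all add: factor1_def factor2_def logpow_def x_def field_simps)
  moreover have "factor2 d s \<zeta> b q x = 1 - t ^ 2"
    using q(2,3) by (simp add: factor2_def x_def s(1)[symmetric] exp_double[symmetric] mult.commute)
  moreover have "numer L s \<zeta> x = \<zeta> powi (- int L) * logpow s (- real L / b q) - \<zeta> ^ (L + 2) * logpow s (real (L + 2) / b q)"
    by (simp add: numer_def logpow_def x_def mult_ac)
  ultimately show ?thesis
    unfolding eq x_def[symmetric] using s(2) by (simp add: f_def mult_ac)
qed

section \<open>The limit of the perturbed sum\<close>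

lemma eventually_admissible: "eventually (\<lambda>b. b \<in> admissible r d) (weight_filter r d)"
  unfolding weight_filter_def eventually_inf_principal by simp

lemma eventually_weight_filter_open:
  assumes "open A" "restrict (\<lambda>p. real_of_int (weight d p)) (pos_weights r d) \<in> A"
  shows "eventually (\<lambda>b. b \<in> A) (weight_filter r d)"
  unfolding weight_filter_def eventually_inf_principal using eventually_nhds_in_open[OF assms] by eventually_elim auto

lemma tendsto_weight_filter:
  assumes "p \<in> pos_weights r d"
  shows "((\<lambda>b. b p) \<longlongrightarrow> real_of_int (weight d p)) (weight_filter r d)"
proof -
  let ?a = "restrict (\<lambda>p. real_of_int (weight d p)) (pos_weights r d)"
  have "isCont (\<lambda>b :: nat \<times> nat \<Rightarrow> real. b p) ?a"
    using continuous_on_product_coordinates[of p, where ?'b = real] unfolding continuous_on_eq_continuous_at[OF open_UNIV] by blast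
  hence "((\<lambda>b. b p) \<longlongrightarrow> ?a p) (nhds ?a)" 
    using tendsto_at_iff_tendsto_nhds[of "\<lambda>b. b p" ?a] unfolding isCont_def by blast
  thus ?thesis using assms unfolding weight_filter_def by (auto intro: tendsto_mono[OF inf_le1])
qed

lemma norm_powi_root:
  fixes z :: complex
  assumes "z powi k = 1" "k > 0"
  shows "norm z = 1"
proof -
  have "norm z ^ nat k = norm (z powi k)" using assms(2) by (simp add: power_int_nonneg_exp norm_power)
  thus ?thesis using power_eq_1_iff[of "norm z" "nat k"] assms by simp
qed

lemma eq_reciprocalI:
  fixes x :: complex
  assumes "of_real y * x = 1"
  shows "x = of_real (1 / y)"
proof -
  have "y \<noteq> 0" using assms by auto
  thus ?thesis using assms by (simp add: field_simps)
qed

definition summand ::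
  "nat \<Rightarrow> (nat \<Rightarrow> nat) \<Rightarrow> nat \<Rightarrow> complex \<Rightarrow> complex \<Rightarrow> (nat \<times> nat \<Rightarrow> real) \<Rightarrow> complex \<Rightarrow> nat \<times> nat \<Rightarrow> complex" where
  "summand r d L t s b \<zeta> q =
     (\<zeta> powi (- int L) * logpow s (- real L / b q)
           - \<zeta> ^ (L + 2) * logpow s (real (L + 2) / b q)) /
        (of_real (b q) * (1 - t ^ 2) * (1 - t) ^ num_even r d *
          (\<Prod>p\<in>pos_weights r d - {q}.
             (1 - \<zeta> powi (- weight d p) * logpow s ((b q - b p) / b q)) *
             (1 - \<zeta> powi (weight d p) * logpow s ((b q + b p) / b q))))"

text \<open>Continuity jointly in \<open>b\<close> and \<open>x\<close> is what later yields
  uniformity on a compact circle.\<close>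

lemma continuous_on_factors:
  "continuous_on A (\<lambda>y. factor1 d s \<zeta> (fst y) p (snd y))"
  "continuous_on A (\<lambda>y. factor2 d s \<zeta> (fst y) p (snd y))"
proof -
  have "continuous_on A (\<lambda>y :: (nat \<times> nat \<Rightarrow> real) \<times> complex. fst y p)"
    by (rule continuous_on_compose2[OF continuous_on_product_coordinates continuous_on_fst[OF continuous_on_id]]) auto
  thus "continuous_on A (\<lambda>y. factor1 d s \<zeta> (fst y) p (snd y))" "continuous_on A (\<lambda>y. factor2 d s \<zeta> (fst y) p (snd y))"
    unfolding factor1_def factor2_def by (intro continuous_intros; simp)+
qed

lemma tendsto_summands:
  assumes s: "exp s = t" and t: "0 < cmod t" "cmod t < 1" and a: "a \<in> weight d ` pos_weights r d" and \<zeta>: "\<zeta> powi a = 1"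
  defines "\<Lambda> \<equiv> {p \<in> pos_weights r d. weight d p = a}"
  shows "((\<lambda>b. \<Sum>q\<in>\<Lambda>. summand r d L t s b \<zeta> q) \<longlongrightarrow>
     residue (integrand r d L t) (\<zeta> * exp (s / of_int a)) / (1 - t) ^ num_even r d) (weight_filter r d)"
proof (cases "weight_filter r d = bot")
  \<comment> \<open>The limit theorem for contour integrals asks for a nontrivial filter; along
    \<open>bot\<close> every function tends to everything.\<close>
  case nontrivial: False
  let ?P = "pos_weights r d"
  let ?F = "weight_filter r d"
  define a0 where "a0 = restrict (\<lambda>p. real_of_int (weight d p)) ?P"
  define x0 where "x0 = complex_of_real (1 / of_int a)"
  have a_pos: "a > 0" using a weight_pos by auto
  have \<zeta>0: "\<zeta> \<noteq> 0" using \<zeta> a_pos by auto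
  have norm_\<zeta>: "norm \<zeta> = 1"
    using \<zeta> a_pos by (rule norm_powi_root)
  have Re_s: "Re s < 0" using t s by (metis exp_less_one_iff norm_exp_eq_Re)
  have s0: "s \<noteq> 0" using Re_s by auto
  have fin: "finite \<Lambda>" "\<Lambda> \<subseteq> ?P" using finite_pos_weights by (auto simp: \<Lambda>_def)
  have a0: "a0 p = of_int (weight d p)" if "p \<in> ?P" for p using that by (simp add: a0_def)
  \<comment> \<open>On \<open>Om\<close> a zero can only come from \<open>factor1\<close> with
    \<open>p \<in> \<Lambda>\<close>, and the bound \<open>2 * pi\<close> excludes all its zeros
    except \<open>b p * x = 1\<close>.\<close>
  define Om where "Om = (\<Inter>p\<in>?P - \<Lambda>. {y. factor1 d s \<zeta> (fst y) p (snd y) \<noteq> 0}) \<inter>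
     (\<Inter>p\<in>?P. {y. factor2 d s \<zeta> (fst y) p (snd y) \<noteq> 0}) \<inter>
     (\<Inter>p\<in>\<Lambda>. {y. norm (s * (1 - of_real (fst y p) * snd y)) < 2 * pi})"
  have "open Om"
  proof -
    have "open {y. factor1 d s \<zeta> (fst y) p (snd y) \<noteq> 0}" "open {y. factor2 d s \<zeta> (fst y) p (snd y) \<noteq> 0}" for p
      by (intro open_Collect_neq continuous_on_factors continuous_on_const)+
    moreover have "open {y :: (nat \<times> nat \<Rightarrow> real) \<times> complex. norm (s * (1 - of_real (fst y p) * snd y)) < 2 * pi}" for p
    proof -
      have "continuous_on UNIV (\<lambda>y :: (nat \<times> nat \<Rightarrow> real) \<times> complex. fst y p)"
        by (rule continuous_on_compose2[OF continuous_on_product_coordinates continuous_on_fst[OF continuous_on_id]]) auto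
      thus ?thesis by (intro open_Collect_less continuous_intros) simp_all
    qed
    ultimately show ?thesis unfolding Om_def using fin finite_pos_weights by (intro open_Int open_INT) auto
  qed
  moreover have "(a0, x0) \<in> Om"
  proof -
    \<comment> \<open>A factor vanishes only if its exponential term has modulus 1; as
      \<open>Re s < 0\<close>, this forces the real exponent \<open>u\<close> to be 0, which for
      \<open>factor1\<close> means equality of the weights and for \<open>factor2\<close> is
      impossible.\<close>
    have nr: "norm (\<zeta> powi k * exp (s * of_real u)) = exp (Re s * u)" for k u
      by (simp add: norm_mult norm_power_int norm_\<zeta>)
    have "factor1 d s \<zeta> a0 p x0 \<noteq> 0" if p: "p \<in> ?P - \<Lambda>" for p
    proof
      have "1 - of_real (a0 p) * x0 = of_real (1 - of_int (weight d p) / of_int a)"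
        using a0[of p] p by (simp add: x0_def)
      moreover assume "factor1 d s \<zeta> a0 p x0 = 0"
      ultimately have "\<zeta> powi (- weight d p) * exp (s * of_real (1 - of_int (weight d p) / of_int a)) = 1"
        by (simp add: factor1_def)
      hence "exp (Re s * (1 - of_int (weight d p) / of_int a)) = 1" using nr by (metis norm_one)
      hence "of_int (weight d p) = (of_int a :: real)" using Re_s a_pos by (auto simp: field_simps)
      thus False using p by (simp add: \<Lambda>_def)
    qed
    moreover have "factor2 d s \<zeta> a0 p x0 \<noteq> 0" if p: "p \<in> ?P" for p
    proof
      have "1 + of_real (a0 p) * x0 = of_real (1 + of_int (weight d p) / of_int a)"
        using a0[of p] p by (simp add: x0_def)
      moreover assume "factor2 d s \<zeta> a0 p x0 = 0"
      ultimately have "\<zeta> powi (weight d p) * exp (s * of_real (1 + of_int (weight d p) / of_int a)) = 1"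
        by (simp add: factor2_def)
      hence "exp (Re s * (1 + of_int (weight d p) / of_int a)) = 1" using nr by (metis norm_one)
      hence "1 + of_int (weight d p) / of_int a = (0 :: real)" using Re_s by auto
      moreover have "of_int (weight d p) / of_int a > (0 :: real)" using weight_pos[OF p] a_pos by simp
      ultimately show False by linarith
    qed
    moreover have "norm (s * (1 - of_real (a0 p) * x0)) < 2 * pi" if "p \<in> \<Lambda>" for p
      using that a_pos a0[of p] by (simp add: \<Lambda>_def x0_def)
    ultimately show ?thesis by (simp add: Om_def)
  qed
  ultimately obtain A B where AB: "open A" "open B" "a0 \<in> A" "x0 \<in> B" "A \<times> B \<subseteq> Om"
    using open_prod_elim[of Om "(a0, x0)"] by (metis mem_Sigma_iff)
  obtain R0 where R0: "R0 > 0" "ball x0 R0 \<subseteq> B" using AB openE by blast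
  \<comment> \<open>The bound \<open>pi / norm s\<close> makes the map from \<open>x\<close> to
    \<open>\<zeta> * exp (s * x)\<close> injective on the ball, whose points have distance less than
    \<open>2 * R\<close>.\<close>
  define R where "R = min R0 (pi / norm s)"
  have R: "R > 0" "ball x0 R \<subseteq> B" "norm s * R \<le> pi"
  proof -
    have "R \<le> R0" "R \<le> pi / norm s" by (simp_all add: R_def)
    thus "ball x0 R \<subseteq> B" "norm s * R \<le> pi" using R0 s0 by (auto simp: field_simps)
    show "R > 0" using R0 s0 by (simp add: R_def)
  qed
  define \<epsilon> where "\<epsilon> = R / 2"
  have \<epsilon>: "0 < \<epsilon>" "\<epsilon> < R" using R by (auto simp: \<epsilon>_def)
  have f1: "factor1 d s \<zeta> b p x = 0 \<longleftrightarrow> p \<in> \<Lambda> \<and> of_real (b p) * x = 1"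
    and f2: "factor2 d s \<zeta> b p x \<noteq> 0" if "p \<in> ?P" "b \<in> A" "x \<in> ball x0 R" for p b x
  proof -
    have Om: "(b, x) \<in> Om" using that AB R by blast
    show "factor2 d s \<zeta> b p x \<noteq> 0" using Om that by (auto simp: Om_def)
    show "factor1 d s \<zeta> b p x = 0 \<longleftrightarrow> p \<in> \<Lambda> \<and> of_real (b p) * x = 1"
    proof (cases "p \<in> \<Lambda>")
      case True
      hence "\<zeta> powi (- weight d p) = 1" using \<zeta> by (simp add: \<Lambda>_def power_int_minus)
      moreover have "norm (s * (1 - of_real (b p) * x)) < 2 * pi" using Om True by (auto simp: Om_def)
      ultimately show ?thesis using exp_eq_1_small[of "s * (1 - of_real (b p) * x)"] s0 True by (auto simp: factor1_def)
    next
      case False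
      thus ?thesis using Om that by (auto simp: Om_def)
    qed
  qed
  \<comment> \<open>Parameters whose poles \<open>1 / b p\<close> lie inside the circle. The limit
    \<open>a0\<close> belongs to \<open>U\<close> even when weights coincide; distinctness of the
    entries enters only in \<open>ev\<close>, where it separates the poles.\<close>
  define U where "U = {b \<in> A. \<forall>p\<in>\<Lambda>. b p > 0 \<and> of_real (1 / b p) \<in> ball x0 \<epsilon>}"
  have a0U: "a0 \<in> U"
    using AB(3) fin(2) a0 a_pos \<epsilon> by (auto simp: U_def \<Lambda>_def x0_def)
  have evU: "eventually (\<lambda>b. b \<in> U) ?F"
  proof -
    have "eventually (\<lambda>b. of_real (1 / b p) \<in> ball x0 \<epsilon>) ?F" if p: "p \<in> \<Lambda>" for p
    proof -
      have "((\<lambda>b. complex_of_real (1 / b p)) \<longlongrightarrow> of_real (1 / of_int (weight d p))) ?F"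
        using p fin(2) a_pos by (intro tendsto_intros tendsto_weight_filter) (auto simp: \<Lambda>_def)
      thus ?thesis using p \<epsilon> by (intro topological_tendstoD[of _ x0]) (auto simp: \<Lambda>_def x0_def)
    qed
    hence "eventually (\<lambda>b. \<forall>p\<in>\<Lambda>. of_real (1 / b p) \<in> ball x0 \<epsilon>) ?F" by (intro eventually_ball_finite fin) auto
    moreover have "eventually (\<lambda>b. b \<in> A) ?F" using AB by (intro eventually_weight_filter_open) (auto simp: a0_def)
    ultimately show ?thesis using eventually_admissible
      by eventually_elim (use fin(2) in \<open>auto simp: U_def admissible_def\<close>)
  qed
  have nz_circle: "factor1 d s \<zeta> b p x \<noteq> 0 \<and> factor2 d s \<zeta> b p x \<noteq> 0" if "b \<in> U" "x \<in> sphere x0 \<epsilon>" "p \<in> ?P" for b p x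
  proof -
    have x: "x \<in> ball x0 R" using that \<epsilon> by auto
    have "of_real (b p) * x \<noteq> 1" if p: "p \<in> \<Lambda>"
    proof
      assume "of_real (b p) * x = 1"
      hence "x = of_real (1 / b p)" by (rule eq_reciprocalI)
      hence "x \<in> ball x0 \<epsilon>" using \<open>b \<in> U\<close> p by (auto simp: U_def)
      thus False using \<open>x \<in> sphere x0 \<epsilon>\<close> by auto
    qed
    thus ?thesis using f1[of p b x] f2[of p b x] x that by (auto simp: U_def)
  qed
  have cont: "continuous_on (U \<times> sphere x0 \<epsilon>) (\<lambda>y. perturbed r d L s \<zeta> (fst y) (snd y))"
    unfolding perturbed_def numer_def
    by (intro continuous_intros continuous_on_factors) (use nz_circle finite_pos_weights in \<open>auto simp del: sphere_def\<close>)
  have int: "perturbed r d L s \<zeta> b contour_integrable_on circlepath x0 \<epsilon>" if "b \<in> U" for b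
  proof (rule contour_integrable_continuous_circlepath)
    have "continuous_on (sphere x0 \<epsilon>) (\<lambda>x. perturbed r d L s \<zeta> (fst (b, x)) (snd (b, x)))"
      by (rule continuous_on_compose2[OF cont]) (use that in \<open>auto intro!: continuous_intros\<close>)
    thus "continuous_on (path_image (circlepath x0 \<epsilon>)) (perturbed r d L s \<zeta> b)" using \<epsilon> by simp
  qed
  have lim: "((\<lambda>b. contour_integral (circlepath x0 \<epsilon>) (perturbed r d L s \<zeta> b)) \<longlongrightarrow>
      contour_integral (circlepath x0 \<epsilon>) (perturbed r d L s \<zeta> a0)) ?F"
  proof (rule contour_integral_uniform_limit_circlepath(2))
    show "eventually (\<lambda>b. perturbed r d L s \<zeta> b contour_integrable_on circlepath x0 \<epsilon>) ?F"
      using evU by eventually_elim (rule int)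
    \<comment> \<open>Joint continuity on \<open>U\<close> times the compact circle gives uniformity
      in \<open>x\<close> near \<open>a0\<close>.\<close>
    show "uniform_limit (sphere x0 \<epsilon>) (perturbed r d L s \<zeta>) (perturbed r d L s \<zeta> a0) ?F"
    proof (rule uniform_limitI)
      fix e :: real assume "e > 0"
      hence "e / 2 > 0" by simp
      obtain X where X: "a0 \<in> X" "open X"
        and "\<forall>b\<in>X \<inter> U. \<forall>x\<in>sphere x0 \<epsilon>. dist (perturbed r d L s \<zeta> (fst (b, x)) (snd (b, x)))
          (perturbed r d L s \<zeta> (fst (a0, x)) (snd (a0, x))) \<le> e / 2"
        by (rule continuous_on_prod_compactE[OF cont compact_sphere a0U \<open>e / 2 > 0\<close>]) (rule that)
      hence le: "dist (perturbed r d L s \<zeta> b x) (perturbed r d L s \<zeta> a0 x) \<le> e / 2"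
        if "b \<in> X" "b \<in> U" "x \<in> sphere x0 \<epsilon>" for b x using that by (simp only: fst_conv snd_conv) blast
      have "eventually (\<lambda>b. b \<in> X) ?F" using X by (intro eventually_weight_filter_open) (auto simp: a0_def)
      with evU show "\<forall>\<^sub>F b in ?F. \<forall>x\<in>sphere x0 \<epsilon>. dist (perturbed r d L s \<zeta> b x) (perturbed r d L s \<zeta> a0 x) < e"
      proof eventually_elim
        case (elim b)
        show ?case using le[OF elim(2,1)] \<open>e > 0\<close> by (smt (verit) field_sum_of_halves)
      qed
    qed
  qed (use nontrivial \<epsilon> in auto)
  have t2: "t ^ 2 \<noteq> 1"
  proof
    assume "t ^ 2 = 1"
    hence "norm t ^ 2 = 1" by (metis norm_one norm_power)
    thus False using t power_eq_1_iff[of "norm t" 2] by simp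
  qed
  have ev: "eventually (\<lambda>b. s * contour_integral (circlepath x0 \<epsilon>) (perturbed r d L s \<zeta> b) / (2 * of_real pi * \<i>) / (1 - t) ^ num_even r d =
      (\<Sum>q\<in>\<Lambda>. summand r d L t s b \<zeta> q)) ?F"
    using evU eventually_admissible
  proof eventually_elim
    case (elim b)
    define pt where "pt q = complex_of_real (1 / b q)" for q
    have inj: "inj_on pt \<Lambda>"
      using elim(2) fin(2) by (auto simp: inj_on_def pt_def admissible_def)
    have bA: "b \<in> A" and bpos: "b p > 0" and ptb: "pt p \<in> ball x0 \<epsilon>" if "p \<in> \<Lambda>" for p
      using elim(1) that by (auto simp: U_def pt_def)
    have zero: "x = pt p" if "of_real (b p) * x = 1" for p x
      unfolding pt_def using that by (rule eq_reciprocalI)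
    have bA: "b \<in> A" using elim(1) by (simp add: U_def)
    have holo: "perturbed r d L s \<zeta> b holomorphic_on ball x0 R - pt ` \<Lambda>"
    proof -
      have nz: "factor1 d s \<zeta> b p x * factor2 d s \<zeta> b p x \<noteq> 0" if "p \<in> ?P" "x \<in> ball x0 R - pt ` \<Lambda>" for p x
      proof -
        have "\<not> (p \<in> \<Lambda> \<and> of_real (b p) * x = 1)" using zero[of p x] that(2) by blast
        thus ?thesis using f1[OF that(1) bA, of x] f2[OF that(1) bA, of x] that(2) by simp
      qed
      have nzp: "(\<Prod>p\<in>?P. factor1 d s \<zeta> b p x * factor2 d s \<zeta> b p x) \<noteq> 0" if "x \<in> ball x0 R - pt ` \<Lambda>" for x
        using nz[OF _ that] finite_pos_weights[of r d] by (simp only: prod_zero_iff) blast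
      have "numer L s \<zeta> holomorphic_on S" "factor1 d s \<zeta> b p holomorphic_on S" "factor2 d s \<zeta> b p holomorphic_on S" for p S
        unfolding numer_def factor1_def factor2_def by (intro holomorphic_intros)+
      thus ?thesis
        unfolding perturbed_def[abs_def]
        by (intro holomorphic_on_divide holomorphic_on_prod holomorphic_on_mult nzp)
    qed
    have "contour_integral (circlepath x0 \<epsilon>) (perturbed r d L s \<zeta> b) =
      2 * pi * \<i> * (\<Sum>z\<in>pt ` \<Lambda>. winding_number (circlepath x0 \<epsilon>) z * residue (perturbed r d L s \<zeta> b) z)"
    proof (rule Residue_theorem[of "ball x0 R"])
      show "path_image (circlepath x0 \<epsilon>) \<subseteq> ball x0 R - pt ` \<Lambda>"
        using \<epsilon> ptb by fastforce
      show "\<forall>z. z \<notin> ball x0 R \<longrightarrow> winding_number (circlepath x0 \<epsilon>) z = 0"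
        using \<epsilon> by (auto intro!: winding_number_zero_outside[of _ "cball x0 \<epsilon>"])
    qed (use fin holo in auto)
    also have "(\<Sum>z\<in>pt ` \<Lambda>. winding_number (circlepath x0 \<epsilon>) z * residue (perturbed r d L s \<zeta> b) z) =
        (\<Sum>q\<in>\<Lambda>. residue (perturbed r d L s \<zeta> b) (pt q))"
      unfolding sum.reindex[OF inj] o_def
    proof (rule sum.cong)
      fix q assume "q \<in> \<Lambda>"
      hence "winding_number (circlepath x0 \<epsilon>) (pt q) = 1"
        using ptb[of q] by (intro winding_number_circlepath) (simp add: dist_norm norm_minus_commute)
      thus "winding_number (circlepath x0 \<epsilon>) (pt q) * residue (perturbed r d L s \<zeta> b) (pt q) = residue (perturbed r d L s \<zeta> b) (pt q)"
        by simp
    qed simp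
    finally have "contour_integral (circlepath x0 \<epsilon>) (perturbed r d L s \<zeta> b) =
      2 * of_real pi * \<i> * (\<Sum>q\<in>\<Lambda>. residue (perturbed r d L s \<zeta> b) (pt q))" by simp
    moreover have "s * (c * X) / c / Y = s * X / Y" if "c \<noteq> 0" for c X Y :: complex using that by simp
    from this[of "2 * of_real pi * \<i>"] have "s * (2 * of_real pi * \<i> * X) / (2 * of_real pi * \<i>) / Y = s * X / Y" for X Y by simp
    ultimately have "s * contour_integral (circlepath x0 \<epsilon>) (perturbed r d L s \<zeta> b) / (2 * of_real pi * \<i>) / (1 - t) ^ num_even r d =
        s * (\<Sum>q\<in>\<Lambda>. residue (perturbed r d L s \<zeta> b) (pt q)) / (1 - t) ^ num_even r d"
      by (simp only:)
    also have "\<dots> = (\<Sum>q\<in>\<Lambda>. s * residue (perturbed r d L s \<zeta> b) (pt q) / (1 - t) ^ num_even r d)"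
      by (simp only: sum_distrib_left sum_divide_distrib)
    also have "\<dots> = (\<Sum>q\<in>\<Lambda>. summand r d L t s b \<zeta> q)"
    proof (rule sum.cong)
      fix q assume q: "q \<in> \<Lambda>"
      show "s * residue (perturbed r d L s \<zeta> b) (pt q) / (1 - t) ^ num_even r d = summand r d L t s b \<zeta> q"
        unfolding pt_def summand_def
      \<comment> \<open>Deleting the other poles leaves \<open>pt q\<close> as the only zero of any
        \<open>factor1\<close> in the set.\<close>
      proof (rule residue_perturbed[where S = "ball x0 R - pt ` (\<Lambda> - {q})"])
        show "open (ball x0 R - pt ` (\<Lambda> - {q}))" using fin by (intro open_Diff finite_imp_closed) auto
        have "pt q \<notin> pt ` (\<Lambda> - {q})" using inj q by (auto simp: inj_on_def)
        thus "of_real (1 / b q) \<in> ball x0 R - pt ` (\<Lambda> - {q})"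
          using ptb[OF q] \<epsilon> by (auto simp: pt_def[symmetric] simp del: of_real_divide)
        show "factor2 d s \<zeta> b p x \<noteq> 0 \<and> (factor1 d s \<zeta> b p x = 0 \<longrightarrow> p = q \<and> x = of_real (1 / b q))"
          if p: "p \<in> ?P" and x: "x \<in> ball x0 R - pt ` (\<Lambda> - {q})" for p x
          using f1[OF p bA] f2[OF p bA] x zero[of p x] unfolding pt_def[symmetric] by blast
      qed (use q fin(2) \<zeta> bpos s s0 t2 in \<open>auto simp: \<Lambda>_def\<close>)
    qed simp
    finally show ?case .
  qed
  \<comment> \<open>At the weights themselves the poles from \<open>\<Lambda>\<close> merge at
    \<open>x0\<close>, and \<open>\<phi>\<close> carries the integral back to the variable
    \<open>z\<close>, where it is the residue at \<open>\<phi> x0\<close>.\<close>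
  define \<phi> where "\<phi> = (\<lambda>x. \<zeta> * exp (s * x))"
  have phi_deriv: "deriv \<phi> x = s * \<phi> x" for x
    unfolding \<phi>_def by (rule DERIV_imp_deriv) (auto intro!: derivative_eq_intros)
  have "s * contour_integral (circlepath x0 \<epsilon>) (perturbed r d L s \<zeta> a0) =
      contour_integral (circlepath x0 \<epsilon>) (\<lambda>x. s * perturbed r d L s \<zeta> a0 x)"
    by (rule contour_integral_lmul[OF int[OF a0U], symmetric])
  also have "(\<lambda>x. s * perturbed r d L s \<zeta> a0 x) = (\<lambda>x. deriv \<phi> x * integrand r d L t (\<phi> x))"
    unfolding phi_deriv using perturbed_at_weights[of \<zeta> r d a0 t s L, OF \<zeta>0 a0 s[symmetric]]
    by (simp add: \<phi>_def mult.assoc)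
  also have "contour_integral (circlepath x0 \<epsilon>) \<dots> = 2 * of_real pi * \<i> * residue (integrand r d L t) (\<phi> x0)"
  proof (rule residue_change_of_variables[of _ _ R])
    show "\<phi> holomorphic_on ball x0 R" unfolding \<phi>_def by (intro holomorphic_intros)
    show inj: "inj_on \<phi> (ball x0 R)"
    proof (rule inj_onI)
      fix x y assume xy: "x \<in> ball x0 R" "y \<in> ball x0 R" "\<phi> x = \<phi> y"
      have "exp (s * (x - y)) = 1" using xy(3) \<zeta>0 by (simp add: \<phi>_def right_diff_distrib exp_diff)
      moreover have "norm (s * (x - y)) < 2 * pi"
      proof -
        have "norm (x - y) < 2 * R" using xy(1,2) dist_triangle_half_r[of x0 x "2 * R" y] by (simp add: dist_norm)
        hence "norm s * norm (x - y) < norm s * (2 * R)" using s0 by simp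
        thus ?thesis using R(3) by (simp add: norm_mult)
      qed
      ultimately have "s * (x - y) = 0" by (rule exp_eq_1_small)
      thus "x = y" using s0 by simp
    qed
    show "integrand r d L t holomorphic_on \<phi> ` ball x0 R - {\<phi> x0}"
    proof (rule integrand_holomorphic)
      show "0 \<notin> \<phi> ` ball x0 R - {\<phi> x0}" using \<zeta>0 by (auto simp: \<phi>_def)
      fix z p assume "z \<in> \<phi> ` ball x0 R - {\<phi> x0}" and p: "p \<in> ?P"
      then obtain x where x: "x \<in> ball x0 R" "z = \<phi> x" "x \<noteq> x0" by blast
      have "\<not> (p \<in> \<Lambda> \<and> of_real (a0 p) * x = 1)"
        using x(3) a0[OF p] a_pos by (auto simp: \<Lambda>_def x0_def field_simps)
      hence "factor1 d s \<zeta> a0 p x \<noteq> 0" "factor2 d s \<zeta> a0 p x \<noteq> 0" using f1[OF p AB(3) x(1)] f2[OF p AB(3) x(1)] by auto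
      moreover have z0: "z \<noteq> 0" using x \<zeta>0 by (simp add: \<phi>_def)
      moreover have zp: "z powi k = \<zeta> powi k * exp (of_int k * s * x)" for k
        by (simp add: x(2) \<phi>_def power_int_mult_distrib exp_power_int mult_ac)
      have "factor1 d s \<zeta> a0 p x = 1 - t * z powi (- weight d p)" "factor2 d s \<zeta> a0 p x = 1 - t * z powi weight d p"
        by (simp_all add: factor1_def factor2_def zp a0[OF p] s[symmetric] exp_add[symmetric] algebra_simps
            flip: exp_minus exp_diff)
      ultimately show "z powi weight d p \<noteq> t \<and> t * z powi weight d p \<noteq> 1"
        by (auto simp: power_int_minus)
    qed
  qed (use \<epsilon> in auto)
  also have "\<phi> x0 = \<zeta> * exp (s / of_int a)" by (simp add: \<phi>_def x0_def)
  finally have I0: "s * contour_integral (circlepath x0 \<epsilon>) (perturbed r d L s \<zeta> a0) / (2 * of_real pi * \<i>) =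
      residue (integrand r d L t) (\<zeta> * exp (s / of_int a))" by simp
  have "t \<noteq> 1" using t by auto
  hence "((\<lambda>b. s * contour_integral (circlepath x0 \<epsilon>) (perturbed r d L s \<zeta> b) / (2 * of_real pi * \<i>) / (1 - t) ^ num_even r d) \<longlongrightarrow>
      s * contour_integral (circlepath x0 \<epsilon>) (perturbed r d L s \<zeta> a0) / (2 * of_real pi * \<i>) / (1 - t) ^ num_even r d) ?F"
    by (intro tendsto_intros lim) auto
  from Lim_transform_eventually[OF this ev] show ?thesis by (simp only: I0)
qed simp

text \<open>A pole determines its pair \<open>(a, \<zeta>)\<close>: its modulus is
  \<open>exp (Re s / a)\<close>, strictly monotone in \<open>a\<close> as \<open>Re s < 0\<close>,
  and then \<open>\<zeta>\<close> is a quotient. So poles of different weights never collide and no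
  residue is counted twice.\<close>

lemma sum_poles:
  assumes s: "exp s = t" and t: "0 < cmod t" "cmod t < 1"
  shows "(\<Sum>a\<in>weight d ` pos_weights r d. \<Sum>\<zeta>\<in>{\<zeta>. \<zeta> powi a = 1}. g (\<zeta> * exp (s / of_int a))) = (\<Sum>z\<in>poles r d t. g z)"
proof -
  have pos: "a > 0" if "a \<in> weight d ` pos_weights r d" for a using that weight_pos by auto
  have Re_s: "Re s < 0" using t s by (metis exp_less_one_iff norm_exp_eq_Re)
  have "bij_betw (\<lambda>(a, \<zeta>). \<zeta> * exp (s / of_int a)) (SIGMA a:weight d ` pos_weights r d. {\<zeta>. \<zeta> powi a = 1}) (poles r d t)"
    unfolding bij_betw_def
  proof
    show "inj_on (\<lambda>(a, \<zeta>). \<zeta> * exp (s / of_int a)) (SIGMA a:weight d ` pos_weights r d. {\<zeta>. \<zeta> powi a = 1})"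
    proof (rule inj_onI, clarsimp)
      fix p q \<zeta> \<xi> assume p: "p \<in> pos_weights r d" "\<zeta> powi weight d p = 1" and q: "q \<in> pos_weights r d" "\<xi> powi weight d q = 1"
        and eq: "\<zeta> * exp (s / of_int (weight d p)) = \<xi> * exp (s / of_int (weight d q))"
      have ne: "norm (exp (s / of_int k)) = exp (Re s / of_int k)" for k :: int
        by (metis Re_divide_of_real norm_exp_eq_Re of_real_of_int_eq)
      have "exp (Re s / of_int (weight d p)) = exp (Re s / of_int (weight d q))"
        using arg_cong[OF eq, of norm] norm_powi_root[OF p(2)] norm_powi_root[OF q(2)] weight_pos p(1) q(1) by (simp add: norm_mult ne)
      hence "Re s / of_int (weight d p) = Re s / of_int (weight d q)" by simp
      hence "weight d p = weight d q" using Re_s weight_pos[OF p(1)] weight_pos[OF q(1)] by (simp add: field_simps)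
      thus "weight d p = weight d q \<and> \<zeta> = \<xi>" using eq by simp
    qed
    have root: "exp (s / of_int a) powi a = t" if "a > 0" for a
      using that by (simp add: s[symmetric] exp_power_int)
    show "(\<lambda>(a, \<zeta>). \<zeta> * exp (s / of_int a)) ` (SIGMA a:weight d ` pos_weights r d. {\<zeta>. \<zeta> powi a = 1}) = poles r d t"
    proof (intro equalityI subsetI)
      fix z assume "z \<in> (\<lambda>(a, \<zeta>). \<zeta> * exp (s / of_int a)) ` (SIGMA a:weight d ` pos_weights r d. {\<zeta>. \<zeta> powi a = 1})"
      thus "z \<in> poles r d t" using weight_pos by (force simp: poles_def power_int_mult_distrib root)
    next
      fix z assume "z \<in> poles r d t"
      then obtain p where p: "p \<in> pos_weights r d" "z powi weight d p = t" by (auto simp: poles_def)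
      define a where "a = weight d p"
      define \<zeta> where "\<zeta> = z / exp (s / of_int a)"
      have "\<zeta> powi a = 1"
        using p weight_pos[OF p(1)] t by (simp add: \<zeta>_def a_def power_int_divide_distrib root)
      moreover have "z = \<zeta> * exp (s / of_int a)" by (simp add: \<zeta>_def)
      ultimately show "z \<in> (\<lambda>(a, \<zeta>). \<zeta> * exp (s / of_int a)) ` (SIGMA a:weight d ` pos_weights r d. {\<zeta>. \<zeta> powi a = 1})"
        using p(1) by (intro image_eqI[of _ _ "(a, \<zeta>)"]) (auto simp: a_def)
    qed
  qed
  from sum.reindex_bij_betw[OF this, of g] show ?thesis
    using finite_pos_weights finite_powi_roots pos by (subst sum.Sigma) (auto simp: case_prod_unfold)
qed

lemma tendsto_perturbed_sum:
  assumes "exp s = t" "0 < cmod t" "cmod t < 1"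
  shows "(perturbed_sum r d L t s \<longlongrightarrow> (\<Sum>z\<in>poles r d t. residue (integrand r d L t) z) / (1 - t) ^ num_even r d) (weight_filter r d)"
proof -
  \<comment> \<open>The sum over \<open>q\<close> with equal weight is moved innermost, with
    \<open>a\<close> and \<open>\<zeta>\<close> fixed: this is the total for which
    \<open>tendsto_summands\<close> gives a limit.\<close>
  have eq: "perturbed_sum r d L t s b =
     (\<Sum>a\<in>weight d ` pos_weights r d. \<Sum>\<zeta>\<in>{\<zeta>. \<zeta> powi a = 1}. \<Sum>q\<in>{p \<in> pos_weights r d. weight d p = a}. summand r d L t s b \<zeta> q)" for b
  proof -
    have "perturbed_sum r d L t s b =
       (\<Sum>q\<in>pos_weights r d. \<Sum>\<zeta>\<in>{\<zeta>. \<zeta> powi weight d q = 1}. summand r d L t s b \<zeta> q)"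
      by (simp only: perturbed_sum_def summand_def)
    also have "\<dots> = (\<Sum>a\<in>weight d ` pos_weights r d. \<Sum>q\<in>{p \<in> pos_weights r d. weight d p = a}.
        \<Sum>\<zeta>\<in>{\<zeta>. \<zeta> powi weight d q = 1}. summand r d L t s b \<zeta> q)"
      by (rule sum.image_gen[OF finite_pos_weights])
    also have "\<dots> = (\<Sum>a\<in>weight d ` pos_weights r d. \<Sum>q\<in>{p \<in> pos_weights r d. weight d p = a}.
        \<Sum>\<zeta>\<in>{\<zeta>. \<zeta> powi a = 1}. summand r d L t s b \<zeta> q)" by (intro sum.cong) auto
    finally show ?thesis by (subst (asm) sum.swap)
  qed
  have "((\<lambda>b. \<Sum>a\<in>weight d ` pos_weights r d. \<Sum>\<zeta>\<in>{\<zeta>. \<zeta> powi a = 1}.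
        \<Sum>q\<in>{p \<in> pos_weights r d. weight d p = a}. summand r d L t s b \<zeta> q) \<longlongrightarrow>
      (\<Sum>a\<in>weight d ` pos_weights r d. \<Sum>\<zeta>\<in>{\<zeta>. \<zeta> powi a = 1}.
        residue (integrand r d L t) (\<zeta> * exp (s / of_int a)) / (1 - t) ^ num_even r d)) (weight_filter r d)"
    by (intro tendsto_sum tendsto_summands assms) auto
  thus ?thesis
    unfolding eq[symmetric] sum_divide_distrib
      sum_poles[OF assms, of "\<lambda>z. residue (integrand r d L t) z / (1 - t) ^ num_even r d"] .
qed

theorem theorem3p4:
  fixes r L :: nat and d :: "nat \<Rightarrow> nat" and t s :: complex
  assumes "r \<ge> 1"
    and "rep_invariants r d = {0}"
    and "0 < cmod t" and "cmod t < 1"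
    and "exp s = t"
  shows "summable (\<lambda>n. of_nat (cfun.dim (covariants r d L n)) * t ^ n) \<and>
    (\<exists>F. (perturbed_sum r d L t s \<longlongrightarrow> F) (weight_filter r d) \<and>
      (nu r d L \<le> 0 \<longrightarrow> hilb r d L t = F) \<and>
      (nu r d L > 0 \<longrightarrow> hilb r d L t =
         F + (-1) ^ card (pos_weights r d) / (1 - t) ^ num_even r d *
           (\<Sum>(I, J)\<in>exponent_pairs r d L.
              \<Prod>p\<in>pos_weights r d. t powi (int (I p) - int (J p) - 1))))"
proof (intro conjI exI)
  \<comment> \<open>The limit is the contribution of the nonzero poles; the pole 0 contributes the
    sum over \<open>exponent_pairs\<close>, which is empty when \<open>nu r d L \<le> 0\<close>, so
    one formula covers both cases.\<close>
  let ?F = "(\<Sum>z\<in>poles r d t. residue (integrand r d L t) z) / (1 - t) ^ num_even r d"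
  let ?S = "\<Sum>(I, J)\<in>exponent_pairs r d L. \<Prod>p\<in>pos_weights r d. t powi (int (I p) - int (J p) - 1)"
  have t0: "t \<noteq> 0" using assms(3) by auto
  note sums = sums_dim_covariants[OF assms(4), of r d L]
  show "summable (\<lambda>n. of_nat (cfun.dim (covariants r d L n)) * t ^ n)" using sums by (rule sums_summable)
  have "hilb r d L t = contour_integral (circlepath 0 1) (integrand r d L t) / (2 * of_real pi * \<i>) / (1 - t) ^ num_even r d"
    unfolding hilb_def using sums by (rule sums_unique[symmetric])
  also have "\<dots> = (residue (integrand r d L t) 0 + (\<Sum>z\<in>poles r d t. residue (integrand r d L t) z)) / (1 - t) ^ num_even r d"
    by (simp add: contour_integral_integrand[OF t0 assms(4)])
  also have "\<dots> = ?F + (-1) ^ card (pos_weights r d) / (1 - t) ^ num_even r d * ?S"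
    by (simp add: residue_integrand_0[OF t0 assms(4)] add_divide_distrib)
  finally have hilb: "hilb r d L t = ?F + (-1) ^ card (pos_weights r d) / (1 - t) ^ num_even r d * ?S" .
  show "(perturbed_sum r d L t s \<longlongrightarrow> ?F) (weight_filter r d)" by (rule tendsto_perturbed_sum[OF assms(5,3,4)])
  show "nu r d L \<le> 0 \<longrightarrow> hilb r d L t = ?F" using hilb by (simp add: exponent_pairs_empty)
  show "nu r d L > 0 \<longrightarrow> hilb r d L t = ?F + (-1) ^ card (pos_weights r d) / (1 - t) ^ num_even r d * ?S" using hilb by blast
qed

end
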